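(* Let $G$ be a Lie group with Lie algebra $\mathfrak{g}=T_eG$, let $L:TG\to\mathbb{R}$ be a right-invariant Lagrangian, and let $l:=L|_{\mathfrak{g}}:\mathfrak{g}\to\mathbb{R}$ be its restriction to $\mathfrak{g}$. For a curve $g(t)\in G$, $t\in[a,b]$, let $$\xi(t)=\dot g(t)\, g(t)^{-1}:=T_{g(t)}R_{g(t)^{-1}}\,\dot g(t)\in\mathfrak{g}.$$ Then the following four statements are equivalent: (i) $g(t)$ satisfies the Euler--Lagrange equations for the Lagrangian $L$ on $G$. (ii) The variational principle $\delta\int_a^b L(g(t),\dot g(t))\,dt=0$ holds for variations of $g(t)$ with fixed endpoints. (iii) The (right-invariant) Euler--Poincaré equations hold: $$\frac{d}{dt}\frac{\delta l}{\delta\xi}=-\,\mathrm{ad}^*_\xi\,\frac{\delta l}{\delta\xi}.$$ (iv) The variational principle $\delta\int_a^b l(\xi(t))\,dt=0$ holds on $\mathfrak{g}$, using variations of the form $\delta\xi=\dot\eta-[\xi,\eta]$, where $\eta(t)$ is an arbitrary path in $\mathfrak{g}$ which vanishes at the endpoints, i.e. $\eta(a)=\eta(b)=0$.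
   Context: $R_h:G\to G$, $R_h(g)=gh$, is right translation. The Lagrangian $L$ is right-invariant if $L(T_gR_h(v))=L(v)$ for all $g,h\in G$ and all $v\in T_gG$. Lagrangians and curves are smooth. The bracket $[\cdot,\cdot]$ on $\mathfrak{g}$ is the standard Lie algebra bracket (the one obtained from left-invariant vector fields; for matrix groups it is the matrix commutator $[\xi,\eta]=\xi\eta-\eta\xi$), and $\mathrm{ad}_\xi\eta=[\xi,\eta]$. With $\langle\cdot,\cdot\rangle:\mathfrak{g}^*\times\mathfrak{g}\to\mathbb{R}$ the natural pairing, $\mathrm{ad}^*_\xi:\mathfrak{g}^*\to\mathfrak{g}^*$ is defined by $\langle\mathrm{ad}^*_\xi\mu,\eta\rangle=\langle\mu,\mathrm{ad}_\xi\eta\rangle$. The functional derivative $\delta l/\delta\xi\in\mathfrak{g}^*$ is defined by $\langle \delta l/\delta\xi,\delta\xi\rangle=\frac{d}{d\epsilon}\big|_{\epsilon=0}l(\xi+\epsilon\,\delta\xi)$ for all $\delta\xi\in\mathfrak{g}$. In (iv), the principle means that $\int_a^b\langle \delta l/\delta\xi,\delta\xi\rangle\,dt=0$ for all $\delta\xi$ of the stated form. *)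

theory Defs
  imports "HOL-Analysis.Analysis" "HOL-Algebra.Group"
begin

section \<open>Smooth maps between normed spaces\<close>

text \<open>On an open set of a finite-dimensional space this is the usual class \<open>C\<^sup>n\<close>:
  all iterated directional derivatives of order at most \<open>n\<close> are continuous.\<close>

primrec Ck_on :: "nat \<Rightarrow> 'x::real_normed_vector set \<Rightarrow> ('x \<Rightarrow> 'y::real_normed_vector) \<Rightarrow> bool" where
  "Ck_on 0 S f \<longleftrightarrow> continuous_on S f"
| "Ck_on (Suc n) S f \<longleftrightarrow> (\<forall>x\<in>S. f differentiable (at x)) \<and>
     (\<forall>v. Ck_on n S (\<lambda>x. frechet_derivative f (at x) v))"

text \<open>Smoothness on an arbitrary set, in particular on a compact interval, means existence of a
  smooth extension to an open neighbourhood.\<close>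

definition smooth_on :: "'x::real_normed_vector set \<Rightarrow> ('x \<Rightarrow> 'y::real_normed_vector) \<Rightarrow> bool" where
  "smooth_on X f \<longleftrightarrow>
     (\<exists>S h. open S \<and> X \<subseteq> S \<and> (\<forall>x\<in>X. h x = f x) \<and> (\<forall>n. Ck_on n S h))"

section \<open>Smooth manifolds\<close>

text \<open>A chart is its domain together with the coordinate map; the values of the coordinate map
  outside the domain are irrelevant.\<close>

type_synonym ('a, 'e) chart = "'a set \<times> ('a \<Rightarrow> 'e)"

definition chart_inv :: "('a, 'e) chart \<Rightarrow> 'e \<Rightarrow> 'a" where
  "chart_inv c = inv_into (fst c) (snd c)"

text \<open>The model space is a finite-dimensional normed space rather than a type of class
  \<^class>\<open>euclidean_space\<close>, because the latter excludes dimension zero. The atlas \<open>A\<close> need not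
  be maximal.\<close>

locale smooth_manifold =
  fixes T :: "'a topology" and A :: "('a, 'e::real_normed_vector) chart set"
  assumes finite_dimensional_model: "\<exists>B::'e set. finite B \<and> span B = UNIV"
    and Hausdorff: "Hausdorff_space T"
    and second_countable: "second_countable T"
    and charts_cover: "\<Union>(fst ` A) = topspace T"
    and chart_dom_open: "c \<in> A \<Longrightarrow> openin T (fst c)"
    and chart_image_open: "c \<in> A \<Longrightarrow> open (snd c ` fst c)"
    and chart_homeomorphic: "c \<in> A \<Longrightarrow>
      homeomorphic_map (subtopology T (fst c)) (top_of_set (snd c ` fst c)) (snd c)"
    and charts_compatible: "c \<in> A \<Longrightarrow> d \<in> A \<Longrightarrow>
      smooth_on (snd c ` (fst c \<inter> fst d)) (snd d \<circ> chart_inv c)"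

definition smooth_map ::
  "'a topology \<Rightarrow> ('a, 'e::real_normed_vector) chart set \<Rightarrow>
   'b topology \<Rightarrow> ('b, 'f::real_normed_vector) chart set \<Rightarrow> ('a \<Rightarrow> 'b) \<Rightarrow> bool" where
  "smooth_map T A T' A' f \<longleftrightarrow> continuous_map T T' f \<and>
     (\<forall>c\<in>A. \<forall>d\<in>A'. smooth_on (snd c ` (fst c \<inter> f -` fst d)) (snd d \<circ> f \<circ> chart_inv c))"

definition prod_atlas ::
  "('a, 'e) chart set \<Rightarrow> ('b, 'f) chart set \<Rightarrow> ('a \<times> 'b, 'e \<times> 'f) chart set" where
  "prod_atlas A B = (\<lambda>(c, d). (fst c \<times> fst d, map_prod (snd c) (snd d))) ` (A \<times> B)"

definition smooth_into ::
  "'a topology \<Rightarrow> ('a, 'e::real_normed_vector) chart set \<Rightarrow>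
   'x::real_normed_vector set \<Rightarrow> ('x \<Rightarrow> 'a) \<Rightarrow> bool" where
  "smooth_into T A X f \<longleftrightarrow>
     (\<exists>S h. open S \<and> X \<subseteq> S \<and> (\<forall>x\<in>X. h x = f x) \<and> smooth_map (top_of_set S) {(S, id)} T A h)"

section \<open>Tangent vectors\<close>

text \<open>A tangent vector at \<open>x\<close> is the family of its coordinate vectors in all charts around \<open>x\<close>,
  related by the derivatives of the transition maps, and \<open>0\<close> at all other arguments.
  The vector space operations are pointwise. A point of the tangent bundle is a pair of a
  base point and a tangent vector there.\<close>

type_synonym ('a, 'e) tangent = "('a, 'e) chart \<Rightarrow> 'e"

definition charts_at :: "('a, 'e) chart set \<Rightarrow> 'a \<Rightarrow> ('a, 'e) chart set" where
  "charts_at A x = {c \<in> A. x \<in> fst c}"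

definition chart_at :: "('a, 'e) chart set \<Rightarrow> 'a \<Rightarrow> ('a, 'e) chart" where
  "chart_at A x = (SOME c. c \<in> charts_at A x)"

definition tangent_space ::
  "('a, 'e::real_normed_vector) chart set \<Rightarrow> 'a \<Rightarrow> ('a, 'e) tangent set" where
  "tangent_space A x = {v. (\<forall>c. c \<notin> charts_at A x \<longrightarrow> v c = 0) \<and>
     (\<forall>c\<in>charts_at A x. \<forall>d\<in>charts_at A x.
        v d = frechet_derivative (snd d \<circ> chart_inv c) (at (snd c x)) (v c))}"

text \<open>The tangent vector at \<open>x\<close> whose coordinate vector in the chart \<open>c\<close> is \<open>w\<close>.\<close>

definition tangent_of ::
  "('a, 'e::real_normed_vector) chart set \<Rightarrow> ('a, 'e) chart \<Rightarrow> 'a \<Rightarrow> 'e \<Rightarrow> ('a, 'e) tangent" where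
  "tangent_of A c x w = (\<lambda>d. if d \<in> charts_at A x
     then frechet_derivative (snd d \<circ> chart_inv c) (at (snd c x)) w else 0)"

definition tangent_map ::
  "('a, 'e::real_normed_vector) chart set \<Rightarrow> ('a \<Rightarrow> 'a) \<Rightarrow> 'a \<Rightarrow> ('a, 'e) tangent \<Rightarrow>
   ('a, 'e) tangent" where
  "tangent_map A f x v = (\<lambda>d. if d \<in> charts_at A (f x)
     then frechet_derivative (snd d \<circ> f \<circ> chart_inv (chart_at A x))
            (at (snd (chart_at A x) x)) (v (chart_at A x))
     else 0)"

text \<open>The velocity of a curve defined on \<open>I\<close>; at an endpoint of \<open>I\<close> it is one-sided.\<close>

definition velocity ::
  "('a, 'e::real_normed_vector) chart set \<Rightarrow> real set \<Rightarrow> (real \<Rightarrow> 'a) \<Rightarrow> real \<Rightarrow>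
   ('a, 'e) tangent" where
  "velocity A I g t = (\<lambda>d. if d \<in> charts_at A (g t)
     then vector_derivative (snd d \<circ> g) (at t within I) else 0)"

text \<open>The bracket of vector fields, in coordinates \<open>[X, Y] = DY \<cdot> X - DX \<cdot> Y\<close>.\<close>

definition vf_bracket ::
  "('a, 'e::real_normed_vector) chart set \<Rightarrow> ('a \<Rightarrow> ('a, 'e) tangent) \<Rightarrow>
   ('a \<Rightarrow> ('a, 'e) tangent) \<Rightarrow> 'a \<Rightarrow> ('a, 'e) tangent" where
  "vf_bracket A X Y x = (\<lambda>c. if c \<in> charts_at A x
     then frechet_derivative (\<lambda>q. Y (chart_inv c q) c) (at (snd c x)) (X x c)
        - frechet_derivative (\<lambda>q. X (chart_inv c q) c) (at (snd c x)) (Y x c)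
     else 0)"

section \<open>Lagrangian mechanics on a manifold\<close>

definition local_lagrangian ::
  "('a, 'e::real_normed_vector) chart set \<Rightarrow> ('a \<times> ('a, 'e) tangent \<Rightarrow> real) \<Rightarrow>
   ('a, 'e) chart \<Rightarrow> 'e \<times> 'e \<Rightarrow> real" where
  "local_lagrangian A L c = (\<lambda>(q, w). L (chart_inv c q, tangent_of A c (chart_inv c q) w))"

definition smooth_lagrangian ::
  "('a, 'e::real_normed_vector) chart set \<Rightarrow> ('a \<times> ('a, 'e) tangent \<Rightarrow> real) \<Rightarrow> bool" where
  "smooth_lagrangian A L \<longleftrightarrow>
     (\<forall>c\<in>A. smooth_on (snd c ` fst c \<times> UNIV) (local_lagrangian A L c))"

text \<open>The equation \<open>d/dt (\<partial>L/\<partial>v) = \<partial>L/\<partial>q\<close> in every chart, both sides being covectors,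
  evaluated on an arbitrary \<open>w\<close>.\<close>

definition euler_lagrange ::
  "('a, 'e::real_normed_vector) chart set \<Rightarrow> ('a \<times> ('a, 'e) tangent \<Rightarrow> real) \<Rightarrow>
   real \<Rightarrow> real \<Rightarrow> (real \<Rightarrow> 'a) \<Rightarrow> bool" where
  "euler_lagrange A L a b g \<longleftrightarrow>
     (\<forall>t\<in>{a..b}. \<forall>c\<in>charts_at A (g t). \<forall>w.
        let q = (\<lambda>s. snd c (g s));
            v = (\<lambda>s. vector_derivative q (at s within {a..b}));
            Lc = local_lagrangian A L c
        in ((\<lambda>s. frechet_derivative (\<lambda>u. Lc (q s, u)) (at (v s)) w) has_real_derivative
              frechet_derivative (\<lambda>p. Lc (p, v t)) (at (q t)) w) (at t within {a..b}))"

text \<open>The first argument of \<open>\<Gamma>\<close> is the deformation parameter.\<close>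

definition fixed_endpoint_variation ::
  "'a topology \<Rightarrow> ('a, 'e::real_normed_vector) chart set \<Rightarrow> real \<Rightarrow> real \<Rightarrow> (real \<Rightarrow> 'a) \<Rightarrow>
   (real \<Rightarrow> real \<Rightarrow> 'a) \<Rightarrow> bool" where
  "fixed_endpoint_variation T A a b g \<Gamma> \<longleftrightarrow>
     (\<forall>t\<in>{a..b}. \<Gamma> 0 t = g t) \<and>
     (\<exists>\<delta>>0. smooth_into T A ({-\<delta><..<\<delta>} \<times> {a..b}) (\<lambda>(\<epsilon>, t). \<Gamma> \<epsilon> t) \<and>
        (\<forall>\<epsilon>\<in>{-\<delta><..<\<delta>}. \<Gamma> \<epsilon> a = g a \<and> \<Gamma> \<epsilon> b = g b))"

definition hamilton_principle ::
  "'a topology \<Rightarrow> ('a, 'e::real_normed_vector) chart set \<Rightarrow> ('a \<times> ('a, 'e) tangent \<Rightarrow> real) \<Rightarrow>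
   real \<Rightarrow> real \<Rightarrow> (real \<Rightarrow> 'a) \<Rightarrow> bool" where
  "hamilton_principle T A L a b g \<longleftrightarrow>
     (\<forall>\<Gamma>. fixed_endpoint_variation T A a b g \<Gamma> \<longrightarrow>
        ((\<lambda>\<epsilon>. integral {a..b} (\<lambda>t. L (\<Gamma> \<epsilon> t, velocity A {a..b} (\<Gamma> \<epsilon>) t)))
           has_real_derivative 0) (at 0))"

section \<open>Lie groups\<close>

locale lie_group = group G + smooth_manifold T A
  for G :: "('a, 'm) monoid_scheme" and T :: "'a topology"
    and A :: "('a, 'e::real_normed_vector) chart set" +
  assumes topspace_carrier: "topspace T = carrier G"
    and smooth_mult:
      "smooth_map (prod_topology T T) (prod_atlas A A) T A (\<lambda>(x, y). x \<otimes>\<^bsub>G\<^esub> y)"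
    and smooth_inv: "smooth_map T A T A (\<lambda>x. inv\<^bsub>G\<^esub> x)"

abbreviation lie_algebra ::
  "('a, 'm) monoid_scheme \<Rightarrow> ('a, 'e::real_normed_vector) chart set \<Rightarrow> ('a, 'e) tangent set" where
  "lie_algebra G A \<equiv> tangent_space A \<one>\<^bsub>G\<^esub>"

definition right_translation :: "('a, 'm) monoid_scheme \<Rightarrow> 'a \<Rightarrow> 'a \<Rightarrow> 'a" where
  "right_translation G h = (\<lambda>g. g \<otimes>\<^bsub>G\<^esub> h)"

definition left_invariant_field ::
  "('a, 'm) monoid_scheme \<Rightarrow> ('a, 'e::real_normed_vector) chart set \<Rightarrow> ('a, 'e) tangent \<Rightarrow>
   'a \<Rightarrow> ('a, 'e) tangent" where
  "left_invariant_field G A \<xi> = (\<lambda>g. tangent_map A (\<lambda>h. g \<otimes>\<^bsub>G\<^esub> h) \<one>\<^bsub>G\<^esub> \<xi>)"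

definition ad ::
  "('a, 'm) monoid_scheme \<Rightarrow> ('a, 'e::real_normed_vector) chart set \<Rightarrow> ('a, 'e) tangent \<Rightarrow>
   ('a, 'e) tangent \<Rightarrow> ('a, 'e) tangent" where
  "ad G A \<xi> \<eta> = vf_bracket A (left_invariant_field G A \<xi>) (left_invariant_field G A \<eta>) \<one>\<^bsub>G\<^esub>"

text \<open>Covectors on the Lie algebra are functions on tangent vectors at the identity, so the
  natural pairing is application.\<close>

definition ad_star ::
  "('a, 'm) monoid_scheme \<Rightarrow> ('a, 'e::real_normed_vector) chart set \<Rightarrow> ('a, 'e) tangent \<Rightarrow>
   (('a, 'e) tangent \<Rightarrow> real) \<Rightarrow> (('a, 'e) tangent \<Rightarrow> real)" where
  "ad_star G A \<xi> \<mu> = (\<lambda>\<eta>. \<mu> (ad G A \<xi> \<eta>))"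

definition functional_derivative ::
  "(('a, 'e::real_normed_vector) tangent \<Rightarrow> real) \<Rightarrow> ('a, 'e) tangent \<Rightarrow>
   (('a, 'e) tangent \<Rightarrow> real)" where
  "functional_derivative l \<xi> = (\<lambda>\<zeta>. deriv (\<lambda>\<epsilon>. l (\<lambda>c. \<xi> c + \<epsilon> *\<^sub>R \<zeta> c)) 0)"

definition right_invariant ::
  "('a, 'm) monoid_scheme \<Rightarrow> ('a, 'e::real_normed_vector) chart set \<Rightarrow>
   ('a \<times> ('a, 'e) tangent \<Rightarrow> real) \<Rightarrow> bool" where
  "right_invariant G A L \<longleftrightarrow>
     (\<forall>g\<in>carrier G. \<forall>h\<in>carrier G. \<forall>v\<in>tangent_space A g.
        L (right_translation G h g, tangent_map A (right_translation G h) g v) = L (g, v))"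

definition reduced_lagrangian ::
  "('a, 'm) monoid_scheme \<Rightarrow> ('a \<times> ('a, 'e) tangent \<Rightarrow> real) \<Rightarrow> ('a, 'e) tangent \<Rightarrow> real" where
  "reduced_lagrangian G L = (\<lambda>\<xi>. L (\<one>\<^bsub>G\<^esub>, \<xi>))"

definition reduced_velocity ::
  "('a, 'm) monoid_scheme \<Rightarrow> ('a, 'e::real_normed_vector) chart set \<Rightarrow> real set \<Rightarrow>
   (real \<Rightarrow> 'a) \<Rightarrow> real \<Rightarrow> ('a, 'e) tangent" where
  "reduced_velocity G A I g =
     (\<lambda>t. tangent_map A (right_translation G (inv\<^bsub>G\<^esub> (g t))) (g t) (velocity A I g t))"

definition smooth_lie_algebra_path ::
  "('a, 'm) monoid_scheme \<Rightarrow> ('a, 'e::real_normed_vector) chart set \<Rightarrow> real set \<Rightarrow>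
   (real \<Rightarrow> ('a, 'e) tangent) \<Rightarrow> bool" where
  "smooth_lie_algebra_path G A I \<eta> \<longleftrightarrow>
     (\<forall>t\<in>I. \<eta> t \<in> lie_algebra G A) \<and> (\<forall>c\<in>charts_at A \<one>\<^bsub>G\<^esub>. smooth_on I (\<lambda>t. \<eta> t c))"

definition path_derivative ::
  "real set \<Rightarrow> (real \<Rightarrow> ('a, 'e::real_normed_vector) tangent) \<Rightarrow> real \<Rightarrow> ('a, 'e) tangent" where
  "path_derivative I \<eta> t = (\<lambda>c. vector_derivative (\<lambda>s. \<eta> s c) (at t within I))"

text \<open>The dual of the Lie algebra is finite-dimensional, so a curve in it is differentiated by
  differentiating its pairing with every fixed element \<open>\<zeta>\<close> of the Lie algebra.\<close>

definition euler_poincare ::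
  "('a, 'm) monoid_scheme \<Rightarrow> ('a, 'e::real_normed_vector) chart set \<Rightarrow>
   (('a, 'e) tangent \<Rightarrow> real) \<Rightarrow> real \<Rightarrow> real \<Rightarrow> (real \<Rightarrow> ('a, 'e) tangent) \<Rightarrow> bool" where
  "euler_poincare G A l a b \<xi> \<longleftrightarrow>
     (\<forall>t\<in>{a..b}. \<forall>\<zeta>\<in>lie_algebra G A.
        ((\<lambda>s. functional_derivative l (\<xi> s) \<zeta>) has_real_derivative
           - ad_star G A (\<xi> t) (functional_derivative l (\<xi> t)) \<zeta>) (at t within {a..b}))"

definition reduced_variation ::
  "('a, 'm) monoid_scheme \<Rightarrow> ('a, 'e::real_normed_vector) chart set \<Rightarrow> real set \<Rightarrow>
   (real \<Rightarrow> ('a, 'e) tangent) \<Rightarrow> (real \<Rightarrow> ('a, 'e) tangent) \<Rightarrow> real \<Rightarrow> ('a, 'e) tangent" where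
  "reduced_variation G A I \<xi> \<eta> t = (\<lambda>c. path_derivative I \<eta> t c - ad G A (\<xi> t) (\<eta> t) c)"

definition reduced_variational_principle ::
  "('a, 'm) monoid_scheme \<Rightarrow> ('a, 'e::real_normed_vector) chart set \<Rightarrow>
   (('a, 'e) tangent \<Rightarrow> real) \<Rightarrow> real \<Rightarrow> real \<Rightarrow> (real \<Rightarrow> ('a, 'e) tangent) \<Rightarrow> bool" where
  "reduced_variational_principle G A l a b \<xi> \<longleftrightarrow>
     (\<forall>\<eta>. smooth_lie_algebra_path G A {a..b} \<eta> \<and> \<eta> a = (\<lambda>_. 0) \<and> \<eta> b = (\<lambda>_. 0) \<longrightarrow>
        ((\<lambda>t. functional_derivative l (\<xi> t) (reduced_variation G A {a..b} \<xi> \<eta> t))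
           has_integral 0) {a..b})"

end

theory Submission
  imports Defs
begin

text \<open>
Right-invariance makes the Lagrangian a function \<open>l\<close> of the reduced velocity \<open>\<xi> = g' g\<^sup>-\<^sup>1\<close> alone. A
deformation of the curve has, besides \<open>\<xi>\<close>, a reduced variation field \<open>\<eta> = \<delta>g g\<^sup>-\<^sup>1\<close>, and the heart of
the matter is the identity \<open>\<delta>\<xi> = \<eta>' - [\<xi>, \<eta>]\<close> between the two. It is the Maurer-Cartan equation for
the pullback of the right-invariant Maurer-Cartan form to the plane of the parameters \<open>\<epsilon>\<close> and \<open>t\<close>
(\<open>maurer_cartan\<close>, \<open>zero_curvature\<close>), and it follows from the symmetry of second derivatives applied
to multiplication and inversion in a chart at the identity. The pulled back form is called \<open>darboux\<close>
below. It is read in a fixed chart at the identity, so that all analysis takes place in the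
finite-dimensional model space.

With the reduced momentum \<open>\<mu> = \<delta>l/\<delta>\<xi>\<close> the four statements become statements about the pairing of \<open>\<mu>\<close>
with vectors of the model space.

\<^item> The Euler-Poincare equation and the reduced principle. Along a field \<open>\<eta>\<close> that vanishes at the
endpoints the integral of the derivative of \<open>\<langle>\<mu>, \<eta>\<rangle>\<close> is zero, so \<open>\<integral> \<langle>\<mu>, \<eta>' - [\<xi>, \<eta>]\<rangle> dt\<close> is minus
the integral of \<open>\<langle>\<mu>' + ad\<^sup>*\<^sub>\<xi> \<mu>, \<eta>\<rangle>\<close>, and the
fundamental lemma of the calculus of variations applies (\<open>strong_iff_weak_euler_poincare\<close>).

\<^item> The two variational principles. By the identity for \<open>\<delta>\<xi>\<close> the derivative of the action along any
deformation is \<open>\<integral> \<langle>\<mu>, \<eta>' - [\<xi>, \<eta>]\<rangle> dt\<close> (\<open>action_derivative\<close>). Fixed endpoints make \<open>\<eta>\<close> vanish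
there; conversely
multiplication of \<open>g t\<close> from the left by the element with chart coordinates \<open>\<epsilon> \<eta> t\<close> is a deformation
with the prescribed \<open>\<eta>\<close>.

\<^item> The Euler-Lagrange and the Euler-Poincare equation. This equivalence holds at each time
separately, without integration. For a constant chart vector \<open>w\<close>, let \<open>\<eta>\<close> be the reduced variation
field of \<open>q + \<epsilon> w\<close>. Then
\<open>\<partial>L/\<partial>v \<cdot> w = \<langle>\<mu>, \<eta>\<rangle>\<close> and \<open>\<partial>L/\<partial>q \<cdot> w = \<langle>\<mu>, \<eta>' - [\<xi>, \<eta>]\<rangle>\<close>, so the Euler-Lagrange equation reads
\<open>\<langle>\<mu>', \<eta>\<rangle> = - \<langle>\<mu>, [\<xi>, \<eta>]\<rangle>\<close>, and \<open>\<eta> t\<close> takes every value as \<open>w\<close> varies (\<open>euler_lagrange_at_iff\<close>).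
\<close>

section \<open>Coordinates on finite-dimensional normed spaces\<close>

text \<open>All norms on a finite-dimensional space are equivalent, in the form that is needed here: coefficients
with respect to a finite independent set depend continuously on the vector. In the induction step
the new vector \<open>b\<close> has positive distance \<open>d\<close> from the span of the old ones, because that span is
complete by the induction hypothesis; hence the coefficient of \<open>b\<close> in a vector \<open>s\<close> is at most
\<open>norm s / d\<close>.\<close>

lemma independent_coefficients_bounded:
  fixes B :: "'x::real_normed_vector set"
  assumes "finite B" "independent B"
  shows "\<exists>C\<ge>0. \<forall>f. (\<Sum>b\<in>B. \<bar>f b\<bar>) \<le> C * norm (\<Sum>b\<in>B. f b *\<^sub>R b)"
  using assms
proof (induction B rule: finite_induct)
  case empty
  show ?case by (intro exI[of _ 0]) auto
next
  case (insert b B)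
  have indep: "independent B" and b: "b \<notin> span B"
    using insert.prems insert.hyps by (auto simp: independent_insert split: if_splits)
  obtain C where "C \<ge> 0" and C: "\<And>f. (\<Sum>x\<in>B. \<bar>f x\<bar>) \<le> C * norm (\<Sum>x\<in>B. f x *\<^sub>R x)"
    using insert.IH[OF indep] by blast
  \<comment> \<open>If the distance were zero, vectors of the span would converge to \<open>b\<close>; their
    coefficients would be Cauchy, and the limits of the coefficients would put \<open>b\<close> into the span.\<close>
  have "\<exists>d>0. \<forall>v\<in>span B. d \<le> norm (b - v)"
  proof (rule ccontr)
    assume "\<not> ?thesis"
    then have ex: "\<exists>v\<in>span B. norm (b - v) < d" if "d > 0" for d
      using that by (meson not_le)
    have "\<exists>f. norm (b - (\<Sum>x\<in>B. f x *\<^sub>R x)) < inverse (real (Suc n))" for n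
    proof -
      obtain v where "v \<in> span B" "norm (b - v) < inverse (real (Suc n))"
        using ex[of "inverse (real (Suc n))"] by auto
      moreover from this obtain f where "v = (\<Sum>x\<in>B. f x *\<^sub>R x)"
        using span_finite[OF insert.hyps(1)] by auto
      ultimately show ?thesis by blast
    qed
    then obtain F where F: "\<And>n. norm (b - (\<Sum>x\<in>B. F n x *\<^sub>R x)) < inverse (real (Suc n))"
      by metis
    define s where "s n = (\<Sum>x\<in>B. F n x *\<^sub>R x)" for n
    have "(\<lambda>n. b - s n) \<longlonglongrightarrow> 0"
      by (rule Lim_null_comparison[OF _ LIMSEQ_inverse_real_of_nat])
         (use F in \<open>auto simp: s_def intro!: always_eventually less_imp_le\<close>)
    then have s: "s \<longlonglongrightarrow> b"
      using tendsto_diff[OF tendsto_const[of b], of "\<lambda>n. b - s n" 0] by simp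
    have "Cauchy (\<lambda>n. F n x)" if x: "x \<in> B" for x
    proof (rule metric_CauchyI)
      fix e :: real assume "e > 0"
      have "Cauchy s" using s by (rule LIMSEQ_imp_Cauchy)
      then obtain N where N: "\<And>m n. m \<ge> N \<Longrightarrow> n \<ge> N \<Longrightarrow> dist (s m) (s n) < e / (C + 1)"
        using \<open>e > 0\<close> \<open>C \<ge> 0\<close> by (metis metric_CauchyD add_nonneg_pos divide_pos_pos zero_less_one)
      show "\<exists>N. \<forall>m\<ge>N. \<forall>n\<ge>N. dist (F m x) (F n x) < e"
      proof (intro exI[of _ N] allI impI)
        fix m n assume "m \<ge> N" "n \<ge> N"
        have "\<bar>F m x - F n x\<bar> \<le> (\<Sum>x\<in>B. \<bar>F m x - F n x\<bar>)"
          using insert.hyps(1) x by (intro member_le_sum) auto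
        also have "\<dots> \<le> C * norm (s m - s n)"
          using C[of "\<lambda>x. F m x - F n x"] by (simp add: s_def sum_subtractf scaleR_diff_left)
        also have "\<dots> \<le> C * (e / (C + 1))"
          using N[OF \<open>m \<ge> N\<close> \<open>n \<ge> N\<close>] \<open>C \<ge> 0\<close> by (intro mult_left_mono) (auto simp: dist_norm)
        also have "\<dots> < (C + 1) * (e / (C + 1))"
          using \<open>e > 0\<close> \<open>C \<ge> 0\<close> by (intro mult_strict_right_mono) auto
        also have "\<dots> = e" using \<open>C \<ge> 0\<close> by simp
        finally show "dist (F m x) (F n x) < e" by (simp add: dist_real_def)
      qed
    qed
    then have "\<forall>x\<in>B. \<exists>y. (\<lambda>n. F n x) \<longlonglongrightarrow> y"
      by (simp add: Cauchy_convergent_iff convergent_def)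
    from bchoice[OF this] obtain G where G: "\<And>x. x \<in> B \<Longrightarrow> (\<lambda>n. F n x) \<longlonglongrightarrow> G x" by blast
    have "s \<longlonglongrightarrow> (\<Sum>x\<in>B. G x *\<^sub>R x)"
      unfolding s_def by (intro tendsto_sum tendsto_scaleR G tendsto_const)
    then have "b = (\<Sum>x\<in>B. G x *\<^sub>R x)" using s LIMSEQ_unique by blast
    then have "b \<in> span B" by (simp add: span_sum span_scale span_base)
    then show False using b by blast
  qed
  then obtain d where "d > 0" and d: "\<And>v. v \<in> span B \<Longrightarrow> d \<le> norm (b - v)" by blast
  show ?case
  proof (intro exI[of _ "1 / d + C * (1 + norm b / d)"] conjI allI)
    show "0 \<le> 1 / d + C * (1 + norm b / d)" using \<open>d > 0\<close> \<open>C \<ge> 0\<close> by simp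
    fix f
    define r where "r = (\<Sum>x\<in>B. f x *\<^sub>R x)"
    define s where "s = f b *\<^sub>R b + r"
    have fb: "\<bar>f b\<bar> \<le> norm s / d"
    proof (cases "f b = 0")
      case False
      have "(- 1 / f b) *\<^sub>R r \<in> span B"
        unfolding r_def by (intro span_scale span_sum) (rule span_base)
      then have "d \<le> norm (b - (- 1 / f b) *\<^sub>R r)" by (rule d)
      then have "\<bar>f b\<bar> * d \<le> norm (f b *\<^sub>R (b - (- 1 / f b) *\<^sub>R r))"
        by (simp add: mult_left_mono)
      also have "f b *\<^sub>R (b - (- 1 / f b) *\<^sub>R r) = s"
        using False by (simp add: s_def scaleR_right_distrib)
      finally show ?thesis using \<open>d > 0\<close> by (simp add: field_simps)
    qed (use \<open>d > 0\<close> in simp)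
    have "norm r \<le> norm s + \<bar>f b\<bar> * norm b"
      using norm_triangle_ineq4[of s "f b *\<^sub>R b"] by (simp add: s_def)
    also have "\<dots> \<le> norm s + norm s / d * norm b"
      using fb by (intro add_left_mono mult_right_mono) auto
    finally have "(\<Sum>x\<in>B. \<bar>f x\<bar>) \<le> C * (norm s + norm s / d * norm b)"
      by (intro order_trans[OF C[of f]] mult_left_mono) (use \<open>C \<ge> 0\<close> in \<open>auto simp: r_def\<close>)
    then have "\<bar>f b\<bar> + (\<Sum>x\<in>B. \<bar>f x\<bar>) \<le> (1 / d + C * (1 + norm b / d)) * norm s"
      using fb by (simp add: algebra_simps)
    then show "(\<Sum>x\<in>insert b B. \<bar>f x\<bar>)
        \<le> (1 / d + C * (1 + norm b / d)) * norm (\<Sum>x\<in>insert b B. f x *\<^sub>R x)"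
      using insert.hyps by (simp add: s_def r_def)
  qed
qed

text \<open>Finite dimension, in the form of continuous coordinate functionals. The index set is an
initial segment of the naturals because the dimension is not a type here; the vectors
\<open>e i\<close> need not be distinct or independent, which makes products immediate.\<close>

definition has_coordinates :: "'x::real_normed_vector itself \<Rightarrow> bool" where
  "has_coordinates _ \<longleftrightarrow> (\<exists>n (e :: nat \<Rightarrow> 'x) \<kappa>.
     (\<forall>i<n. bounded_linear (\<kappa> i)) \<and> (\<forall>x. x = (\<Sum>i<n. \<kappa> i x *\<^sub>R e i)))"

lemma has_coordinates_of_span:
  fixes B :: "'x::real_normed_vector set"
  assumes "finite B" "span B = UNIV"
  shows "has_coordinates TYPE('x)"
proof -
  obtain D where D: "D \<subseteq> B" "independent D" "span D = UNIV"
    using assms maximal_independent_subset[of B] by (metis span_mono span_span top.extremum_uniqueI)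
  have fin: "finite D" using D(1) assms(1) finite_subset by blast
  obtain C where C: "\<And>f. (\<Sum>b\<in>D. \<bar>f b\<bar>) \<le> C * norm (\<Sum>b\<in>D. f b *\<^sub>R b)"
    using independent_coefficients_bounded[OF fin D(2)] by blast
  have rep: "(\<Sum>b\<in>D. representation D x b *\<^sub>R b) = x" for x
    using real_vector.sum_representation_eq[of D x D] D fin by simp
  have bl: "bounded_linear (\<lambda>x. representation D x b)" if "b \<in> D" for b
  proof (rule bounded_linear_intro[where K = C])
    fix x
    have "\<bar>representation D x b\<bar> \<le> (\<Sum>b\<in>D. \<bar>representation D x b\<bar>)"
      using fin that by (intro member_le_sum) auto
    also have "\<dots> \<le> norm x * C" using C[of "representation D x"] by (simp add: rep mult.commute)
    finally show "norm (representation D x b) \<le> norm x * C" by simp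
  qed (use D in \<open>simp_all add: real_vector.representation_add real_vector.representation_scale\<close>)
  obtain h where h: "bij_betw h {..<card D} D"
    using fin ex_bij_betw_nat_finite atLeast0LessThan by metis
  have "x = (\<Sum>i<card D. representation D x (h i) *\<^sub>R h i)" for x
    using sum.reindex_bij_betw[OF h, of "\<lambda>b. representation D x b *\<^sub>R b"] rep by simp
  moreover have "\<forall>i<card D. bounded_linear (\<lambda>x. representation D x (h i))"
    using h bl by (auto simp: bij_betw_def)
  ultimately show ?thesis unfolding has_coordinates_def
    by (intro exI[of _ "card D"] exI[of _ h] exI[of _ "\<lambda>i x. representation D x (h i)"]) auto
qed

lemma has_coordinates_real: "has_coordinates TYPE(real)"
  by (rule has_coordinates_of_span[of "{1}"]) (auto simp: span_singleton)

lemma has_coordinates_prod: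
  assumes "has_coordinates TYPE('x::real_normed_vector)"
    and "has_coordinates TYPE('y::real_normed_vector)"
  shows "has_coordinates TYPE('x \<times> 'y)"
proof -
  obtain n and e :: "nat \<Rightarrow> 'x" and \<kappa>
    where 1: "\<And>i. i < n \<Longrightarrow> bounded_linear (\<kappa> i)" "\<And>x. x = (\<Sum>i<n. \<kappa> i x *\<^sub>R e i)"
    using assms(1) unfolding has_coordinates_def by metis
  obtain m and d :: "nat \<Rightarrow> 'y" and \<mu>
    where 2: "\<And>i. i < m \<Longrightarrow> bounded_linear (\<mu> i)" "\<And>x. x = (\<Sum>i<m. \<mu> i x *\<^sub>R d i)"
    using assms(2) unfolding has_coordinates_def by metis
  define E where "E i = (if i < n then (e i, 0) else (0, d (i - n)))" for i
  define K where "K i z = (if i < n then \<kappa> i (fst z) else \<mu> (i - n) (snd z))" for i z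
  have "bounded_linear (K i)" if "i < n + m" for i
  proof (cases "i < n")
    case True
    then have "K i = (\<lambda>z. \<kappa> i (fst z))" by (auto simp: K_def)
    then show ?thesis using bounded_linear_compose[OF 1(1)[OF True] bounded_linear_fst] by simp
  next
    case False
    then have "K i = (\<lambda>z. \<mu> (i - n) (snd z))" by (auto simp: K_def)
    moreover have "i - n < m" using False that by arith
    ultimately show ?thesis
      using bounded_linear_compose[OF 2(1)[of "i - n"] bounded_linear_snd] by simp
  qed
  moreover have "z = (\<Sum>i<n + m. K i z *\<^sub>R E i)" for z
  proof -
    have "(\<Sum>i<n + m. K i z *\<^sub>R E i) = (\<Sum>i<n. K i z *\<^sub>R E i) + (\<Sum>i<m. K (i + n) z *\<^sub>R E (i + n))"
      using sum.atLeastLessThan_concat[of 0 n "n + m" "\<lambda>i. K i z *\<^sub>R E i"]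
        sum.shift_bounds_nat_ivl[of "\<lambda>i. K i z *\<^sub>R E i" 0 n m]
      by (simp add: atLeast0LessThan add.commute)
    also have "(\<Sum>i<n. K i z *\<^sub>R E i) = (\<Sum>i<n. \<kappa> i (fst z) *\<^sub>R e i, 0)"
      by (auto simp: K_def E_def prod_eq_iff fst_sum snd_sum)
    also have "(\<Sum>i<m. K (i + n) z *\<^sub>R E (i + n)) = (0, \<Sum>i<m. \<mu> i (snd z) *\<^sub>R d i)"
      by (auto simp: K_def E_def prod_eq_iff fst_sum snd_sum)
    finally show ?thesis using 1(2)[of "fst z"] 2(2)[of "snd z"] by (simp add: prod_eq_iff)
  qed
  ultimately show ?thesis unfolding has_coordinates_def by blast
qed

lemma has_coordinates_real_pair: "has_coordinates TYPE(real \<times> real)"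
  by (rule has_coordinates_prod[OF has_coordinates_real has_coordinates_real])

section \<open>Calculus of infinitely differentiable functions\<close>

abbreviation fderiv :: "('x::real_normed_vector \<Rightarrow> 'y::real_normed_vector) \<Rightarrow> 'x \<Rightarrow> 'x \<Rightarrow> 'y" where
  "fderiv f x \<equiv> frechet_derivative f (at x)"

lemma fderiv_eqI: "(f has_derivative f') (at x) \<Longrightarrow> fderiv f x u = f' u"
  by (simp add: frechet_derivative_at[symmetric])

lemma fderiv_works: "f differentiable (at x) \<Longrightarrow> (f has_derivative fderiv f x) (at x)"
  by (simp add: frechet_derivative_works[symmetric])

lemma fderiv_cong:
  assumes "open S" "x \<in> S" "\<And>y. y \<in> S \<Longrightarrow> f y = g y"
  shows "fderiv f x = fderiv g x"
proof -
  have "(f has_derivative F) (at x) \<longleftrightarrow> (g has_derivative F) (at x)" for F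
    using has_derivative_transform_within_open[of f F x UNIV S g]
      has_derivative_transform_within_open[of g F x UNIV S f] assms by auto
  then show ?thesis by (simp add: frechet_derivative_def)
qed

lemma differentiable_cong_open:
  assumes "f differentiable (at x)" "open S" "x \<in> S" "\<And>y. y \<in> S \<Longrightarrow> f y = g y"
  shows "g differentiable (at x)"
  using has_derivative_transform_within_open[of f _ x UNIV S g] assms
  unfolding differentiable_def by blast

lemma Ck_on_subset: "Ck_on n S f \<Longrightarrow> S' \<subseteq> S \<Longrightarrow> Ck_on n S' f"
  by (induction n arbitrary: f) (auto intro: continuous_on_subset)

lemma Ck_on_cong:
  "Ck_on n S f \<Longrightarrow> open S \<Longrightarrow> (\<And>x. x \<in> S \<Longrightarrow> f x = g x) \<Longrightarrow> Ck_on n S g"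
proof (induction n arbitrary: f g)
  case 0
  then show ?case using continuous_on_cong[of S S f g] by simp
next
  case (Suc n)
  have "Ck_on n S (\<lambda>x. fderiv g x v)" for v
  proof (rule Suc.IH[of "\<lambda>x. fderiv f x v"])
    fix x assume "x \<in> S"
    then show "fderiv f x v = fderiv g x v" using fderiv_cong[of S x f g] Suc.prems by simp
  qed (use Suc.prems in auto)
  moreover have "g differentiable (at x)" if "x \<in> S" for x
    using Suc.prems that differentiable_cong_open[of f x S g] by auto
  ultimately show ?case by simp
qed

lemma Ck_on_local:
  "(\<And>x. x \<in> S \<Longrightarrow> \<exists>U. open U \<and> x \<in> U \<and> Ck_on n U f) \<Longrightarrow> Ck_on n S f"
proof (induction n arbitrary: f)
  case 0
  have "isCont f x" if "x \<in> S" for x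
    using 0[OF that] by (auto simp: continuous_on_eq_continuous_at)
  then show ?case by (simp add: continuous_at_imp_continuous_on)
next
  case (Suc n)
  have "Ck_on n S (\<lambda>x. fderiv f x v)" for v
    by (rule Suc.IH) (use Suc.prems in fastforce)
  moreover have "f differentiable (at x)" if "x \<in> S" for x
    using Suc.prems[OF that] by auto
  ultimately show ?case by simp
qed

lemma Ck_on_Suc_imp: "Ck_on (Suc n) S f \<Longrightarrow> Ck_on n S f"
proof (induction n arbitrary: f)
  case 0
  then show ?case
    by (auto intro!: continuous_at_imp_continuous_on differentiable_imp_continuous_within)
next
  case (Suc n)
  then show ?case by (metis Ck_on.simps(2))
qed

lemma Ck_on_const: "Ck_on n S (\<lambda>x. c)"
  by (induction n arbitrary: c) auto

lemma Ck_on_bounded_linear_comp: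
  assumes h: "bounded_linear h"
  shows "Ck_on n S f \<Longrightarrow> open S \<Longrightarrow> Ck_on n S (\<lambda>x. h (f x))"
proof (induction n arbitrary: f)
  case 0
  then show ?case using h by (simp add: bounded_linear.continuous_on)
next
  case (Suc n)
  have d: "((\<lambda>x. h (f x)) has_derivative (\<lambda>v. h (fderiv f x v))) (at x)" if "x \<in> S" for x
    using bounded_linear.has_derivative[OF h fderiv_works] Suc.prems that by auto
  have "Ck_on n S (\<lambda>x. fderiv (\<lambda>x. h (f x)) x v)" for v
    by (rule Ck_on_cong[of n S "\<lambda>x. h (fderiv f x v)"])
       (use Suc.prems Suc.IH in \<open>auto simp: fderiv_eqI[OF d]\<close>)
  then show ?case using d by (auto simp: differentiable_def)
qed

lemma Ck_on_ident: "Ck_on n S (\<lambda>x. x)"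
  by (cases n) (auto intro: Ck_on_const)

lemma Ck_on_add:
  "Ck_on n S f \<Longrightarrow> Ck_on n S g \<Longrightarrow> open S \<Longrightarrow> Ck_on n S (\<lambda>x. f x + g x)"
proof (induction n arbitrary: f g)
  case 0
  then show ?case by (auto intro: continuous_on_add)
next
  case (Suc n)
  have d: "((\<lambda>x. f x + g x) has_derivative (\<lambda>v. fderiv f x v + fderiv g x v)) (at x)"
    if "x \<in> S" for x
    by (rule has_derivative_add[OF fderiv_works fderiv_works]) (use Suc.prems that in auto)
  have "Ck_on n S (\<lambda>x. fderiv (\<lambda>x. f x + g x) x v)" for v
    by (rule Ck_on_cong[of n S "\<lambda>x. fderiv f x v + fderiv g x v"])
       (use Suc.prems Suc.IH in \<open>auto simp: fderiv_eqI[OF d]\<close>)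
  then show ?case using d by (auto simp: differentiable_def)
qed

lemma Ck_on_bounded_bilinear:
  assumes p: "bounded_bilinear p"
  shows "Ck_on n S f \<Longrightarrow> Ck_on n S g \<Longrightarrow> open S \<Longrightarrow> Ck_on n S (\<lambda>x. p (f x) (g x))"
proof (induction n arbitrary: f g)
  case 0
  then show ?case using bounded_bilinear.continuous_on[OF p] by simp
next
  case (Suc n)
  have d: "((\<lambda>x. p (f x) (g x)) has_derivative
      (\<lambda>v. p (f x) (fderiv g x v) + p (fderiv f x v) (g x))) (at x)" if "x \<in> S" for x
    by (rule bounded_bilinear.FDERIV[OF p fderiv_works fderiv_works]) (use Suc.prems that in auto)
  have "Ck_on n S (\<lambda>x. fderiv (\<lambda>x. p (f x) (g x)) x v)" for v
  proof (rule Ck_on_cong[of n S "\<lambda>x. p (f x) (fderiv g x v) + p (fderiv f x v) (g x)"])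
    show "Ck_on n S (\<lambda>x. p (f x) (fderiv g x v) + p (fderiv f x v) (g x))"
      using Suc.prems Ck_on_Suc_imp[OF Suc.prems(1)] Ck_on_Suc_imp[OF Suc.prems(2)]
      by (intro Ck_on_add Suc.IH) auto
  qed (use Suc.prems in \<open>auto simp: fderiv_eqI[OF d]\<close>)
  then show ?case using d by (auto simp: differentiable_def)
qed

lemma Ck_on_sum:
  assumes "finite I" "\<And>i. i \<in> I \<Longrightarrow> Ck_on n S (f i)" "open S"
  shows "Ck_on n S (\<lambda>x. \<Sum>i\<in>I. f i x)"
  using assms by (induction I rule: finite_induct) (auto intro: Ck_on_add Ck_on_const)

text \<open>The derivative \<open>fderiv g (f x) (fderiv f x v)\<close> of a composition depends on \<open>x\<close> through both the point
and the direction, while \<open>Ck_on\<close> only speaks of derivatives in a fixed direction. Expanding the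
direction in coordinates of the intermediate space turns it into a sum of products of functions to
which the induction hypothesis applies. This is why the intermediate space has to be
finite-dimensional.\<close>

lemma Ck_on_compose:
  fixes f :: "'x::real_normed_vector \<Rightarrow> 'y::real_normed_vector"
    and g :: "'y \<Rightarrow> 'z::real_normed_vector"
  assumes coord: "has_coordinates TYPE('y)"
  shows "Ck_on n S f \<Longrightarrow> Ck_on n U g \<Longrightarrow> f ` S \<subseteq> U \<Longrightarrow> open S \<Longrightarrow> Ck_on n S (\<lambda>x. g (f x))"
proof (induction n arbitrary: g)
  case 0
  then show ?case by (auto intro: continuous_on_compose2)
next
  case (Suc n)
  obtain m and e :: "nat \<Rightarrow> 'y" and \<kappa>
    where \<kappa>: "\<And>i. i < m \<Longrightarrow> bounded_linear (\<kappa> i)" and e: "\<And>y. y = (\<Sum>i<m. \<kappa> i y *\<^sub>R e i)"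
    using coord unfolding has_coordinates_def by metis
  have d: "((\<lambda>x. g (f x)) has_derivative (\<lambda>v. fderiv g (f x) (fderiv f x v))) (at x)"
    if "x \<in> S" for x
    using diff_chain_at[OF fderiv_works fderiv_works, of f x g] Suc.prems that by (auto simp: o_def)
  have split: "fderiv g (f x) (fderiv f x v) = (\<Sum>i<m. \<kappa> i (fderiv f x v) *\<^sub>R fderiv g (f x) (e i))"
    if "x \<in> S" for x v
  proof -
    have lin: "linear (fderiv g (f x))"
      using Suc.prems that by (intro linear_frechet_derivative) auto
    show ?thesis
      by (subst e[of "fderiv f x v"]) (simp add: linear_sum[OF lin] linear_scale[OF lin])
  qed
  have "Ck_on n S (\<lambda>x. fderiv (\<lambda>x. g (f x)) x v)" for v
  proof (rule Ck_on_cong[of n S "\<lambda>x. \<Sum>i<m. \<kappa> i (fderiv f x v) *\<^sub>R fderiv g (f x) (e i)"])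
    have "Ck_on n S (\<lambda>x. \<kappa> i (fderiv f x v) *\<^sub>R fderiv g (f x) (e i))" if "i < m" for i
    proof (rule Ck_on_bounded_bilinear[OF bounded_bilinear_scaleR])
      show "Ck_on n S (\<lambda>x. \<kappa> i (fderiv f x v))"
        by (rule Ck_on_bounded_linear_comp[OF \<kappa>[OF that]]) (use Suc.prems in auto)
      show "Ck_on n S (\<lambda>x. fderiv g (f x) (e i))"
        by (rule Suc.IH[of "\<lambda>y. fderiv g y (e i)"]) (use Suc.prems Ck_on_Suc_imp[OF Suc.prems(1)] in auto)
    qed (use Suc.prems in auto)
    then show "Ck_on n S (\<lambda>x. \<Sum>i<m. \<kappa> i (fderiv f x v) *\<^sub>R fderiv g (f x) (e i))"
      using Suc.prems by (intro Ck_on_sum) auto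
  qed (use Suc.prems in \<open>auto simp: fderiv_eqI[OF d] split\<close>)
  then show ?case using d by (auto simp: differentiable_def)
qed

text \<open>Differentiability at the points of \<open>S\<close> only behaves well under restriction, composition and change of
the function off \<open>S\<close> if \<open>S\<close> is open, so openness is part of the notion.\<close>

definition Cinf_on :: "'x::real_normed_vector set \<Rightarrow> ('x \<Rightarrow> 'y::real_normed_vector) \<Rightarrow> bool" where
  "Cinf_on S f \<longleftrightarrow> open S \<and> (\<forall>n. Ck_on n S f)"

lemma Cinf_on_open: "Cinf_on S f \<Longrightarrow> open S"
  by (simp add: Cinf_on_def)

lemma Cinf_on_differentiable: "Cinf_on S f \<Longrightarrow> x \<in> S \<Longrightarrow> f differentiable (at x)"
  by (metis Cinf_on_def Ck_on.simps(2))

lemma Cinf_on_has_derivative: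
  "Cinf_on S f \<Longrightarrow> x \<in> S \<Longrightarrow> (f has_derivative fderiv f x) (at x)"
  by (intro fderiv_works Cinf_on_differentiable)

lemma Cinf_on_continuous_on: "Cinf_on S f \<Longrightarrow> continuous_on S f"
  by (metis Cinf_on_def Ck_on.simps(1))

lemma Cinf_on_fderiv: "Cinf_on S f \<Longrightarrow> Cinf_on S (\<lambda>x. fderiv f x u)"
  by (metis Cinf_on_def Ck_on.simps(2))

lemma Cinf_on_subset: "Cinf_on S f \<Longrightarrow> open S' \<Longrightarrow> S' \<subseteq> S \<Longrightarrow> Cinf_on S' f"
  by (auto simp: Cinf_on_def intro: Ck_on_subset)

lemma Cinf_on_cong: "Cinf_on S f \<Longrightarrow> (\<And>x. x \<in> S \<Longrightarrow> f x = g x) \<Longrightarrow> Cinf_on S g"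
  by (auto simp: Cinf_on_def intro: Ck_on_cong)

lemma Cinf_on_local:
  assumes "open S" "\<And>x. x \<in> S \<Longrightarrow> \<exists>U. x \<in> U \<and> Cinf_on U f"
  shows "Cinf_on S f"
proof -
  have "Ck_on n S f" for n
    by (rule Ck_on_local) (use assms(2) in \<open>auto simp: Cinf_on_def\<close>)
  then show ?thesis using assms(1) by (simp add: Cinf_on_def)
qed

lemma Cinf_on_const: "open S \<Longrightarrow> Cinf_on S (\<lambda>x. c)"
  by (simp add: Cinf_on_def Ck_on_const)

lemma Cinf_on_ident: "open S \<Longrightarrow> Cinf_on S (\<lambda>x. x)"
  by (simp add: Cinf_on_def Ck_on_ident)

lemma Cinf_on_bounded_linear_comp:
  "bounded_linear h \<Longrightarrow> Cinf_on S f \<Longrightarrow> Cinf_on S (\<lambda>x. h (f x))"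
  by (simp add: Cinf_on_def Ck_on_bounded_linear_comp)

lemma Cinf_on_add: "Cinf_on S f \<Longrightarrow> Cinf_on S g \<Longrightarrow> Cinf_on S (\<lambda>x. f x + g x)"
  by (simp add: Cinf_on_def Ck_on_add)

lemma Cinf_on_minus: "Cinf_on S f \<Longrightarrow> Cinf_on S (\<lambda>x. - f x)"
  using Cinf_on_bounded_linear_comp[OF bounded_linear_minus[OF bounded_linear_ident]] .

lemma Cinf_on_diff: "Cinf_on S f \<Longrightarrow> Cinf_on S g \<Longrightarrow> Cinf_on S (\<lambda>x. f x - g x)"
  using Cinf_on_add[OF _ Cinf_on_minus, of S f g] by simp

lemma Cinf_on_scaleR:
  "Cinf_on S f \<Longrightarrow> Cinf_on S g \<Longrightarrow> Cinf_on S (\<lambda>x. f x *\<^sub>R g x)"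
  by (simp add: Cinf_on_def Ck_on_bounded_bilinear[OF bounded_bilinear_scaleR])

lemma Cinf_on_mult:
  fixes f g :: "'x::real_normed_vector \<Rightarrow> real"
  shows "Cinf_on S f \<Longrightarrow> Cinf_on S g \<Longrightarrow> Cinf_on S (\<lambda>x. f x * g x)"
  using Cinf_on_scaleR[of S f g] by simp

lemma Cinf_on_Pair:
  assumes "Cinf_on S f" "Cinf_on S g"
  shows "Cinf_on S (\<lambda>x. (f x, g x))"
proof -
  have "Cinf_on S (\<lambda>x. (f x, 0) + (0, g x))"
    by (intro Cinf_on_add assms Cinf_on_bounded_linear_comp[of "\<lambda>y. (y, 0)"]
          Cinf_on_bounded_linear_comp[of "\<lambda>y. (0, y)"]
          bounded_linear_Pair bounded_linear_ident bounded_linear_zero)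
  then show ?thesis by simp
qed

lemma Cinf_on_fst: "Cinf_on S f \<Longrightarrow> Cinf_on S (\<lambda>x. fst (f x))"
  by (rule Cinf_on_bounded_linear_comp[OF bounded_linear_fst])

lemma Cinf_on_snd: "Cinf_on S f \<Longrightarrow> Cinf_on S (\<lambda>x. snd (f x))"
  by (rule Cinf_on_bounded_linear_comp[OF bounded_linear_snd])

lemma Cinf_on_compose:
  fixes f :: "'x::real_normed_vector \<Rightarrow> 'y::real_normed_vector"
  assumes "has_coordinates TYPE('y)" "Cinf_on U g" "Cinf_on S f" "\<And>x. x \<in> S \<Longrightarrow> f x \<in> U"
  shows "Cinf_on S (\<lambda>x. g (f x))"
  using Ck_on_compose[OF assms(1), of _ S f U g] assms(2-4) unfolding Cinf_on_def by blast

text \<open>Joint smoothness of the derivative in point and direction, by the same expansion of the direction in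
coordinates as for compositions.\<close>

lemma Cinf_on_compose_fderiv:
  fixes p :: "'x::real_normed_vector \<Rightarrow> 'y::real_normed_vector"
  assumes coord: "has_coordinates TYPE('y)"
    and "Cinf_on U f" "Cinf_on S p" "Cinf_on S u" "\<And>x. x \<in> S \<Longrightarrow> p x \<in> U"
  shows "Cinf_on S (\<lambda>x. fderiv f (p x) (u x))"
proof -
  obtain m and e :: "nat \<Rightarrow> 'y" and \<kappa>
    where \<kappa>: "\<And>i. i < m \<Longrightarrow> bounded_linear (\<kappa> i)" and e: "\<And>y. y = (\<Sum>i<m. \<kappa> i y *\<^sub>R e i)"
    using coord unfolding has_coordinates_def by metis
  have split: "fderiv f (p x) (u x) = (\<Sum>i<m. \<kappa> i (u x) *\<^sub>R fderiv f (p x) (e i))" if "x \<in> S" for x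
  proof -
    have lin: "linear (fderiv f (p x))"
      using assms that by (intro linear_frechet_derivative Cinf_on_differentiable[of U]) auto
    show ?thesis
      by (subst e[of "u x"]) (simp add: linear_sum[OF lin] linear_scale[OF lin])
  qed
  have "Cinf_on S (\<lambda>x. \<kappa> i (u x) *\<^sub>R fderiv f (p x) (e i))" if "i < m" for i
    by (rule Cinf_on_scaleR[OF Cinf_on_bounded_linear_comp[OF \<kappa>[OF that] assms(4)]
          Cinf_on_compose[OF coord Cinf_on_fderiv[OF assms(2)] assms(3)]]) (rule assms(5))
  then have "Cinf_on S (\<lambda>x. \<Sum>i<m. \<kappa> i (u x) *\<^sub>R fderiv f (p x) (e i))"
    using Cinf_on_open[OF assms(3)] by (auto simp: Cinf_on_def intro!: Ck_on_sum)
  then show ?thesis by (rule Cinf_on_cong) (simp add: split)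
qed

lemma fderiv_compose:
  assumes "f differentiable (at x)" "g differentiable (at (f x))"
  shows "fderiv (\<lambda>y. g (f y)) x u = fderiv g (f x) (fderiv f x u)"
  using diff_chain_at[OF fderiv_works[OF assms(1)] fderiv_works[OF assms(2)]]
  by (intro fderiv_eqI) (simp add: o_def)

lemma smooth_on_open_iff:
  assumes "open S"
  shows "smooth_on S f \<longleftrightarrow> Cinf_on S f"
proof
  assume "smooth_on S f"
  then obtain U h where U: "open U" "S \<subseteq> U" "\<And>x. x \<in> S \<Longrightarrow> h x = f x" "\<And>n. Ck_on n U h"
    unfolding smooth_on_def by blast
  then have "Cinf_on S h" using assms by (auto simp: Cinf_on_def intro: Ck_on_subset)
  then show "Cinf_on S f" by (rule Cinf_on_cong) (use U in auto)
next
  assume "Cinf_on S f"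
  then show "smooth_on S f" unfolding smooth_on_def Cinf_on_def by blast
qed

lemma smooth_onE:
  assumes "smooth_on X f"
  obtains S h where "X \<subseteq> S" "Cinf_on S h" "\<And>x. x \<in> X \<Longrightarrow> h x = f x"
  using assms unfolding smooth_on_def Cinf_on_def by blast

lemma smooth_onI:
  assumes "Cinf_on S h" "X \<subseteq> S" "\<And>x. x \<in> X \<Longrightarrow> h x = f x"
  shows "smooth_on X f"
  using assms unfolding smooth_on_def Cinf_on_def by blast

lemma smooth_on_compose_Cinf_on:
  fixes f :: "'x::real_normed_vector \<Rightarrow> 'y::real_normed_vector"
  assumes "has_coordinates TYPE('y)" "smooth_on X g" "Cinf_on S f" "\<And>x. x \<in> S \<Longrightarrow> f x \<in> X"
  shows "Cinf_on S (\<lambda>x. g (f x))"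
proof -
  obtain U h where U: "X \<subseteq> U" "Cinf_on U h" "\<And>x. x \<in> X \<Longrightarrow> h x = g x"
    using smooth_onE[OF assms(2)] by blast
  have "Cinf_on S (\<lambda>x. h (f x))"
    by (rule Cinf_on_compose[OF assms(1) U(2) assms(3)]) (use assms(4) U(1) in auto)
  then show ?thesis by (rule Cinf_on_cong) (use assms(4) U(3) in auto)
qed

section \<open>Symmetry of second derivatives\<close>

text \<open>The second difference of \<open>f\<close> along \<open>h u\<close> and \<open>h v\<close> is the increment over \<open>{0..1}\<close> of the function
\<open>\<tau> \<mapsto> f (x + h u + \<tau> h v) - f (x + \<tau> h v)\<close>, whose derivative is \<open>h\<close> times an increment of the
directional derivative along \<open>v\<close>. The latter is differentiable at \<open>x\<close>, so the mean value inequality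
gives \<open>h\<^sup>2\<close> times the second derivative up to \<open>o(h\<^sup>2)\<close>.\<close>

lemma second_difference_estimate:
  fixes f :: "'x::real_normed_vector \<Rightarrow> 'y::real_normed_vector"
  assumes "open S" "x \<in> S" and f: "\<And>y. y \<in> S \<Longrightarrow> f differentiable (at y)"
    and f': "(\<lambda>y. fderiv f y v) differentiable (at x)"
    and "e > 0"
  shows "\<exists>d>0. \<forall>h. 0 < h \<and> h < d \<longrightarrow>
    norm (f (x + h *\<^sub>R u + h *\<^sub>R v) - f (x + h *\<^sub>R u) - f (x + h *\<^sub>R v) + f x
      - (h * h) *\<^sub>R fderiv (\<lambda>y. fderiv f y v) x u) \<le> e * (h * h)"
proof -
  define \<phi> where "\<phi> y = fderiv f y v" for y
  define W where "W = fderiv \<phi> x"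
  \<comment> \<open>The points that occur stay within distance \<open>h K\<close> of \<open>x\<close>; the summand 1 makes \<open>K\<close> positive.\<close>
  define K where "K = norm u + 2 * norm v + 1"
  have "K > 0" by (simp add: K_def add_nonneg_pos)
  have W: "(\<phi> has_derivative W) (at x)"
    using fderiv_works[OF f'] by (simp add: \<phi>_def[abs_def] W_def)
  interpret W: bounded_linear W using W by (rule has_derivative_bounded_linear)
  obtain r where "r > 0"
    and r: "\<And>y. norm (y - x) < r \<Longrightarrow> norm (\<phi> y - \<phi> x - W (y - x)) \<le> e / K * norm (y - x)"
    using W[unfolded has_derivative_at_alt, THEN conjunct2, rule_format, of "e / K"]
      \<open>e > 0\<close> \<open>K > 0\<close> by auto
  obtain \<rho> where "\<rho> > 0" and \<rho>: "ball x \<rho> \<subseteq> S"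
    using assms(1,2) openE by blast
  have "norm (f (x + h *\<^sub>R u + h *\<^sub>R v) - f (x + h *\<^sub>R u) - f (x + h *\<^sub>R v) + f x - (h * h) *\<^sub>R W u)
      \<le> e * (h * h)" if h: "0 < h" "h < min r \<rho> / K" for h
  proof -
    define y1 where "y1 \<tau> = x + h *\<^sub>R u + (\<tau> * h) *\<^sub>R v" for \<tau>
    define y0 where "y0 \<tau> = x + (\<tau> * h) *\<^sub>R v" for \<tau>
    define G where "G \<tau> = f (y1 \<tau>) - f (y0 \<tau>) - (\<tau> * (h * h)) *\<^sub>R W u" for \<tau>
    define G' where "G' \<tau> = h *\<^sub>R \<phi> (y1 \<tau>) - h *\<^sub>R \<phi> (y0 \<tau>) - (h * h) *\<^sub>R W u" for \<tau>
    have hK: "h * K < r" "h * K < \<rho>" using h \<open>K > 0\<close> by (auto simp: field_simps)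
    have n1: "norm (y1 \<tau> - x) \<le> h * (norm u + norm v)"
      and n0: "norm (y0 \<tau> - x) \<le> h * norm v" if "\<tau> \<in> {0..1}" for \<tau>
    proof -
      have v: "norm ((\<tau> * h) *\<^sub>R v) \<le> h * norm v"
        using that h(1) by (simp add: abs_mult mult_right_mono mult_left_le_one_le)
      then show "norm (y0 \<tau> - x) \<le> h * norm v" by (simp add: y0_def)
      show "norm (y1 \<tau> - x) \<le> h * (norm u + norm v)"
        using norm_triangle_ineq[of "h *\<^sub>R u" "(\<tau> * h) *\<^sub>R v"] v h(1)
        by (simp add: y1_def algebra_simps)
    qed
    have "h * (norm u + norm v) < h * K" "h * norm v < h * K"
      using h(1) by (auto simp: K_def intro!: mult_strict_left_mono add_nonneg_pos)
    then have near: "norm (y1 \<tau> - x) < r" "norm (y1 \<tau> - x) < \<rho>"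
        "norm (y0 \<tau> - x) < r" "norm (y0 \<tau> - x) < \<rho>" if "\<tau> \<in> {0..1}" for \<tau>
      using n1[OF that] n0[OF that] hK by auto
    then have inS: "y1 \<tau> \<in> S" "y0 \<tau> \<in> S" if "\<tau> \<in> {0..1}" for \<tau>
      using that \<rho> by (force simp: dist_norm norm_minus_commute)+
    have "(G has_derivative (\<lambda>s. s *\<^sub>R G' \<tau>)) (at \<tau> within {0..1})" if "\<tau> \<in> {0..1}" for \<tau>
    proof -
      have "(y1 has_derivative (\<lambda>s. (s * h) *\<^sub>R v)) (at \<tau>)"
        "(y0 has_derivative (\<lambda>s. (s * h) *\<^sub>R v)) (at \<tau>)"
        unfolding y1_def[abs_def] y0_def[abs_def] by (auto intro!: derivative_eq_intros)
      from diff_chain_at[OF this(1) fderiv_works[OF f[OF inS(1)[OF that]]]]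
        diff_chain_at[OF this(2) fderiv_works[OF f[OF inS(2)[OF that]]]]
      have "((\<lambda>\<tau>. f (y1 \<tau>)) has_derivative (\<lambda>s. fderiv f (y1 \<tau>) ((s * h) *\<^sub>R v))) (at \<tau>)"
        "((\<lambda>\<tau>. f (y0 \<tau>)) has_derivative (\<lambda>s. fderiv f (y0 \<tau>) ((s * h) *\<^sub>R v))) (at \<tau>)"
        by (simp_all add: o_def)
      then have "(G has_derivative (\<lambda>s. fderiv f (y1 \<tau>) ((s * h) *\<^sub>R v)
          - fderiv f (y0 \<tau>) ((s * h) *\<^sub>R v) - (s * (h * h)) *\<^sub>R W u)) (at \<tau>)"
        unfolding G_def[abs_def] by (auto intro!: derivative_eq_intros)
      moreover have "fderiv f (y1 \<tau>) ((s * h) *\<^sub>R v) = (s * h) *\<^sub>R \<phi> (y1 \<tau>)"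
        "fderiv f (y0 \<tau>) ((s * h) *\<^sub>R v) = (s * h) *\<^sub>R \<phi> (y0 \<tau>)" for s
        unfolding \<phi>_def
        by (rule linear_scale[OF linear_frechet_derivative[OF f[OF inS(1)[OF that]]]],
            rule linear_scale[OF linear_frechet_derivative[OF f[OF inS(2)[OF that]]]])
      moreover have "(s * h) *\<^sub>R p - (s * h) *\<^sub>R q - (s * (h * h)) *\<^sub>R w
          = s *\<^sub>R (h *\<^sub>R p - h *\<^sub>R q - (h * h) *\<^sub>R w)" for s :: real and p q w :: 'y
        by (simp add: scaleR_diff_right)
      ultimately have "(G has_derivative (\<lambda>s. s *\<^sub>R G' \<tau>)) (at \<tau>)"
        unfolding G'_def by (simp only:)
      then show ?thesis by (rule has_derivative_at_withinI)
    qed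
    moreover have "onorm (\<lambda>s. s *\<^sub>R G' \<tau>) \<le> e * (h * h)" if \<tau>: "\<tau> \<in> {0..1}" for \<tau>
    proof -
      have "\<phi> (y1 \<tau>) - \<phi> (y0 \<tau>) - h *\<^sub>R W u
          = (\<phi> (y1 \<tau>) - \<phi> x - W (y1 \<tau> - x)) - (\<phi> (y0 \<tau>) - \<phi> x - W (y0 \<tau> - x))"
        by (simp add: y1_def y0_def W.add W.scaleR W.diff)
      then have "norm (\<phi> (y1 \<tau>) - \<phi> (y0 \<tau>) - h *\<^sub>R W u)
          \<le> e / K * norm (y1 \<tau> - x) + e / K * norm (y0 \<tau> - x)"
        using r[OF near(1)[OF \<tau>]] r[OF near(3)[OF \<tau>]] norm_triangle_ineq4 by (smt (verit))
      also have "\<dots> \<le> e / K * (h * (norm u + norm v)) + e / K * (h * norm v)"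
        using n1[OF \<tau>] n0[OF \<tau>] \<open>e > 0\<close> \<open>K > 0\<close> by (intro add_mono mult_left_mono) auto
      also have "\<dots> = e / K * (h * (norm u + 2 * norm v))" by (simp add: algebra_simps)
      also have "\<dots> \<le> e / K * (h * K)"
        using h(1) \<open>e > 0\<close> \<open>K > 0\<close> by (intro mult_left_mono) (auto simp: K_def)
      also have "\<dots> = e * h" using \<open>K > 0\<close> by simp
      finally have "norm (\<phi> (y1 \<tau>) - \<phi> (y0 \<tau>) - h *\<^sub>R W u) \<le> e * h" .
      then have "h * norm (\<phi> (y1 \<tau>) - \<phi> (y0 \<tau>) - h *\<^sub>R W u) \<le> h * (e * h)"
        using h(1) by (intro mult_left_mono) auto
      moreover have "G' \<tau> = h *\<^sub>R (\<phi> (y1 \<tau>) - \<phi> (y0 \<tau>) - h *\<^sub>R W u)"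
        by (simp add: G'_def scaleR_diff_right)
      ultimately have "norm (G' \<tau>) \<le> e * (h * h)"
        using h(1) by (simp add: mult.left_commute)
      then show ?thesis
        using h(1) \<open>e > 0\<close> by (intro onorm_bound) (auto simp: mult.commute mult_left_mono)
    qed
    ultimately have "norm (G 1 - G 0) \<le> e * (h * h) * norm (1 - 0 :: real)"
      by (intro differentiable_bound[of "{0..1}" G "\<lambda>\<tau> s. s *\<^sub>R G' \<tau>"]) auto
    then show ?thesis by (simp add: G_def y1_def y0_def algebra_simps)
  qed
  then show ?thesis
    using \<open>r > 0\<close> \<open>\<rho> > 0\<close> \<open>K > 0\<close> unfolding W_def \<phi>_def
    by (intro exI[of _ "min r \<rho> / K"]) auto
qed

text \<open>The second difference is symmetric in \<open>u\<close> and \<open>v\<close>, and both iterated derivatives are its limit after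
division by \<open>h\<^sup>2\<close>.\<close>

lemma symmetric_second_fderiv:
  fixes f :: "'x::real_normed_vector \<Rightarrow> 'y::real_normed_vector"
  assumes f: "Cinf_on S f" and x: "x \<in> S"
  shows "fderiv (\<lambda>y. fderiv f y v) x u = fderiv (\<lambda>y. fderiv f y u) x v"
proof -
  let ?W = "\<lambda>u v. fderiv (\<lambda>y. fderiv f y v) x u"
  have "norm (?W u v - ?W v u) \<le> e" if "e > 0" for e
  proof -
    have est: "\<exists>d>0. \<forall>h. 0 < h \<and> h < d \<longrightarrow>
      norm (f (x + h *\<^sub>R u + h *\<^sub>R v) - f (x + h *\<^sub>R u) - f (x + h *\<^sub>R v) + f x
        - (h * h) *\<^sub>R ?W u v) \<le> e / 2 * (h * h)" for u v
      using that
      by (intro second_difference_estimate[OF Cinf_on_open[OF f] x Cinf_on_differentiable[OF f]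
            Cinf_on_differentiable[OF Cinf_on_fderiv[OF f] x]]) auto
    obtain d1 where d1: "d1 > 0" "\<And>h. 0 < h \<Longrightarrow> h < d1 \<Longrightarrow>
      norm (f (x + h *\<^sub>R u + h *\<^sub>R v) - f (x + h *\<^sub>R u) - f (x + h *\<^sub>R v) + f x
        - (h * h) *\<^sub>R ?W u v) \<le> e / 2 * (h * h)"
      using est[of u v] by blast
    obtain d2 where d2: "d2 > 0" "\<And>h. 0 < h \<Longrightarrow> h < d2 \<Longrightarrow>
      norm (f (x + h *\<^sub>R v + h *\<^sub>R u) - f (x + h *\<^sub>R v) - f (x + h *\<^sub>R u) + f x
        - (h * h) *\<^sub>R ?W v u) \<le> e / 2 * (h * h)"
      using est[of v u] by blast
    define h where "h = min d1 d2 / 2"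
    have h: "0 < h" "h < d1" "h < d2" using d1(1) d2(1) by (auto simp: h_def min_def)
    define \<Delta> where "\<Delta> = f (x + h *\<^sub>R u + h *\<^sub>R v) - f (x + h *\<^sub>R u) - f (x + h *\<^sub>R v) + f x"
    have \<Delta>': "\<Delta> = f (x + h *\<^sub>R v + h *\<^sub>R u) - f (x + h *\<^sub>R v) - f (x + h *\<^sub>R u) + f x"
      by (simp add: \<Delta>_def algebra_simps)
    have "norm (\<Delta> - (h * h) *\<^sub>R ?W u v) \<le> e / 2 * (h * h)"
      "norm (\<Delta> - (h * h) *\<^sub>R ?W v u) \<le> e / 2 * (h * h)"
      using d1(2)[OF h(1,2)] d2(2)[OF h(1,3)] by (simp_all only: \<Delta>_def[symmetric] \<Delta>'[symmetric])
    then have "norm ((\<Delta> - (h * h) *\<^sub>R ?W v u) - (\<Delta> - (h * h) *\<^sub>R ?W u v)) \<le> e * (h * h)"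
      using norm_triangle_ineq4[of "\<Delta> - (h * h) *\<^sub>R ?W v u" "\<Delta> - (h * h) *\<^sub>R ?W u v"] by linarith
    moreover have "(\<Delta> - (h * h) *\<^sub>R ?W v u) - (\<Delta> - (h * h) *\<^sub>R ?W u v)
        = (h * h) *\<^sub>R (?W u v - ?W v u)"
      by (simp add: scaleR_diff_right)
    ultimately have "(h * h) * norm (?W u v - ?W v u) \<le> (h * h) * e"
      using h(1) by (simp add: mult.commute)
    then show ?thesis using h(1) by simp
  qed
  then have "norm (?W u v - ?W v u) \<le> 0" by (rule field_le_epsilon) simp
  then show ?thesis by simp
qed

section \<open>Smooth families of points of a manifold\<close>

context smooth_manifold
begin

text \<open>Smooth maps from open sets of normed spaces into the manifold. Every map between manifolds in this
development is studied by composing it with such families, in particular with inverse charts; then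
smoothness and derivatives never involve charts of the source.\<close>

definition smooth_family :: "'x::real_normed_vector set \<Rightarrow> ('x \<Rightarrow> 'a) \<Rightarrow> bool" where
  "smooth_family S f \<longleftrightarrow> open S \<and> continuous_map (top_of_set S) T f \<and>
     (\<forall>c\<in>A. Cinf_on {x\<in>S. f x \<in> fst c} (\<lambda>x. snd c (f x)))"

lemma coordinates_model: "has_coordinates TYPE('e)"
  using finite_dimensional_model has_coordinates_of_span by blast

lemma coordinates_model_pair: "has_coordinates TYPE('e \<times> 'e)"
  by (rule has_coordinates_prod[OF coordinates_model coordinates_model])

lemma chart_subset: "c \<in> A \<Longrightarrow> fst c \<subseteq> topspace T"
  using chart_dom_open openin_subset by blast

lemma chart_inj: "c \<in> A \<Longrightarrow> inj_on (snd c) (fst c)"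
  using homeomorphic_imp_injective_map[OF chart_homeomorphic, of c] chart_subset[of c]
  by (simp add: topspace_subtopology Int_absorb1)

lemma chart_inv_chart: "c \<in> A \<Longrightarrow> x \<in> fst c \<Longrightarrow> chart_inv c (snd c x) = x"
  unfolding chart_inv_def by (rule inv_into_f_f[OF chart_inj])

lemma chart_inv_dom: "c \<in> A \<Longrightarrow> p \<in> snd c ` fst c \<Longrightarrow> chart_inv c p \<in> fst c"
  by (auto simp: chart_inv_chart)

lemma chart_chart_inv: "c \<in> A \<Longrightarrow> p \<in> snd c ` fst c \<Longrightarrow> snd c (chart_inv c p) = p"
  by (auto simp: chart_inv_chart)

lemma chart_image_openin:
  assumes "c \<in> A" "openin T V"
  shows "open (snd c ` (fst c \<inter> V))"
proof -
  have "openin (subtopology T (fst c)) (fst c \<inter> V)"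
    using assms(2) by (metis openin_subtopology_Int2)
  then have "openin (top_of_set (snd c ` fst c)) (snd c ` (fst c \<inter> V))"
    using homeomorphic_imp_open_map[OF chart_homeomorphic[OF assms(1)]] by (simp add: open_map_def)
  then show ?thesis
    using chart_image_open[OF assms(1)] by (simp add: openin_open_eq)
qed

lemma continuous_map_open_preimage:
  assumes "continuous_map (top_of_set S) T f" "open S" "openin T V"
  shows "open {x\<in>S. f x \<in> V}"
  using openin_continuous_map_preimage[OF assms(1,3)] assms(2) by (simp add: openin_open_eq)

lemma smooth_family_open: "smooth_family S f \<Longrightarrow> open S"
  by (simp add: smooth_family_def)

lemma smooth_family_continuous: "smooth_family S f \<Longrightarrow> continuous_map (top_of_set S) T f"
  by (simp add: smooth_family_def)

lemma smooth_family_into: "smooth_family S f \<Longrightarrow> x \<in> S \<Longrightarrow> f x \<in> topspace T"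
  using smooth_family_continuous continuous_map_image_subset_topspace by fastforce

lemma smooth_family_open_preimage:
  "smooth_family S f \<Longrightarrow> openin T V \<Longrightarrow> open {x\<in>S. f x \<in> V}"
  by (simp add: smooth_family_def continuous_map_open_preimage)

lemma smooth_family_chart:
  "smooth_family S f \<Longrightarrow> c \<in> A \<Longrightarrow> Cinf_on {x\<in>S. f x \<in> fst c} (\<lambda>x. snd c (f x))"
  by (simp add: smooth_family_def)

lemma chart_through:
  assumes "x \<in> topspace T"
  obtains c where "c \<in> A" "x \<in> fst c"
  using assms charts_cover by blast

text \<open>Around each point one chart suffices: continuity follows because charts are homeomorphisms, and
smoothness in all the other charts because transition maps are smooth.\<close>

lemma smooth_familyI:
  fixes f :: "'x::real_normed_vector \<Rightarrow> 'a"
  assumes S: "open S"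
    and loc: "\<And>x. x \<in> S \<Longrightarrow> \<exists>c\<in>A. \<exists>U. x \<in> U \<and> f ` U \<subseteq> fst c \<and> Cinf_on U (\<lambda>x. snd c (f x))"
  shows "smooth_family S f"
proof -
  have op: "open {x\<in>S. f x \<in> V}" if V: "openin T V" for V
  proof (subst open_subopen, safe)
    fix x assume x: "x \<in> S" "f x \<in> V"
    obtain c U where c: "c \<in> A" "x \<in> U" "f ` U \<subseteq> fst c" "Cinf_on U (\<lambda>x. snd c (f x))"
      using loc[OF x(1)] by blast
    define W where "W = U \<inter> (\<lambda>x. snd c (f x)) -` (snd c ` (fst c \<inter> V))"
    have "open W" unfolding W_def
      using Cinf_on_continuous_on[OF c(4)] Cinf_on_open[OF c(4)] chart_image_openin[OF c(1) V]
      by (rule continuous_open_preimage)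
    moreover have "x \<in> W" using c x by (auto simp: W_def)
    moreover have "f y \<in> V" if "y \<in> W" for y
      using that c(3) inj_onD[OF chart_inj[OF c(1)]] by (auto simp: W_def)
    ultimately show "\<exists>W. open W \<and> x \<in> W \<and> W \<subseteq> {x\<in>S. f x \<in> V}"
      using S x(1) by (intro exI[of _ "W \<inter> S"]) auto
  qed
  have "f ` S \<subseteq> topspace T" using loc chart_subset by fastforce
  then have cont: "continuous_map (top_of_set S) T f"
    using op S by (auto simp: continuous_map_def openin_open_eq Pi_iff)
  have "Cinf_on {x\<in>S. f x \<in> fst d} (\<lambda>x. snd d (f x))" if d: "d \<in> A" for d
  proof (rule Cinf_on_local)
    show od: "open {x\<in>S. f x \<in> fst d}" by (rule op[OF chart_dom_open[OF d]])
    fix x assume x: "x \<in> {x\<in>S. f x \<in> fst d}"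
    obtain c U where c: "c \<in> A" "x \<in> U" "f ` U \<subseteq> fst c" "Cinf_on U (\<lambda>x. snd c (f x))"
      using loc[of x] x by blast
    define W where "W = U \<inter> {x\<in>S. f x \<in> fst d}"
    have "Cinf_on W (\<lambda>x. snd c (f x))"
      using c(4) by (rule Cinf_on_subset) (use od Cinf_on_open[OF c(4)] in \<open>auto simp: W_def\<close>)
    then have "Cinf_on W (\<lambda>x. (snd d \<circ> chart_inv c) (snd c (f x)))"
      by (rule smooth_on_compose_Cinf_on[OF coordinates_model charts_compatible[OF c(1) d]])
         (use c(3) in \<open>auto simp: W_def\<close>)
    then have "Cinf_on W (\<lambda>x. snd d (f x))"
      by (rule Cinf_on_cong) (use c in \<open>auto simp: W_def chart_inv_chart\<close>)
    then show "\<exists>U. x \<in> U \<and> Cinf_on U (\<lambda>x. snd d (f x))"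
      using c(2) x by (intro exI[of _ W]) (auto simp: W_def)
  qed
  then show ?thesis using S cont by (simp add: smooth_family_def)
qed

lemma smooth_map_iff_smooth_family:
  assumes S: "open S"
  shows "smooth_map (top_of_set S) {(S, id)} T A f \<longleftrightarrow> smooth_family S f"
proof (cases "continuous_map (top_of_set S) T f")
  case True
  have id: "chart_inv (S, id) x = x" if "x \<in> S" for x
    using inv_into_f_f[of id S x] that by (simp add: chart_inv_def)
  have "smooth_on (S \<inter> f -` fst c) (snd c \<circ> f \<circ> chart_inv (S, id))
      \<longleftrightarrow> Cinf_on {x\<in>S. f x \<in> fst c} (\<lambda>x. snd c (f x))" if c: "c \<in> A" for c
  proof -
    have eq: "S \<inter> f -` fst c = {x\<in>S. f x \<in> fst c}" by auto
    have "open {x\<in>S. f x \<in> fst c}"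
      by (rule continuous_map_open_preimage[OF True S chart_dom_open[OF c]])
    then show ?thesis unfolding eq using id
      by (auto simp: smooth_on_open_iff elim!: Cinf_on_cong)
  qed
  then show ?thesis using True S by (simp add: smooth_map_def smooth_family_def)
qed (simp add: smooth_map_def smooth_family_def)

lemma smooth_intoE:
  assumes "smooth_into T A X f"
  obtains S h where "smooth_family S h" "X \<subseteq> S" "\<And>x. x \<in> X \<Longrightarrow> h x = f x"
  using assms smooth_map_iff_smooth_family unfolding smooth_into_def by blast

lemma smooth_intoI:
  assumes "smooth_family S h" "X \<subseteq> S" "\<And>x. x \<in> X \<Longrightarrow> h x = f x"
  shows "smooth_into T A X f"
  unfolding smooth_into_def using assms smooth_map_iff_smooth_family[OF smooth_family_open[OF assms(1)]]
    smooth_family_open[OF assms(1)]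
  by (intro exI[of _ S] exI[of _ h]) auto

lemma smooth_family_compose:
  fixes \<phi> :: "'y::real_normed_vector \<Rightarrow> 'x::real_normed_vector"
  assumes coord: "has_coordinates TYPE('x)" and f: "smooth_family S f"
    and \<phi>: "Cinf_on S' \<phi>" "\<And>y. y \<in> S' \<Longrightarrow> \<phi> y \<in> S"
  shows "smooth_family S' (\<lambda>y. f (\<phi> y))"
proof (rule smooth_familyI)
  show "open S'" using \<phi>(1) by (rule Cinf_on_open)
  fix y assume y: "y \<in> S'"
  obtain c where c: "c \<in> A" "f (\<phi> y) \<in> fst c"
    using smooth_family_into[OF f \<phi>(2)[OF y]] chart_through by blast
  define U where "U = S' \<inter> \<phi> -` {x\<in>S. f x \<in> fst c}"
  have "open U" unfolding U_def
    using Cinf_on_continuous_on[OF \<phi>(1)] Cinf_on_open[OF \<phi>(1)]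
      smooth_family_open_preimage[OF f chart_dom_open[OF c(1)]]
    by (rule continuous_open_preimage)
  with \<phi>(1) have "Cinf_on U \<phi>" by (rule Cinf_on_subset) (auto simp: U_def)
  then have "Cinf_on U (\<lambda>y. snd c (f (\<phi> y)))"
    by (rule Cinf_on_compose[OF coord smooth_family_chart[OF f c(1)]]) (auto simp: U_def)
  then show "\<exists>c\<in>A. \<exists>U. y \<in> U \<and> (\<lambda>y. f (\<phi> y)) ` U \<subseteq> fst c \<and> Cinf_on U (\<lambda>y. snd c (f (\<phi> y)))"
    using c y \<phi>(2) by (intro bexI[of _ c] exI[of _ U]) (auto simp: U_def)
qed

lemma smooth_family_const:
  assumes "open S" "h \<in> topspace T"
  shows "smooth_family S (\<lambda>_. h)"
proof (rule smooth_familyI[OF assms(1)])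
  fix x assume "x \<in> S"
  obtain c where "c \<in> A" "h \<in> fst c" using assms(2) chart_through by blast
  then show "\<exists>c\<in>A. \<exists>U. x \<in> U \<and> (\<lambda>_. h) ` U \<subseteq> fst c \<and> Cinf_on U (\<lambda>x. snd c h)"
    using Cinf_on_const[OF open_UNIV] by (intro bexI[of _ c] exI[of _ UNIV]) auto
qed

lemma smooth_family_chart_inv:
  assumes c: "c \<in> A"
  shows "smooth_family (snd c ` fst c) (chart_inv c)"
proof (rule smooth_familyI[OF chart_image_open[OF c]])
  have "Cinf_on (snd c ` fst c) (\<lambda>p. snd c (chart_inv c p))"
    using Cinf_on_ident[OF chart_image_open[OF c]]
    by (rule Cinf_on_cong) (simp add: chart_chart_inv[OF c])
  then show "\<exists>c'\<in>A. \<exists>U. p \<in> U \<and> chart_inv c ` U \<subseteq> fst c' \<and> Cinf_on U (\<lambda>p. snd c' (chart_inv c p))"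
    if "p \<in> snd c ` fst c" for p
    using that c chart_inv_dom[OF c] by (intro bexI[of _ c] exI[of _ "snd c ` fst c"]) auto
qed

end

context lie_group
begin

lemma smooth_family_carrier: "smooth_family S f \<Longrightarrow> x \<in> S \<Longrightarrow> f x \<in> carrier G"
  using smooth_family_into topspace_carrier by blast

lemma smooth_family_mult:
  fixes f1 f2 :: "'x::real_normed_vector \<Rightarrow> 'a"
  assumes f1: "smooth_family S f1" and f2: "smooth_family S f2"
  shows "smooth_family S (\<lambda>x. f1 x \<otimes>\<^bsub>G\<^esub> f2 x)"
  unfolding smooth_family_def
proof (intro conjI ballI)
  show S: "open S" by (rule smooth_family_open[OF f1])
  have "continuous_map (top_of_set S) T ((\<lambda>(x, y). x \<otimes>\<^bsub>G\<^esub> y) \<circ> (\<lambda>x. (f1 x, f2 x)))"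
  proof (rule continuous_map_compose)
    show "continuous_map (top_of_set S) (prod_topology T T) (\<lambda>x. (f1 x, f2 x))"
      using f1 f2 by (simp add: smooth_family_def continuous_map_pairedI)
    show "continuous_map (prod_topology T T) T (\<lambda>(x, y). x \<otimes>\<^bsub>G\<^esub> y)"
      using smooth_mult by (simp add: smooth_map_def)
  qed
  then show cont: "continuous_map (top_of_set S) T (\<lambda>x. f1 x \<otimes>\<^bsub>G\<^esub> f2 x)" by (simp add: o_def)
  fix d assume d: "d \<in> A"
  show "Cinf_on {x\<in>S. f1 x \<otimes>\<^bsub>G\<^esub> f2 x \<in> fst d} (\<lambda>x. snd d (f1 x \<otimes>\<^bsub>G\<^esub> f2 x))"
  proof (rule Cinf_on_local)
    show op: "open {x\<in>S. f1 x \<otimes>\<^bsub>G\<^esub> f2 x \<in> fst d}"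
      by (rule continuous_map_open_preimage[OF cont S chart_dom_open[OF d]])
    fix x assume x: "x \<in> {x\<in>S. f1 x \<otimes>\<^bsub>G\<^esub> f2 x \<in> fst d}"
    obtain c1 where c1: "c1 \<in> A" "f1 x \<in> fst c1"
      using x smooth_family_into[OF f1] chart_through by blast
    obtain c2 where c2: "c2 \<in> A" "f2 x \<in> fst c2"
      using x smooth_family_into[OF f2] chart_through by blast
    let ?c = "(fst c1 \<times> fst c2, map_prod (snd c1) (snd c2))"
    have "?c \<in> prod_atlas A A" using c1 c2 by (force simp: prod_atlas_def)
    then have sm: "smooth_on (map_prod (snd c1) (snd c2) ` (fst c1 \<times> fst c2 \<inter> (\<lambda>(x, y). x \<otimes>\<^bsub>G\<^esub> y) -` fst d))
        (snd d \<circ> (\<lambda>(x, y). x \<otimes>\<^bsub>G\<^esub> y) \<circ> chart_inv ?c)"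
      using smooth_mult d unfolding smooth_map_def by force
    have ci: "chart_inv ?c (snd c1 y, snd c2 z) = (y, z)" if "y \<in> fst c1" "z \<in> fst c2" for y z
      using inv_into_f_f[OF map_prod_inj_on[OF chart_inj[OF c1(1)] chart_inj[OF c2(1)]], of "(y, z)"] that
      by (simp add: chart_inv_def)
    define U where "U = {x\<in>S. f1 x \<in> fst c1} \<inter> {x\<in>S. f2 x \<in> fst c2} \<inter> {x\<in>S. f1 x \<otimes>\<^bsub>G\<^esub> f2 x \<in> fst d}"
    have oU: "open U" unfolding U_def
      by (intro open_Int op smooth_family_open_preimage[OF f1] smooth_family_open_preimage[OF f2]
            chart_dom_open c1 c2)
    have "Cinf_on U (\<lambda>x. (snd c1 (f1 x), snd c2 (f2 x)))"
      by (intro Cinf_on_Pair Cinf_on_subset[OF smooth_family_chart[OF f1 c1(1)] oU]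
            Cinf_on_subset[OF smooth_family_chart[OF f2 c2(1)] oU]) (auto simp: U_def)
    then have "Cinf_on U (\<lambda>x. (snd d \<circ> (\<lambda>(x, y). x \<otimes>\<^bsub>G\<^esub> y) \<circ> chart_inv ?c) (snd c1 (f1 x), snd c2 (f2 x)))"
      by (rule smooth_on_compose_Cinf_on[OF coordinates_model_pair sm])
         (auto simp: U_def intro!: rev_image_eqI)
    then have "Cinf_on U (\<lambda>x. snd d (f1 x \<otimes>\<^bsub>G\<^esub> f2 x))"
      by (rule Cinf_on_cong) (auto simp: U_def ci)
    then show "\<exists>U. x \<in> U \<and> Cinf_on U (\<lambda>x. snd d (f1 x \<otimes>\<^bsub>G\<^esub> f2 x))"
      using x c1 c2 by (intro exI[of _ U]) (auto simp: U_def)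
  qed
qed

lemma smooth_family_inv:
  fixes f :: "'x::real_normed_vector \<Rightarrow> 'a"
  assumes f: "smooth_family S f"
  shows "smooth_family S (\<lambda>x. inv\<^bsub>G\<^esub> (f x))"
  unfolding smooth_family_def
proof (intro conjI ballI)
  show S: "open S" by (rule smooth_family_open[OF f])
  have "continuous_map (top_of_set S) T ((\<lambda>x. inv\<^bsub>G\<^esub> x) \<circ> f)"
    using smooth_inv smooth_family_continuous[OF f] by (auto simp: smooth_map_def intro:
      continuous_map_compose)
  then show cont: "continuous_map (top_of_set S) T (\<lambda>x. inv\<^bsub>G\<^esub> (f x))" by (simp add: o_def)
  fix d assume d: "d \<in> A"
  show "Cinf_on {x\<in>S. inv\<^bsub>G\<^esub> (f x) \<in> fst d} (\<lambda>x. snd d (inv\<^bsub>G\<^esub> (f x)))"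
  proof (rule Cinf_on_local)
    show op: "open {x\<in>S. inv\<^bsub>G\<^esub> (f x) \<in> fst d}"
      by (rule continuous_map_open_preimage[OF cont S chart_dom_open[OF d]])
    fix x assume x: "x \<in> {x\<in>S. inv\<^bsub>G\<^esub> (f x) \<in> fst d}"
    obtain c where c: "c \<in> A" "f x \<in> fst c"
      using x smooth_family_into[OF f] chart_through by blast
    have sm: "smooth_on (snd c ` (fst c \<inter> (\<lambda>x. inv\<^bsub>G\<^esub> x) -` fst d)) (snd d \<circ> (\<lambda>x. inv\<^bsub>G\<^esub> x) \<circ> chart_inv c)"
      using smooth_inv c d unfolding smooth_map_def by blast
    define U where "U = {x\<in>S. f x \<in> fst c} \<inter> {x\<in>S. inv\<^bsub>G\<^esub> (f x) \<in> fst d}"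
    have oU: "open U" unfolding U_def
      by (intro open_Int op smooth_family_open_preimage[OF f] chart_dom_open c)
    have "Cinf_on U (\<lambda>x. snd c (f x))"
      by (intro Cinf_on_subset[OF smooth_family_chart[OF f c(1)] oU]) (auto simp: U_def)
    then have "Cinf_on U (\<lambda>x. (snd d \<circ> (\<lambda>x. inv\<^bsub>G\<^esub> x) \<circ> chart_inv c) (snd c (f x)))"
      by (rule smooth_on_compose_Cinf_on[OF coordinates_model sm]) (auto simp: U_def)
    then have "Cinf_on U (\<lambda>x. snd d (inv\<^bsub>G\<^esub> (f x)))"
      by (rule Cinf_on_cong) (auto simp: U_def chart_inv_chart[OF c(1)])
    then show "\<exists>U. x \<in> U \<and> Cinf_on U (\<lambda>x. snd d (inv\<^bsub>G\<^esub> (f x)))"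
      using x c by (intro exI[of _ U]) (auto simp: U_def)
  qed
qed

end

section \<open>Partial derivatives and linearity of the derivative\<close>

lemma fderiv_partial_fst:
  assumes "F differentiable (at (a, b))"
  shows "fderiv (\<lambda>y. F (y, b)) a u = fderiv F (a, b) (u, 0)"
proof -
  have "((\<lambda>y. (y, b)) has_derivative (\<lambda>u. (u, 0))) (at a)"
    by (auto intro!: derivative_eq_intros)
  then have "(F \<circ> (\<lambda>y. (y, b)) has_derivative fderiv F (a, b) \<circ> (\<lambda>u. (u, 0))) (at a)"
    by (rule diff_chain_at) (rule fderiv_works[OF assms])
  then show ?thesis by (simp add: o_def fderiv_eqI)
qed

lemma fderiv_partial_snd:
  assumes "F differentiable (at (a, b))"
  shows "fderiv (\<lambda>y. F (a, y)) b u = fderiv F (a, b) (0, u)"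
proof -
  have "((\<lambda>y. (a, y)) has_derivative (\<lambda>u. (0, u))) (at b)"
    by (auto intro!: derivative_eq_intros)
  then have "(F \<circ> (\<lambda>y. (a, y)) has_derivative fderiv F (a, b) \<circ> (\<lambda>u. (0, u))) (at b)"
    by (rule diff_chain_at) (rule fderiv_works[OF assms])
  then show ?thesis by (simp add: o_def fderiv_eqI)
qed

lemma fderiv_Pair_split:
  assumes "F differentiable (at (a, b))"
  shows "fderiv F (a, b) (u, v) = fderiv F (a, b) (u, 0) + fderiv F (a, b) (0, v)"
  using linear_add[OF linear_frechet_derivative[OF assms], of "(u, 0)" "(0, v)"] by simp

lemma fderiv_add: "f differentiable (at x) \<Longrightarrow> fderiv f x (u + v) = fderiv f x u + fderiv f x v"
  by (rule linear_add[OF linear_frechet_derivative])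

lemma fderiv_diff: "f differentiable (at x) \<Longrightarrow> fderiv f x (u - v) = fderiv f x u - fderiv f x v"
  by (rule linear_diff[OF linear_frechet_derivative])

lemma fderiv_neg: "f differentiable (at x) \<Longrightarrow> fderiv f x (- v) = - fderiv f x v"
  by (rule linear_neg[OF linear_frechet_derivative])

lemma fderiv_scaleR: "f differentiable (at x) \<Longrightarrow> fderiv f x (r *\<^sub>R v) = r *\<^sub>R fderiv f x v"
  by (rule linear_scale[OF linear_frechet_derivative])

lemma fderiv_zero: "f differentiable (at x) \<Longrightarrow> fderiv f x 0 = 0"
  by (rule linear_0[OF linear_frechet_derivative])

lemma fderiv_Pair_compose:
  assumes "F differentiable (at (f x, g x))" "f differentiable (at x)" "g differentiable (at x)"
  shows "fderiv (\<lambda>y. F (f y, g y)) x u = fderiv F (f x, g x) (fderiv f x u, fderiv g x u)"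
proof -
  have "((\<lambda>y. (f y, g y)) has_derivative (\<lambda>u. (fderiv f x u, fderiv g x u))) (at x)"
    by (intro has_derivative_Pair fderiv_works assms)
  then have "(F \<circ> (\<lambda>y. (f y, g y)) has_derivative
      fderiv F (f x, g x) \<circ> (\<lambda>u. (fderiv f x u, fderiv g x u))) (at x)"
    by (rule diff_chain_at) (use fderiv_works[OF assms(1)] in simp)
  then show ?thesis by (simp add: o_def fderiv_eqI)
qed

section \<open>Tangent vectors along a family\<close>

context smooth_manifold
begin

text \<open>The image of \<open>u\<close> under the differential of \<open>f\<close> at \<open>x\<close>.\<close>

definition tangent_along :: "('x::real_normed_vector \<Rightarrow> 'a) \<Rightarrow> 'x \<Rightarrow> 'x \<Rightarrow> ('a, 'e) tangent" where
  "tangent_along f x u = (\<lambda>c. if c \<in> charts_at A (f x) then fderiv (\<lambda>y. snd c (f y)) x u else 0)"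

lemma charts_atD: "c \<in> charts_at A x \<Longrightarrow> c \<in> A" "c \<in> charts_at A x \<Longrightarrow> x \<in> fst c"
  by (auto simp: charts_at_def)

lemma chart_at_in: "x \<in> topspace T \<Longrightarrow> chart_at A x \<in> charts_at A x"
  unfolding chart_at_def using chart_through[of x]
  by (metis (mono_tags, lifting) charts_at_def mem_Collect_eq someI_ex)

lemma smooth_family_chart_differentiable:
  assumes "smooth_family S f" "x \<in> S" "c \<in> A" "f x \<in> fst c"
  shows "(\<lambda>y. snd c (f y)) differentiable (at x)"
  by (rule Cinf_on_differentiable[OF smooth_family_chart[OF assms(1,3)]]) (use assms in auto)

text \<open>The chain rule in charts. With \<open>F\<close> the identity it says that coordinate vectors transform by the
derivatives of transition maps; with \<open>F\<close> a translation it computes tangent maps.\<close>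

lemma fderiv_through_chart:
  assumes f: "smooth_family S f" "x \<in> S" and c: "c \<in> A" "f x \<in> fst c"
    and F: "smooth_family (snd c ` fst c) (\<lambda>p. F (chart_inv c p))" and d: "d \<in> A" "F (f x) \<in> fst d"
  shows "fderiv (\<lambda>y. snd d (F (f y))) x u =
    fderiv (snd d \<circ> F \<circ> chart_inv c) (snd c (f x)) (fderiv (\<lambda>y. snd c (f y)) x u)"
proof -
  have "fderiv (\<lambda>y. snd d (F (f y))) x = fderiv (\<lambda>y. (snd d \<circ> F \<circ> chart_inv c) (snd c (f y))) x"
    by (rule fderiv_cong[of "{y\<in>S. f y \<in> fst c}"])
       (use f c smooth_family_open_preimage[OF f(1) chart_dom_open[OF c(1)]] in
         \<open>auto simp: chart_inv_chart\<close>)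
  moreover have d: "(snd d \<circ> F \<circ> chart_inv c) differentiable (at (snd c (f x)))"
    using smooth_family_chart_differentiable[OF F _ d(1), of "snd c (f x)"] c d
    by (simp add: chart_inv_chart o_def)
  ultimately show ?thesis
    using fderiv_compose[OF smooth_family_chart_differentiable[OF f c] d, of u] by (simp only:)
qed

lemma tangent_along_in_tangent_space:
  assumes "smooth_family S f" "x \<in> S"
  shows "tangent_along f x u \<in> tangent_space A (f x)"
proof -
  have *: "fderiv (\<lambda>y. snd d (f y)) x u
      = fderiv (snd d \<circ> chart_inv c) (snd c (f x)) (fderiv (\<lambda>y. snd c (f y)) x u)"
    if "c \<in> charts_at A (f x)" "d \<in> charts_at A (f x)" for c d
    using fderiv_through_chart[OF assms charts_atD[OF that(1)], of "\<lambda>x. x" d u]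
      smooth_family_chart_inv[OF charts_atD(1)[OF that(1)]] charts_atD[OF that(2)]
    by (simp add: o_def)
  show ?thesis unfolding tangent_space_def tangent_along_def mem_Collect_eq
  proof (intro conjI allI impI ballI, goal_cases)
    case (2 c d)
    then show ?case by (simp only: if_True) (rule *)
  qed simp
qed

lemma tangent_along_chart_inv:
  assumes "c \<in> A" "p \<in> snd c ` fst c"
  shows "tangent_along (chart_inv c) p u = tangent_of A c (chart_inv c p) u"
  unfolding tangent_along_def tangent_of_def chart_chart_inv[OF assms] by (simp only: o_def)

lemma tangent_space_transform:
  assumes "v \<in> tangent_space A x" "c \<in> charts_at A x" "d \<in> charts_at A x"
  shows "v d = fderiv (snd d \<circ> chart_inv c) (snd c x) (v c)"
  using assms unfolding tangent_space_def by blast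

lemma tangent_space_outside: "v \<in> tangent_space A x \<Longrightarrow> c \<notin> charts_at A x \<Longrightarrow> v c = 0"
  unfolding tangent_space_def by blast

lemma tangent_space_eq_tangent_of:
  assumes "v \<in> tangent_space A x" "c \<in> charts_at A x"
  shows "v = tangent_of A c x (v c)"
proof
  fix d
  show "v d = tangent_of A c x (v c) d"
    using tangent_space_transform[OF assms, of d] tangent_space_outside[OF assms(1), of d]
    by (cases "d \<in> charts_at A x") (simp_all only: tangent_of_def if_True if_False not_False_eq_True)
qed

lemma tangent_space_eq_tangent_along:
  assumes "v \<in> tangent_space A x" "c \<in> charts_at A x"
  shows "v = tangent_along (chart_inv c) (snd c x) (v c)"
proof -
  have "tangent_along (chart_inv c) (snd c x) (v c) = tangent_of A c x (v c)"
    using tangent_along_chart_inv[of c "snd c x" "v c"] charts_atD[OF assms(2)]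
    by (simp add: chart_inv_chart)
  with tangent_space_eq_tangent_of[OF assms] show ?thesis by (rule trans[OF _ sym])
qed

lemma tangent_along_chart_inv_self:
  assumes "c \<in> A" "p \<in> snd c ` fst c"
  shows "tangent_along (chart_inv c) p u c = u"
proof -
  have "fderiv (\<lambda>y. snd c (chart_inv c y)) p = fderiv (\<lambda>y. y) p"
    by (rule fderiv_cong[OF chart_image_open[OF assms(1)] assms(2)]) (simp add: chart_chart_inv assms)
  then show ?thesis
    using assms chart_inv_dom[OF assms] by (simp add: tangent_along_def charts_at_def)
qed

lemma tangent_map_tangent_along:
  assumes f: "smooth_family S f" "x \<in> S"
    and F: "\<And>c. c \<in> A \<Longrightarrow> smooth_family (snd c ` fst c) (\<lambda>p. F (chart_inv c p))"
  shows "tangent_map A F (f x) (tangent_along f x u) = tangent_along (\<lambda>y. F (f y)) x u"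
proof
  fix d
  let ?c = "chart_at A (f x)"
  have c: "?c \<in> charts_at A (f x)" by (rule chart_at_in[OF smooth_family_into[OF f]])
  show "tangent_map A F (f x) (tangent_along f x u) d = tangent_along (\<lambda>y. F (f y)) x u d"
    using c fderiv_through_chart[OF f charts_atD[OF c] F[OF charts_atD(1)[OF c]], of d u]
    by (cases "d \<in> charts_at A (F (f x))") (simp_all add: tangent_map_def tangent_along_def charts_atD)
qed

lemma tangent_along_compose:
  assumes f: "smooth_family S f" and \<phi>: "\<phi> differentiable (at y)" "\<phi> y \<in> S"
  shows "tangent_along (\<lambda>y. f (\<phi> y)) y u = tangent_along f (\<phi> y) (fderiv \<phi> y u)"
proof
  fix c
  show "tangent_along (\<lambda>y. f (\<phi> y)) y u c = tangent_along f (\<phi> y) (fderiv \<phi> y u) c"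
    using fderiv_compose[OF \<phi>(1) smooth_family_chart_differentiable[OF f \<phi>(2)], of c u]
    by (cases "c \<in> charts_at A (f (\<phi> y))") (simp_all add: tangent_along_def charts_atD)
qed

end

section \<open>The Darboux derivative\<close>

context lie_group
begin

abbreviation unit_charts :: "('a, 'e) chart set" where
  "unit_charts \<equiv> charts_at A \<one>\<^bsub>G\<^esub>"

text \<open>The right logarithmic derivative \<open>df f\<^sup>-\<^sup>1\<close>, read in a chart \<open>c\<close> at the identity: translate \<open>f\<close> by a
fixed group element so that it passes through the identity at \<open>x\<close>, and differentiate there. It is the
pullback under \<open>f\<close> of the right-invariant Maurer-Cartan form.\<close>

definition darboux :: "('a, 'e) chart \<Rightarrow> ('x::real_normed_vector \<Rightarrow> 'a) \<Rightarrow> 'x \<Rightarrow> 'x \<Rightarrow> 'e" where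
  "darboux c f x u = fderiv (\<lambda>y. snd c (f y \<otimes>\<^bsub>G\<^esub> inv\<^bsub>G\<^esub> (f x))) x u"

lemma one_in_topspace: "\<one>\<^bsub>G\<^esub> \<in> topspace T"
  by (simp add: topspace_carrier)

lemma smooth_family_right_translate:
  "smooth_family S f \<Longrightarrow> h \<in> carrier G \<Longrightarrow> smooth_family S (\<lambda>y. f y \<otimes>\<^bsub>G\<^esub> h)"
  by (intro smooth_family_mult smooth_family_const) (simp_all add: smooth_family_open topspace_carrier)

lemma smooth_family_left_translate:
  "smooth_family S f \<Longrightarrow> h \<in> carrier G \<Longrightarrow> smooth_family S (\<lambda>y. h \<otimes>\<^bsub>G\<^esub> f y)"
  by (intro smooth_family_mult smooth_family_const) (simp_all add: smooth_family_open topspace_carrier)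

lemma mult_inv_self: "smooth_family S f \<Longrightarrow> x \<in> S \<Longrightarrow> f x \<otimes>\<^bsub>G\<^esub> inv\<^bsub>G\<^esub> (f x) = \<one>\<^bsub>G\<^esub>"
  using smooth_family_carrier r_inv by blast

lemma darboux_eq_tangent_along:
  assumes "smooth_family S f" "x \<in> S" "c \<in> unit_charts"
  shows "darboux c f x u = tangent_along (\<lambda>y. f y \<otimes>\<^bsub>G\<^esub> inv\<^bsub>G\<^esub> (f x)) x u c"
  using assms mult_inv_self[OF assms(1,2)] by (simp add: darboux_def tangent_along_def)

lemma tangent_along_right_translate_in_lie_algebra:
  assumes "smooth_family S f" "x \<in> S"
  shows "tangent_along (\<lambda>y. f y \<otimes>\<^bsub>G\<^esub> inv\<^bsub>G\<^esub> (f x)) x u \<in> lie_algebra G A"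
  using tangent_along_in_tangent_space[OF smooth_family_right_translate[OF assms(1)
      inv_closed[OF smooth_family_carrier[OF assms]]] assms(2), of u] mult_inv_self[OF assms] by simp

lemma darboux_change_chart:
  assumes "smooth_family S f" "x \<in> S" "c \<in> unit_charts" "d \<in> unit_charts"
  shows "darboux d f x u = fderiv (snd d \<circ> chart_inv c) (snd c \<one>\<^bsub>G\<^esub>) (darboux c f x u)"
  unfolding darboux_eq_tangent_along[OF assms(1-3)] darboux_eq_tangent_along[OF assms(1,2,4)]
  by (rule tangent_space_transform[OF tangent_along_right_translate_in_lie_algebra[OF assms(1,2)]
    assms(3,4)])

lemma darboux_at_one:
  assumes "smooth_family S f" "x \<in> S" "f x = \<one>\<^bsub>G\<^esub>"
  shows "darboux c f x u = fderiv (\<lambda>y. snd c (f y)) x u"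
proof -
  have "fderiv (\<lambda>y. snd c (f y \<otimes>\<^bsub>G\<^esub> inv\<^bsub>G\<^esub> (f x))) x = fderiv (\<lambda>y. snd c (f y)) x"
    by (rule fderiv_cong[OF smooth_family_open[OF assms(1)] assms(2)])
       (use smooth_family_carrier[OF assms(1)] assms(3) in simp)
  then show ?thesis by (simp add: darboux_def)
qed

lemma darboux_cong:
  assumes "open S" "x \<in> S" "\<And>y. y \<in> S \<Longrightarrow> f y = g y"
  shows "darboux c f x u = darboux c g x u"
proof -
  have "fderiv (\<lambda>y. snd c (f y \<otimes>\<^bsub>G\<^esub> inv\<^bsub>G\<^esub> (f x))) x = fderiv (\<lambda>y. snd c (g y \<otimes>\<^bsub>G\<^esub> inv\<^bsub>G\<^esub> (g x))) x"
    by (rule fderiv_cong[OF assms(1,2)]) (use assms in simp)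
  then show ?thesis by (simp add: darboux_def)
qed

text \<open>Pullback is functorial.\<close>

lemma darboux_compose:
  assumes f: "smooth_family S f" and \<phi>: "\<phi> differentiable (at y)" "\<phi> y \<in> S"
    and c: "c \<in> unit_charts"
  shows "darboux c (\<lambda>y. f (\<phi> y)) y u = darboux c f (\<phi> y) (fderiv \<phi> y u)"
proof -
  have "smooth_family S (\<lambda>z. f z \<otimes>\<^bsub>G\<^esub> inv\<^bsub>G\<^esub> (f (\<phi> y)))"
    using smooth_family_right_translate[OF f] smooth_family_carrier[OF f \<phi>(2)] by simp
  from smooth_family_chart_differentiable[OF this \<phi>(2) charts_atD(1)[OF c]]
  have "(\<lambda>z. snd c (f z \<otimes>\<^bsub>G\<^esub> inv\<^bsub>G\<^esub> (f (\<phi> y)))) differentiable (at (\<phi> y))"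
    using mult_inv_self[OF f \<phi>(2)] charts_atD(2)[OF c] by simp
  from fderiv_compose[OF \<phi>(1) this] show ?thesis by (simp add: darboux_def)
qed

text \<open>The Maurer-Cartan form is right-invariant; concretely, \<open>f y (f x)\<^sup>-\<^sup>1\<close> does not change when \<open>f\<close> is
multiplied by \<open>h\<close> on the right.\<close>

lemma darboux_right_translate:
  assumes f: "smooth_family S f" and x: "x \<in> S" and h: "h \<in> carrier G"
  shows "darboux c (\<lambda>y. f y \<otimes>\<^bsub>G\<^esub> h) x u = darboux c f x u"
proof -
  have "f y \<otimes>\<^bsub>G\<^esub> h \<otimes>\<^bsub>G\<^esub> inv\<^bsub>G\<^esub> (f x \<otimes>\<^bsub>G\<^esub> h) = f y \<otimes>\<^bsub>G\<^esub> inv\<^bsub>G\<^esub> (f x)" if "y \<in> S" for y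
  proof -
    have "f y \<in> carrier G" "f x \<in> carrier G" using smooth_family_carrier[OF f] that x by auto
    then show ?thesis using h by (simp add: inv_mult_group m_assoc) (simp add: m_assoc[symmetric])
  qed
  then have "fderiv (\<lambda>y. snd c (f y \<otimes>\<^bsub>G\<^esub> h \<otimes>\<^bsub>G\<^esub> inv\<^bsub>G\<^esub> (f x \<otimes>\<^bsub>G\<^esub> h))) x
      = fderiv (\<lambda>y. snd c (f y \<otimes>\<^bsub>G\<^esub> inv\<^bsub>G\<^esub> (f x))) x"
    by (intro fderiv_cong[OF smooth_family_open[OF f] x]) simp
  then show ?thesis by (simp add: darboux_def)
qed

text \<open>Separating the two occurrences of \<open>x\<close> in \<open>darboux\<close> makes it a partial derivative, restricted to the
diagonal, of one smooth function.\<close>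

definition division_family :: "('a, 'e) chart \<Rightarrow> ('x::real_normed_vector \<Rightarrow> 'a) \<Rightarrow> 'x \<times> 'x \<Rightarrow> 'e" where
  "division_family c f z = snd c (f (fst z) \<otimes>\<^bsub>G\<^esub> inv\<^bsub>G\<^esub> (f (snd z)))"

lemma Cinf_on_division_family:
  fixes f :: "'x::real_normed_vector \<Rightarrow> 'a"
  assumes coord: "has_coordinates TYPE('x)" and f: "smooth_family S f" and c: "c \<in> A"
  shows "Cinf_on {z \<in> S \<times> S. f (fst z) \<otimes>\<^bsub>G\<^esub> inv\<^bsub>G\<^esub> (f (snd z)) \<in> fst c} (division_family c f)"
proof -
  have oS: "open (S \<times> S)" using smooth_family_open[OF f] by (simp add: open_Times)
  have "smooth_family (S \<times> S) (\<lambda>z. f (fst z))" "smooth_family (S \<times> S) (\<lambda>z. f (snd z))"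
    by (rule smooth_family_compose[OF coord f];
        use oS in \<open>auto intro: Cinf_on_fst Cinf_on_snd Cinf_on_ident\<close>)+
  then have "smooth_family (S \<times> S) (\<lambda>z. f (fst z) \<otimes>\<^bsub>G\<^esub> inv\<^bsub>G\<^esub> (f (snd z)))"
    by (intro smooth_family_mult smooth_family_inv)
  from smooth_family_chart[OF this c] show ?thesis by (simp add: division_family_def[abs_def])
qed

lemma darboux_eq_division:
  fixes f :: "'x::real_normed_vector \<Rightarrow> 'a"
  assumes coord: "has_coordinates TYPE('x)" and f: "smooth_family S f" "x \<in> S"
    and c: "c \<in> unit_charts"
  shows "darboux c f x u = fderiv (division_family c f) (x, x) (u, 0)"
proof -
  have "division_family c f differentiable (at (x, x))"
    by (rule Cinf_on_differentiable[OF Cinf_on_division_family[OF coord f(1) charts_atD(1)[OF c]]])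
       (use f mult_inv_self[OF f] charts_atD(2)[OF c] in simp)
  from fderiv_partial_fst[OF this, of u] show ?thesis by (simp add: darboux_def division_family_def)
qed

lemma Cinf_on_darboux:
  fixes f :: "'x::real_normed_vector \<Rightarrow> 'a" and p :: "'z::real_normed_vector \<Rightarrow> 'x"
  assumes coord: "has_coordinates TYPE('x)" and f: "smooth_family S f"
    and c: "c \<in> unit_charts"
    and p: "Cinf_on S' p" "\<And>z. z \<in> S' \<Longrightarrow> p z \<in> S" and u: "Cinf_on S' u"
  shows "Cinf_on S' (\<lambda>z. darboux c f (p z) (u z))"
proof -
  have "Cinf_on S' (\<lambda>z. fderiv (division_family c f) (p z, p z) (u z, 0))"
    by (rule Cinf_on_compose_fderiv[OF has_coordinates_prod[OF coord coord]
          Cinf_on_division_family[OF coord f charts_atD(1)[OF c]]])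
       (use p u mult_inv_self[OF f] charts_atD(2)[OF c] in
         \<open>auto intro!: Cinf_on_Pair Cinf_on_const Cinf_on_open[OF u]\<close>)
  then show ?thesis
    by (rule Cinf_on_cong) (use darboux_eq_division[OF coord f _ c] p in simp)
qed

end

section \<open>The Maurer-Cartan equation\<close>

context lie_group
begin

definition chart_mult :: "('a, 'e) chart \<Rightarrow> 'e \<times> 'e \<Rightarrow> 'e" where
  "chart_mult c z = snd c (chart_inv c (fst z) \<otimes>\<^bsub>G\<^esub> chart_inv c (snd z))"

text \<open>The left-invariant vector field with value \<open>w\<close> at the identity, in coordinates.\<close>

definition left_field :: "('a, 'e) chart \<Rightarrow> 'e \<Rightarrow> 'e \<Rightarrow> 'e" where
  "left_field c w p = fderiv (chart_mult c) (p, snd c \<one>\<^bsub>G\<^esub>) (0, w)"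

text \<open>The bracket \<open>[X, Y] = DY \<cdot> X - DX \<cdot> Y\<close> of the left-invariant fields with values \<open>u\<close> and \<open>v\<close>, at the
identity.\<close>

definition chart_bracket :: "('a, 'e) chart \<Rightarrow> 'e \<Rightarrow> 'e \<Rightarrow> 'e" where
  "chart_bracket c u v =
     fderiv (left_field c v) (snd c \<one>\<^bsub>G\<^esub>) u - fderiv (left_field c u) (snd c \<one>\<^bsub>G\<^esub>) v"

definition chart_mult_dom :: "('a, 'e) chart \<Rightarrow> ('e \<times> 'e) set" where
  "chart_mult_dom c = {z \<in> (snd c ` fst c) \<times> (snd c ` fst c).
     chart_inv c (fst z) \<otimes>\<^bsub>G\<^esub> chart_inv c (snd z) \<in> fst c}"

lemma chart_inv_carrier: "c \<in> A \<Longrightarrow> p \<in> snd c ` fst c \<Longrightarrow> chart_inv c p \<in> carrier G"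
  using chart_inv_dom chart_subset topspace_carrier by blast

lemma Cinf_on_chart_mult:
  assumes c: "c \<in> A"
  shows "Cinf_on (chart_mult_dom c) (chart_mult c)"
proof -
  let ?P = "snd c ` fst c"
  have oP: "open (?P \<times> ?P)" using chart_image_open[OF c] by (simp add: open_Times)
  have "smooth_family (?P \<times> ?P) (\<lambda>z. chart_inv c (fst z))" "smooth_family (?P \<times> ?P) (\<lambda>z. chart_inv
    c (snd z))"
    by (rule smooth_family_compose[OF coordinates_model smooth_family_chart_inv[OF c]];
        use oP in \<open>auto intro: Cinf_on_fst Cinf_on_snd Cinf_on_ident\<close>)+
  then have "smooth_family (?P \<times> ?P) (\<lambda>z. chart_inv c (fst z) \<otimes>\<^bsub>G\<^esub> chart_inv c (snd z))"
    by (rule smooth_family_mult)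
  from smooth_family_chart[OF this c] show ?thesis
    by (simp add: chart_mult_def[abs_def] chart_mult_dom_def)
qed

lemma chart_mult_left_one:
  assumes "c \<in> unit_charts" "p \<in> snd c ` fst c"
  shows "(snd c \<one>\<^bsub>G\<^esub>, p) \<in> chart_mult_dom c" "chart_mult c (snd c \<one>\<^bsub>G\<^esub>, p) = p"
  using assms charts_atD[OF assms(1)] chart_inv_carrier[of c p] chart_inv_dom[of c p]
  by (auto simp: chart_mult_dom_def chart_mult_def chart_inv_chart)

lemma chart_mult_right_one:
  assumes "c \<in> unit_charts" "p \<in> snd c ` fst c"
  shows "(p, snd c \<one>\<^bsub>G\<^esub>) \<in> chart_mult_dom c" "chart_mult c (p, snd c \<one>\<^bsub>G\<^esub>) = p"
  using assms charts_atD[OF assms(1)] chart_inv_carrier[of c p] chart_inv_dom[of c p]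
  by (auto simp: chart_mult_dom_def chart_mult_def chart_inv_chart)

lemma chart_mult_differentiable:
  "c \<in> A \<Longrightarrow> z \<in> chart_mult_dom c \<Longrightarrow> chart_mult c differentiable (at z)"
  using Cinf_on_differentiable[OF Cinf_on_chart_mult] .

lemma fderiv_chart_mult_at_one:
  assumes c: "c \<in> unit_charts"
  defines "q \<equiv> snd c \<one>\<^bsub>G\<^esub>"
  shows "fderiv (chart_mult c) (q, q) (u, 0) = u" "fderiv (chart_mult c) (q, q) (0, u) = u"
proof -
  have q: "q \<in> snd c ` fst c" using charts_atD[OF c] by (simp add: q_def)
  have diff: "chart_mult c differentiable (at (q, q))"
    unfolding q_def by (rule chart_mult_differentiable[OF charts_atD(1)[OF c]
          chart_mult_left_one(1)[OF c q, unfolded q_def]])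
  note oP = chart_image_open[OF charts_atD(1)[OF c]]
  have "fderiv (\<lambda>p. chart_mult c (p, q)) q = fderiv (\<lambda>p. p) q"
    by (rule fderiv_cong[OF oP q]) (simp add: q_def chart_mult_right_one[OF c])
  then show "fderiv (chart_mult c) (q, q) (u, 0) = u"
    using fderiv_partial_fst[OF diff, of u] by simp
  have "fderiv (\<lambda>p. chart_mult c (q, p)) q = fderiv (\<lambda>p. p) q"
    by (rule fderiv_cong[OF oP q]) (simp add: q_def chart_mult_left_one[OF c])
  then show "fderiv (chart_mult c) (q, q) (0, u) = u"
    using fderiv_partial_snd[OF diff, of u] by simp
qed

text \<open>In a chart around the identity, group division is multiplication after inversion, and
inversion has derivative \<open>- v\<close> there. Hence the mixed second derivative of division is minus that of
multiplication, and the latter is the derivative of a left-invariant field.\<close>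

lemma division_in_chart_at_one:
  assumes c: "c \<in> unit_charts"
  defines "q \<equiv> snd c \<one>\<^bsub>G\<^esub>"
  shows "fderiv (\<lambda>y. fderiv (division_family c (chart_inv c)) y (w, 0)) (q, q) (0, v)
    = - fderiv (left_field c v) q w"
proof -
  let ?N = "division_family c (chart_inv c)" and ?M = "chart_mult c" and ?P = "snd c ` fst c"
  note cA = charts_atD(1)[OF c] and c1 = charts_atD(2)[OF c]
  have q: "q \<in> ?P" and q1: "chart_inv c q = \<one>\<^bsub>G\<^esub>"
    using c1 by (simp_all add: q_def chart_inv_chart cA)
  define I where "I = {p \<in> ?P. inv\<^bsub>G\<^esub> (chart_inv c p) \<in> fst c}"
  define \<iota> where "\<iota> p = snd c (inv\<^bsub>G\<^esub> (chart_inv c p))" for p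
  have \<iota>: "Cinf_on I \<iota>"
    using smooth_family_chart[OF smooth_family_inv[OF smooth_family_chart_inv[OF cA]] cA]
    by (simp add: I_def \<iota>_def[abs_def])
  have oI: "open I" by (rule Cinf_on_open[OF \<iota>])
  have qI: "q \<in> I" and \<iota>q: "\<iota> q = q" using q c1 by (simp_all add: I_def \<iota>_def q1) (simp add: q_def)
  have \<iota>P: "\<iota> p \<in> ?P" and \<iota>_inv: "chart_inv c (\<iota> p) = inv\<^bsub>G\<^esub> (chart_inv c p)" if "p \<in> I" for p
    using that by (auto simp: I_def \<iota>_def chart_inv_chart cA)
  have N: "?N (y, p) = ?M (y, \<iota> p)" if "p \<in> I" for y p
    using \<iota>_inv[OF that] by (simp add: division_family_def chart_mult_def)
  have \<iota>d: "\<iota> differentiable (at q)" by (rule Cinf_on_differentiable[OF \<iota> qI])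
  have Md: "?M differentiable (at (q, p))" if "p \<in> ?P" for p
    using chart_mult_differentiable[OF cA chart_mult_left_one(1)[OF c that]] by (simp add: q_def)
  let ?W = "{z \<in> ?P \<times> ?P. chart_inv c (fst z) \<otimes>\<^bsub>G\<^esub> inv\<^bsub>G\<^esub> (chart_inv c (snd z)) \<in> fst c}"
  have NW: "Cinf_on ?W ?N"
    by (rule Cinf_on_division_family[OF coordinates_model smooth_family_chart_inv[OF cA] cA])
  have qW: "(q, p) \<in> ?W" if "p \<in> I" for p
    using that q chart_inv_carrier[OF cA, of p] by (simp add: I_def q1)
  \<comment> \<open>Differentiate the relation \<open>p \<cdot> p\<^sup>-\<^sup>1 = 1\<close> at the identity.\<close>
  have \<iota>': "fderiv \<iota> q v = - v"
  proof -
    have "fderiv (\<lambda>p. ?M (p, \<iota> p)) q v = fderiv (\<lambda>p. q) q v"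
    proof (rule fun_cong[OF fderiv_cong[OF oI qI]])
      fix p assume p: "p \<in> I"
      then have "chart_inv c p \<in> carrier G" using chart_inv_carrier[OF cA, of p] by (simp add: I_def)
      then show "?M (p, \<iota> p) = q" using \<iota>_inv[OF p] by (simp add: chart_mult_def q_def)
    qed
    moreover have "fderiv (\<lambda>p. ?M (p, \<iota> p)) q v = fderiv ?M (q, q) (v, fderiv \<iota> q v)"
      using fderiv_Pair_compose[of ?M "\<lambda>p. p" q \<iota> v] Md[OF q] \<iota>d by (simp add: \<iota>q)
    moreover have "\<dots> = v + fderiv \<iota> q v"
      using fderiv_Pair_split[OF Md[OF q], of v "fderiv \<iota> q v"] fderiv_chart_mult_at_one[OF c]
      by (simp add: q_def)
    ultimately show ?thesis by (simp add: add_eq_0_iff)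
  qed
  let ?N' = "\<lambda>y. fderiv ?N y (w, 0)" and ?M' = "\<lambda>y. fderiv ?M y (w, 0)"
  have "fderiv ?N' (q, q) (0, v) = fderiv (\<lambda>p. ?N' (q, p)) q v"
    by (rule fderiv_partial_snd[symmetric]) (rule Cinf_on_differentiable[OF Cinf_on_fderiv[OF NW]
      qW[OF qI]])
  also have "\<dots> = fderiv (\<lambda>p. ?M' (q, \<iota> p)) q v"
  proof (rule fun_cong[OF fderiv_cong[OF oI qI]])
    fix p assume p: "p \<in> I"
    have "?N' (q, p) = fderiv (\<lambda>y. ?N (y, p)) q w"
      using fderiv_partial_fst[OF Cinf_on_differentiable[OF NW qW[OF p]]] by simp
    also have "\<dots> = fderiv (\<lambda>y. ?M (y, \<iota> p)) q w" by (simp add: N[OF p])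
    also have "\<dots> = ?M' (q, \<iota> p)" by (rule fderiv_partial_fst[OF Md[OF \<iota>P[OF p]]])
    finally show "?N' (q, p) = ?M' (q, \<iota> p)" .
  qed
  also have "\<dots> = fderiv ?M' (q, q) (0, - v)"
  proof -
    have "?M' differentiable (at (q, q))"
      using Cinf_on_differentiable[OF Cinf_on_fderiv[OF Cinf_on_chart_mult[OF cA]]]
        chart_mult_left_one(1)[OF c q] by (simp add: q_def)
    from fderiv_Pair_compose[of ?M' "\<lambda>p. q" q \<iota> v] this \<iota>d show ?thesis
      by (simp add: \<iota>q \<iota>')
  qed
  also have "\<dots> = - fderiv ?M' (q, q) (0, v)"
    using fderiv_neg[OF Cinf_on_differentiable[OF Cinf_on_fderiv[OF Cinf_on_chart_mult[OF cA]]],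
        of "(q, q)" "(w, 0)" "(0, v)"] chart_mult_left_one(1)[OF c q] by (simp add: q_def)
  also have "fderiv ?M' (q, q) (0, v) = fderiv (\<lambda>y. fderiv ?M y (0, v)) (q, q) (w, 0)"
    by (rule symmetric_second_fderiv[OF Cinf_on_chart_mult[OF cA]])
       (use chart_mult_left_one(1)[OF c q] in \<open>simp add: q_def\<close>)
  also have "\<dots> = fderiv (\<lambda>p. fderiv ?M (p, q) (0, v)) q w"
    by (rule fderiv_partial_fst[symmetric], rule Cinf_on_differentiable[OF Cinf_on_fderiv[OF
      Cinf_on_chart_mult[OF cA]]])
       (use chart_mult_left_one(1)[OF c q] in \<open>simp add: q_def\<close>)
  finally show ?thesis by (simp add: left_field_def[abs_def] q_def)
qed

text \<open>The Darboux derivative of the inverse chart is a derivative of division on the diagonal. Its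
derivative along the diagonal is a pure second derivative, which is symmetric and drops out, plus the
mixed one.\<close>

lemma maurer_cartan_chart_at_one:
  assumes c: "c \<in> unit_charts"
  defines "q \<equiv> snd c \<one>\<^bsub>G\<^esub>"
  shows "fderiv (\<lambda>p. darboux c (chart_inv c) p w) q v - fderiv (\<lambda>p. darboux c (chart_inv c) p v) q w
    = chart_bracket c v w"
proof -
  let ?N = "division_family c (chart_inv c)" and ?P = "snd c ` fst c"
  note cA = charts_atD(1)[OF c]
  note si = smooth_family_chart_inv[OF cA]
  have q: "q \<in> ?P" using charts_atD(2)[OF c] by (simp add: q_def)
  let ?W = "{z \<in> ?P \<times> ?P. chart_inv c (fst z) \<otimes>\<^bsub>G\<^esub> inv\<^bsub>G\<^esub> (chart_inv c (snd z)) \<in> fst c}"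
  have NW: "Cinf_on ?W ?N" by (rule Cinf_on_division_family[OF coordinates_model si cA])
  have qW: "(q, q) \<in> ?W" using q mult_inv_self[OF si q] charts_atD(2)[OF c] by simp
  have expand: "fderiv (\<lambda>p. darboux c (chart_inv c) p w) q v
      = fderiv (\<lambda>y. fderiv ?N y (w, 0)) (q, q) (v, 0) - fderiv (left_field c v) q w" for v w
  proof -
    have d: "(\<lambda>y. fderiv ?N y (w, 0)) differentiable (at (q, q))"
      by (rule Cinf_on_differentiable[OF Cinf_on_fderiv[OF NW] qW])
    have "fderiv (\<lambda>p. darboux c (chart_inv c) p w) q v = fderiv (\<lambda>p. fderiv ?N (p, p) (w, 0)) q v"
      by (rule fun_cong[OF fderiv_cong[OF chart_image_open[OF cA] q]])
         (rule darboux_eq_division[OF coordinates_model si _ c])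
    also have "\<dots> = fderiv (\<lambda>y. fderiv ?N y (w, 0)) (q, q) (v, v)"
      using fderiv_Pair_compose[of "\<lambda>y. fderiv ?N y (w, 0)" "\<lambda>p. p" q "\<lambda>p. p" v] d by simp
    also have "\<dots> = fderiv (\<lambda>y. fderiv ?N y (w, 0)) (q, q) (v, 0)
        + fderiv (\<lambda>y. fderiv ?N y (w, 0)) (q, q) (0, v)"
      by (rule fderiv_Pair_split[OF d])
    finally show ?thesis using division_in_chart_at_one[OF c] by (simp add: q_def)
  qed
  show ?thesis
    using expand[of w v] expand[of v w] symmetric_second_fderiv[OF NW qW, of "(w, 0)" "(v, 0)"]
    by (simp add: chart_bracket_def q_def)
qed

text \<open>The structure equation \<open>d\<omega>(v, u) = [\<omega> v, \<omega> u]\<close> for the right-invariant form \<open>\<omega>\<close>, pulled back to the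
parameter space. By right-invariance \<open>f\<close> may be translated so that \<open>f x\<close> is the identity; near \<open>x\<close> it
is then the inverse chart composed with a map \<open>\<alpha>\<close> into the model space. The second derivatives of \<open>\<alpha>\<close>
cancel by symmetry, which leaves the equation for the inverse chart at the identity.\<close>

lemma maurer_cartan:
  fixes f :: "'x::real_normed_vector \<Rightarrow> 'a"
  assumes coord: "has_coordinates TYPE('x)" and f: "smooth_family S f" and x: "x \<in> S"
    and c: "c \<in> unit_charts"
  shows "fderiv (\<lambda>y. darboux c f y u) x v - fderiv (\<lambda>y. darboux c f y v) x u
    = chart_bracket c (darboux c f x v) (darboux c f x u)"
proof -
  note cA = charts_atD(1)[OF c]
  note si = smooth_family_chart_inv[OF cA]
  let ?P = "snd c ` fst c"
  define h where "h = inv\<^bsub>G\<^esub> (f x)"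
  define f1 where "f1 y = f y \<otimes>\<^bsub>G\<^esub> h" for y
  define q where "q = snd c \<one>\<^bsub>G\<^esub>"
  have q: "q \<in> ?P" using charts_atD(2)[OF c] by (simp add: q_def)
  have h: "h \<in> carrier G" using smooth_family_carrier[OF f x] by (simp add: h_def)
  have f1: "smooth_family S f1" unfolding f1_def[abs_def] by (rule smooth_family_right_translate[OF f h])
  have f1x: "f1 x = \<one>\<^bsub>G\<^esub>" using mult_inv_self[OF f x] by (simp add: f1_def h_def)
  define U where "U = {y\<in>S. f1 y \<in> fst c}"
  define \<alpha> where "\<alpha> y = snd c (f1 y)" for y
  have \<alpha>: "Cinf_on U \<alpha>" using smooth_family_chart[OF f1 cA] by (simp add: U_def \<alpha>_def[abs_def])
  have oU: "open U" by (rule Cinf_on_open[OF \<alpha>])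
  have xU: "x \<in> U" using x charts_atD(2)[OF c] by (simp add: U_def f1x)
  have \<alpha>x: "\<alpha> x = q" by (simp add: \<alpha>_def f1x q_def)
  have \<alpha>P: "\<alpha> y \<in> ?P" if "y \<in> U" for y using that by (simp add: U_def \<alpha>_def)
  have dar: "darboux c f y u = darboux c (chart_inv c) (\<alpha> y) (fderiv \<alpha> y u)" if "y \<in> U" for y u
  proof -
    have yS: "y \<in> S" using that by (simp add: U_def)
    have "darboux c f y u = darboux c f1 y u"
      unfolding f1_def[abs_def] by (rule darboux_right_translate[OF f yS h, symmetric])
    also have "\<dots> = darboux c (\<lambda>y. chart_inv c (\<alpha> y)) y u"
      by (rule darboux_cong[OF oU that]) (simp add: U_def \<alpha>_def chart_inv_chart cA)
    also have "\<dots> = darboux c (chart_inv c) (\<alpha> y) (fderiv \<alpha> y u)"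
      by (rule darboux_compose[OF si Cinf_on_differentiable[OF \<alpha> that] \<alpha>P[OF that] c])
    finally show ?thesis .
  qed
  have R1: "darboux c (chart_inv c) q w = w" for w
  proof -
    have "darboux c (chart_inv c) q w = fderiv (\<lambda>y. snd c (chart_inv c y)) q w"
      by (rule darboux_at_one[OF si q]) (use charts_atD(2)[OF c] in \<open>simp add: q_def chart_inv_chart cA\<close>)
    also have "\<dots> = fderiv (\<lambda>y. y) q w"
      by (rule fun_cong[OF fderiv_cong[OF chart_image_open[OF cA] q]]) (simp add: chart_chart_inv cA)
    finally show ?thesis by simp
  qed
  define J where "J z = darboux c (chart_inv c) (fst z) (snd z)" for z
  have J: "Cinf_on (?P \<times> UNIV) J" unfolding J_def[abs_def]
    by (rule Cinf_on_darboux[OF coordinates_model si c])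
       (use chart_image_open[OF cA] in \<open>auto intro!: Cinf_on_fst Cinf_on_snd Cinf_on_ident open_Times\<close>)
  have expand: "fderiv (\<lambda>y. darboux c f y u) x v
      = fderiv (\<lambda>p. darboux c (chart_inv c) p (fderiv \<alpha> x u)) q (fderiv \<alpha> x v)
        + fderiv (\<lambda>y. fderiv \<alpha> y u) x v" for u v
  proof -
    have Jd: "J differentiable (at (q, fderiv \<alpha> x u))"
      by (rule Cinf_on_differentiable[OF J]) (use q in simp)
    have "fderiv (\<lambda>y. darboux c f y u) x v = fderiv (\<lambda>y. J (\<alpha> y, fderiv \<alpha> y u)) x v"
      by (rule fun_cong[OF fderiv_cong[OF oU xU]]) (simp add: J_def dar)
    also have "\<dots> = fderiv J (q, fderiv \<alpha> x u) (fderiv \<alpha> x v, fderiv (\<lambda>y. fderiv \<alpha> y u) x v)"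
      using fderiv_Pair_compose[of J \<alpha> x "\<lambda>y. fderiv \<alpha> y u" v] Jd
        Cinf_on_differentiable[OF \<alpha> xU] Cinf_on_differentiable[OF Cinf_on_fderiv[OF \<alpha>] xU]
      by (simp add: \<alpha>x)
    also have "\<dots> = fderiv (\<lambda>p. J (p, fderiv \<alpha> x u)) q (fderiv \<alpha> x v)
        + fderiv (\<lambda>w. J (q, w)) (fderiv \<alpha> x u) (fderiv (\<lambda>y. fderiv \<alpha> y u) x v)"
      unfolding fderiv_partial_fst[OF Jd] fderiv_partial_snd[OF Jd] by (rule fderiv_Pair_split[OF Jd])
    finally show ?thesis by (simp add: J_def R1)
  qed
  have sym: "fderiv (\<lambda>y. fderiv \<alpha> y u) x v = fderiv (\<lambda>y. fderiv \<alpha> y v) x u"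
    by (rule symmetric_second_fderiv[OF \<alpha> xU])
  have dx: "darboux c f x w = fderiv \<alpha> x w" for w
    unfolding dar[OF xU] \<alpha>x by (rule R1)
  show ?thesis
    unfolding expand[of u v] expand[of v u] sym dx add_diff_cancel_right q_def
    by (rule maurer_cartan_chart_at_one[OF c])
qed

end

section \<open>Velocities on a closed interval\<close>

lemma has_vector_derivative_fderiv:
  fixes f :: "real \<Rightarrow> 'y::real_normed_vector"
  assumes "f differentiable (at t)"
  shows "(f has_vector_derivative fderiv f t 1) (at t within X)"
proof -
  have "(f has_derivative (\<lambda>r. r *\<^sub>R fderiv f t 1)) (at t)"
  proof -
    have "fderiv f t = (\<lambda>r. r *\<^sub>R fderiv f t 1)"
    proof
      fix r :: real
      show "fderiv f t r = r *\<^sub>R fderiv f t 1"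
        using fderiv_scaleR[OF assms, of r 1] by (simp only: real_scaleR_def mult_1_right)
    qed
    with fderiv_works[OF assms] show ?thesis by (simp only:)
  qed
  then show ?thesis unfolding has_vector_derivative_def by (rule has_derivative_at_withinI)
qed

text \<open>Curves are smooth on a closed interval as restrictions of curves on a neighbourhood; at the endpoints
the one-sided derivative of the curve is the derivative of the extension.\<close>

lemma vector_derivative_within_Icc:
  fixes h :: "real \<Rightarrow> 'y::real_normed_vector"
  assumes "(h has_vector_derivative D) (at t within {a..b})" "a < b" "t \<in> {a..b}"
    and "\<And>s. s \<in> {a..b} \<Longrightarrow> f s = h s"
  shows "vector_derivative f (at t within {a..b}) = D"
proof -
  have "(f has_vector_derivative D) (at t within {a..b})"
    by (rule has_vector_derivative_transform[OF assms(3) _ assms(1)]) (use assms(4) in auto)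
  then show ?thesis using vector_derivative_within_cbox[of a b t f D] assms(2,3) by simp
qed

lemma has_real_derivative_within_Icc_iff:
  fixes h :: "real \<Rightarrow> real"
  assumes h: "h differentiable (at t)" and "a < b" and t: "t \<in> {a..b}"
    and U: "open U" "t \<in> U" "\<And>s. s \<in> U \<Longrightarrow> s \<in> {a..b} \<Longrightarrow> f s = h s"
  shows "(f has_real_derivative E) (at t within {a..b}) \<longleftrightarrow> E = fderiv h t 1"
proof -
  obtain d where d: "d > 0" "\<And>s. dist s t < d \<Longrightarrow> s \<in> U"
    using U(1,2) unfolding open_dist by blast
  have "(h has_vector_derivative fderiv h t 1) (at t within {a..b})"
    by (rule has_vector_derivative_fderiv[OF h])
  then have f: "(f has_vector_derivative fderiv h t 1) (at t within {a..b})"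
    by (rule has_vector_derivative_transform_within[OF _ d(1) t]) (use d U(3) in force)
  then show ?thesis
    using vector_derivative_unique_within_closed_interval[of a b t f] assms(2) t
    by (auto simp: has_real_derivative_iff_has_vector_derivative)
qed

context smooth_manifold
begin

lemma tangent_space_add_scaleR:
  assumes v: "v \<in> tangent_space A x" and w: "w \<in> tangent_space A x"
  shows "(\<lambda>c. v c + r *\<^sub>R w c) \<in> tangent_space A x"
proof -
  have *: "v d + r *\<^sub>R w d = fderiv (snd d \<circ> chart_inv c) (snd c x) (v c + r *\<^sub>R w c)"
    if "c \<in> charts_at A x" "d \<in> charts_at A x" for c d
  proof -
    have "(\<lambda>p. snd d (chart_inv c p)) differentiable (at (snd c x))"
      by (rule smooth_family_chart_differentiable[OF smooth_family_chart_inv])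
         (use charts_atD that in \<open>auto simp: chart_inv_chart\<close>)
    then have diff: "snd d \<circ> chart_inv c differentiable (at (snd c x))" by (simp add: o_def)
    show ?thesis
      unfolding fderiv_add[OF diff] fderiv_scaleR[OF diff]
        tangent_space_transform[OF v that] tangent_space_transform[OF w that] ..
  qed
  show ?thesis unfolding tangent_space_def mem_Collect_eq
  proof (intro conjI allI impI ballI, goal_cases)
    case (1 c)
    then show ?case using tangent_space_outside[OF v] tangent_space_outside[OF w] by simp
  next
    case (2 c d)
    then show ?case by (rule *)
  qed
qed

lemma velocity_eq_tangent_along:
  assumes \<gamma>: "smooth_family S \<gamma>" and S: "{a..b} \<subseteq> S" and "a < b" and t: "t \<in> {a..b}"
    and g: "\<And>s. s \<in> {a..b} \<Longrightarrow> g s = \<gamma> s"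
  shows "velocity A {a..b} g t = tangent_along \<gamma> t 1"
proof
  fix d
  show "velocity A {a..b} g t d = tangent_along \<gamma> t 1 d"
  proof (cases "d \<in> charts_at A (\<gamma> t)")
    case True
    have "(\<lambda>y. snd d (\<gamma> y)) differentiable (at t)"
      by (rule smooth_family_chart_differentiable[OF \<gamma>]) (use charts_atD[OF True] S t in auto)
    from vector_derivative_within_Icc[OF has_vector_derivative_fderiv[OF this] \<open>a < b\<close> t, of "snd d \<circ> g"]
    show ?thesis using True g t by (simp add: velocity_def tangent_along_def)
  qed (use g t in \<open>simp add: velocity_def tangent_along_def\<close>)
qed

end

section \<open>The Lie algebra bracket in a chart\<close>

context lie_group
begin

lemma chart_one:
  assumes "c \<in> unit_charts"
  shows "snd c \<one>\<^bsub>G\<^esub> \<in> snd c ` fst c" "chart_inv c (snd c \<one>\<^bsub>G\<^esub>) = \<one>\<^bsub>G\<^esub>"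
  using charts_atD[OF assms] by (auto simp: chart_inv_chart)

lemma lie_algebra_eq_tangent_along:
  assumes "v \<in> lie_algebra G A" "c \<in> unit_charts"
  shows "v = tangent_along (chart_inv c) (snd c \<one>\<^bsub>G\<^esub>) (v c)"
  by (rule tangent_space_eq_tangent_along[OF assms])

lemma left_invariant_field_in_chart:
  assumes c: "c \<in> unit_charts" and \<eta>: "\<eta> \<in> lie_algebra G A" and p: "p \<in> snd c ` fst c"
  shows "left_invariant_field G A \<eta> (chart_inv c p) c = left_field c (\<eta> c) p"
proof -
  let ?g = "chart_inv c p" and ?q = "snd c \<one>\<^bsub>G\<^esub>"
  note cA = charts_atD(1)[OF c]
  note si = smooth_family_chart_inv
  have g: "?g \<in> carrier G" by (rule chart_inv_carrier[OF cA p])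
  have "left_invariant_field G A \<eta> ?g
      = tangent_map A (\<lambda>h. ?g \<otimes>\<^bsub>G\<^esub> h) (chart_inv c ?q) (tangent_along (chart_inv c) ?q (\<eta> c))"
    unfolding left_invariant_field_def lie_algebra_eq_tangent_along[OF \<eta> c, symmetric] chart_one(2)[OF c] ..
  also have "\<dots> = tangent_along (\<lambda>y. ?g \<otimes>\<^bsub>G\<^esub> chart_inv c y) ?q (\<eta> c)"
    by (rule tangent_map_tangent_along[OF si[OF cA] chart_one(1)[OF c]])
       (rule smooth_family_left_translate[OF si g])
  finally have "left_invariant_field G A \<eta> ?g c = fderiv (\<lambda>y. chart_mult c (p, y)) ?q (\<eta> c)"
    using g chart_inv_dom[OF cA p] cA chart_one(2)[OF c]
    by (simp add: tangent_along_def charts_at_def chart_mult_def)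
  also have "\<dots> = left_field c (\<eta> c) p"
    unfolding left_field_def
    by (rule fderiv_partial_snd[OF chart_mult_differentiable[OF cA chart_mult_right_one(1)[OF c p]]])
  finally show ?thesis .
qed

lemma ad_in_chart:
  assumes c: "c \<in> unit_charts" and \<xi>: "\<xi> \<in> lie_algebra G A" and \<eta>: "\<eta> \<in> lie_algebra G A"
  shows "ad G A \<xi> \<eta> c = chart_bracket c (\<xi> c) (\<eta> c)"
proof -
  have at1: "left_invariant_field G A v \<one>\<^bsub>G\<^esub> c = v c" if "v \<in> lie_algebra G A" for v
    using left_invariant_field_in_chart[OF c that chart_one(1)[OF c]] fderiv_chart_mult_at_one(2)[OF c]
    by (simp add: chart_one(2)[OF c] left_field_def)
  have fld: "fderiv (\<lambda>p. left_invariant_field G A v (chart_inv c p) c) (snd c \<one>\<^bsub>G\<^esub>)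
      = fderiv (left_field c (v c)) (snd c \<one>\<^bsub>G\<^esub>)" if "v \<in> lie_algebra G A" for v
    by (rule fderiv_cong[OF chart_image_open[OF charts_atD(1)[OF c]] chart_one(1)[OF c]])
       (rule left_invariant_field_in_chart[OF c that])
  show ?thesis
    using c by (simp add: ad_def vf_bracket_def chart_bracket_def at1[OF \<xi>] at1[OF \<eta>] fld[OF \<xi>] fld[OF \<eta>])
qed

text \<open>The bracket is defined chart by chart, and its coordinates have to be shown to transform like those of
a tangent vector. Realise \<open>\<xi>\<close> and \<open>\<eta>\<close> as the two partial derivatives at the identity of a
two-parameter family. By the Maurer-Cartan equation the bracket is then, in every chart, the same
combination of derivatives of Darboux derivatives; these transform by one and the same linear map, the
derivative of the transition map at the identity.\<close>

lemma ad_in_lie_algebra: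
  assumes \<xi>: "\<xi> \<in> lie_algebra G A" and \<eta>: "\<eta> \<in> lie_algebra G A"
  shows "ad G A \<xi> \<eta> \<in> lie_algebra G A"
proof -
  have *: "ad G A \<xi> \<eta> d = fderiv (snd d \<circ> chart_inv c) (snd c \<one>\<^bsub>G\<^esub>) (ad G A \<xi> \<eta> c)"
    if c: "c \<in> unit_charts" and d: "d \<in> unit_charts" for c d
  proof -
    let ?q = "snd c \<one>\<^bsub>G\<^esub>" and ?P = "snd c ` fst c"
    note cA = charts_atD(1)[OF c]
    define \<tau> where "\<tau> = fderiv (snd d \<circ> chart_inv c) ?q"
    \<comment> \<open>The affine family through the identity with partial derivatives \<open>\<xi>\<close> and \<open>\<eta>\<close>.\<close>
    define \<phi> :: "real \<times> real \<Rightarrow> 'e" where "\<phi> z = ?q + fst z *\<^sub>R \<xi> c + snd z *\<^sub>R \<eta> c" for z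
    define S where "S = \<phi> -` ?P"
    define f where "f z = chart_inv c (\<phi> z)" for z
    have \<phi>U: "Cinf_on UNIV \<phi>" unfolding \<phi>_def[abs_def]
      by (intro Cinf_on_add Cinf_on_scaleR Cinf_on_const Cinf_on_fst Cinf_on_snd Cinf_on_ident open_UNIV)
    have oS: "open S" unfolding S_def
      using Cinf_on_continuous_on[OF \<phi>U] chart_image_open[OF cA]
      by (metis continuous_on_open_vimage inf_top.right_neutral open_UNIV)
    have \<phi>: "Cinf_on S \<phi>" by (rule Cinf_on_subset[OF \<phi>U oS]) simp
    have f: "smooth_family S f" unfolding f_def[abs_def]
      by (rule smooth_family_compose[OF coordinates_model smooth_family_chart_inv[OF cA] \<phi>]) (simp
        add: S_def)
    have z: "0 \<in> S" using chart_one(1)[OF c] by (simp add: S_def \<phi>_def)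
    have f0: "f 0 = \<one>\<^bsub>G\<^esub>" using chart_one(2)[OF c] by (simp add: f_def \<phi>_def)
    have "(\<phi> has_derivative (\<lambda>z. fst z *\<^sub>R \<xi> c + snd z *\<^sub>R \<eta> c)) (at 0)"
      unfolding \<phi>_def[abs_def] by (auto intro!: derivative_eq_intros)
    then have \<phi>': "fderiv \<phi> 0 u = fst u *\<^sub>R \<xi> c + snd u *\<^sub>R \<eta> c" for u by (rule fderiv_eqI)
    have at0: "darboux e f 0 u = tangent_along (chart_inv c) ?q (fderiv \<phi> 0 u) e"
      if e: "e \<in> unit_charts" for e u
    proof -
      have "darboux e f 0 u = tangent_along f 0 u e"
        using e by (simp add: darboux_at_one[OF f z f0] tangent_along_def f0)
      also have "tangent_along f 0 u = tangent_along (chart_inv c) (\<phi> 0) (fderiv \<phi> 0 u)"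
        unfolding f_def[abs_def]
        by (rule tangent_along_compose[OF smooth_family_chart_inv[OF cA] Cinf_on_differentiable[OF \<phi> z]])
           (use z in \<open>simp add: S_def\<close>)
      finally show ?thesis by (simp add: \<phi>_def)
    qed
    have val: "darboux e f 0 (1, 0) = \<xi> e" "darboux e f 0 (0, 1) = \<eta> e"
      if e: "e \<in> unit_charts" for e
      using at0[OF e] lie_algebra_eq_tangent_along[OF \<xi> c] lie_algebra_eq_tangent_along[OF \<eta> c]
      by (metis \<phi>' fst_conv snd_conv scaleR_one scaleR_zero_left add.right_neutral)
         (metis at0[OF e] lie_algebra_eq_tangent_along[OF \<eta> c] \<phi>' fst_conv snd_conv scaleR_one
           scaleR_zero_left add.left_neutral)
    have mc: "ad G A \<xi> \<eta> e = fderiv (\<lambda>y. darboux e f y (0, 1)) 0 (1, 0) - fderiv (\<lambda>y. darboux e f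
      y (1, 0)) 0 (0, 1)"
      if e: "e \<in> unit_charts" for e
      using maurer_cartan[OF has_coordinates_real_pair f z e, of "(0, 1)" "(1, 0)"] by (simp add:
        val[OF e] ad_in_chart[OF e \<xi> \<eta>])
    have "snd d \<circ> chart_inv c differentiable (at ?q)"
      using smooth_family_chart_differentiable[OF smooth_family_chart_inv[OF cA] chart_one(1)[OF c], of d]
        charts_atD[OF d] chart_one(2)[OF c] by (simp add: o_def)
    then have \<tau>: "bounded_linear \<tau>"
      using fderiv_works has_derivative_bounded_linear unfolding \<tau>_def by blast
    have "fderiv (\<lambda>y. darboux d f y u) 0 v = \<tau> (fderiv (\<lambda>y. darboux c f y u) 0 v)" for u v
    proof -
      have "fderiv (\<lambda>y. darboux d f y u) 0 v = fderiv (\<lambda>y. \<tau> (darboux c f y u)) 0 v"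
        by (rule fun_cong[OF fderiv_cong[OF oS z]]) (use darboux_change_chart[OF f _ c d] in \<open>simp
          add: \<tau>_def\<close>)
      also have "\<dots> = \<tau> (fderiv (\<lambda>y. darboux c f y u) 0 v)"
      proof (rule fderiv_eqI[OF bounded_linear.has_derivative[OF \<tau> fderiv_works]])
        have "Cinf_on S (\<lambda>y. darboux c f y u)"
          by (rule Cinf_on_darboux[OF has_coordinates_real_pair f c]) (use oS in \<open>auto intro:
            Cinf_on_ident Cinf_on_const\<close>)
        then show "(\<lambda>y. darboux c f y u) differentiable (at 0)" using z by (rule Cinf_on_differentiable)
      qed
      finally show ?thesis .
    qed
    then show ?thesis
      unfolding mc[OF c] mc[OF d] \<tau>_def[symmetric] by (simp add: linear_diff bounded_linear.linear[OF \<tau>])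
  qed
  show ?thesis unfolding tangent_space_def mem_Collect_eq
  proof (intro conjI allI impI ballI, goal_cases)
    case (1 c)
    then show ?case by (simp add: ad_def vf_bracket_def)
  next
    case (2 c d)
    then show ?case by (rule *)
  qed
qed

lemma left_field_joint:
  assumes c: "c \<in> unit_charts"
  shows "Cinf_on ((snd c ` fst c) \<times> UNIV) (\<lambda>z. left_field c (snd z) (fst z))"
  unfolding left_field_def
  by (rule Cinf_on_compose_fderiv[OF coordinates_model_pair
        Cinf_on_chart_mult[OF charts_atD(1)[OF c]]])
     (use chart_image_open[OF charts_atD(1)[OF c]] chart_mult_right_one(1)[OF c] in
       \<open>auto intro!: Cinf_on_Pair Cinf_on_fst Cinf_on_snd Cinf_on_ident Cinf_on_const open_Times\<close>)

lemma fderiv_left_field: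
  assumes c: "c \<in> unit_charts"
  shows "fderiv (left_field c v) (snd c \<one>\<^bsub>G\<^esub>) u
    = fderiv (\<lambda>z. left_field c (snd z) (fst z)) (snd c \<one>\<^bsub>G\<^esub>, v) (u, 0)"
  using fderiv_partial_fst[OF Cinf_on_differentiable[OF left_field_joint[OF c]], of "snd c \<one>\<^bsub>G\<^esub>" v u]
    chart_one(1)[OF c] by simp

lemma Cinf_on_chart_bracket:
  fixes u v :: "'x::real_normed_vector \<Rightarrow> 'e"
  assumes c: "c \<in> unit_charts" and u: "Cinf_on S u" and v: "Cinf_on S v"
  shows "Cinf_on S (\<lambda>x. chart_bracket c (u x) (v x))"
proof -
  have "Cinf_on S (\<lambda>x. fderiv (left_field c (v x)) (snd c \<one>\<^bsub>G\<^esub>) (u x))"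
    if u: "Cinf_on S u" and v: "Cinf_on S v" for u v :: "'x \<Rightarrow> 'e"
    unfolding fderiv_left_field[OF c]
    by (rule Cinf_on_compose_fderiv[OF coordinates_model_pair
          left_field_joint[OF c]])
       (use u v chart_one(1)[OF c] in \<open>auto intro!: Cinf_on_Pair Cinf_on_const Cinf_on_open[OF u]\<close>)
  from Cinf_on_diff[OF this[OF u v] this[OF v u]] show ?thesis by (simp only: chart_bracket_def)
qed

lemma chart_bracket_scaleR_right:
  assumes c: "c \<in> unit_charts"
  shows "chart_bracket c u (r *\<^sub>R v) = r *\<^sub>R chart_bracket c u v"
proof -
  let ?q = "snd c \<one>\<^bsub>G\<^esub>" and ?P = "snd c ` fst c"
  note cA = charts_atD(1)[OF c]
  have lf: "Cinf_on ?P (left_field c w)" for w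
  proof -
    have "Cinf_on ?P (\<lambda>p. (\<lambda>z. left_field c (snd z) (fst z)) (p, w))"
      by (rule Cinf_on_compose[OF coordinates_model_pair left_field_joint[OF c]])
         (use chart_image_open[OF cA] in \<open>auto intro!: Cinf_on_Pair Cinf_on_ident Cinf_on_const\<close>)
    then show ?thesis by simp
  qed
  note lfd = Cinf_on_differentiable[OF lf chart_one(1)[OF c]]
  have "fderiv (left_field c (r *\<^sub>R v)) ?q u = fderiv (\<lambda>p. r *\<^sub>R left_field c v p) ?q u"
  proof (rule fun_cong[OF fderiv_cong[OF chart_image_open[OF cA] chart_one(1)[OF c]]])
    fix p assume p: "p \<in> ?P"
    show "left_field c (r *\<^sub>R v) p = r *\<^sub>R left_field c v p"
      using fderiv_scaleR[OF chart_mult_differentiable[OF cA chart_mult_right_one(1)[OF c p]], of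
        r "(0, v)"]
      by (simp add: left_field_def)
  qed
  also have "\<dots> = r *\<^sub>R fderiv (left_field c v) ?q u"
    by (rule fderiv_eqI[OF bounded_linear.has_derivative[OF bounded_linear_scaleR_right
      fderiv_works[OF lfd]]])
  finally show ?thesis
    by (simp add: chart_bracket_def fderiv_scaleR[OF lfd] scaleR_diff_right)
qed

end

section \<open>Strong and weak form of the Euler-Poincare equation\<close>

lemma has_real_derivative_fderiv:
  fixes f :: "real \<Rightarrow> real"
  assumes "f differentiable (at t)"
  shows "(f has_real_derivative fderiv f t 1) (at t within X)"
  using has_vector_derivative_fderiv[OF assms] by (simp add: has_real_derivative_iff_has_vector_derivative)

lemma momentum_product_rule:
  fixes \<l> :: "'y::real_normed_vector \<Rightarrow> real" and x y :: "real \<Rightarrow> 'y"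
  assumes coord: "has_coordinates TYPE('y)" and \<l>: "Cinf_on UNIV \<l>"
    and x: "Cinf_on S x" and y: "Cinf_on S y" and t: "t \<in> S"
  shows "fderiv (\<lambda>s. fderiv \<l> (x s) (y s)) t 1
    = fderiv (\<lambda>s. fderiv \<l> (x s) (y t)) t 1 + fderiv \<l> (x t) (fderiv y t 1)"
proof -
  define F where "F z = fderiv \<l> (x (fst z)) (snd z)" for z
  have x1: "Cinf_on (S \<times> UNIV) (\<lambda>z :: real \<times> 'y. x (fst z))"
    by (rule Cinf_on_compose[OF has_coordinates_real x])
       (use Cinf_on_open[OF x] in \<open>auto intro!: Cinf_on_fst Cinf_on_ident open_Times\<close>)
  have F: "Cinf_on (S \<times> UNIV) F" unfolding F_def[abs_def]
    by (rule Cinf_on_compose_fderiv[OF coord \<l> x1])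
       (use Cinf_on_open[OF x] in \<open>auto intro!: Cinf_on_snd Cinf_on_ident open_Times\<close>)
  have Fd: "F differentiable (at (t, y t))"
    by (rule Cinf_on_differentiable[OF F]) (use t in simp)
  have "fderiv (\<lambda>s. F (s, y s)) t 1 = fderiv F (t, y t) (1, fderiv y t 1)"
    using fderiv_Pair_compose[of F "\<lambda>s. s" t y 1] Fd Cinf_on_differentiable[OF y t] by simp
  also have "\<dots> = fderiv (\<lambda>s. F (s, y t)) t 1 + fderiv (\<lambda>w. F (t, w)) (y t) (fderiv y t 1)"
    unfolding fderiv_partial_fst[OF Fd] fderiv_partial_snd[OF Fd] by (rule fderiv_Pair_split[OF Fd])
  also have "fderiv (\<lambda>w. F (t, w)) (y t) (fderiv y t 1) = fderiv \<l> (x t) (fderiv y t 1)"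
    unfolding F_def fst_conv snd_conv
    by (rule fderiv_eqI[OF bounded_linear_imp_has_derivative[OF has_derivative_bounded_linear
          [OF Cinf_on_has_derivative[OF \<l> UNIV_I]]]])
  finally show ?thesis by (simp add: F_def)
qed

lemma integral_derivative_eq_0:
  fixes M :: "real \<Rightarrow> real"
  assumes M: "Cinf_on S M" and S: "{a..b} \<subseteq> S" and "a < b" and "M a = 0" "M b = 0"
  shows "((\<lambda>t. fderiv M t 1) has_integral 0) {a..b}"
proof -
  have "((\<lambda>t. fderiv M t 1) has_integral M b - M a) {a..b}"
    by (rule fundamental_theorem_of_calculus)
       (use assms(2,3) in \<open>auto intro!: has_vector_derivative_fderiv Cinf_on_differentiable[OF M]\<close>)
  then show ?thesis using assms by simp
qed

text \<open>Integration by parts and the fundamental lemma of the calculus of variations. The pairing of the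
momentum with a curve \<open>y\<close> vanishing at the endpoints has total derivative of integral zero, which
turns the weak integrand into minus the pairing of \<open>y\<close> with the defect of the strong equation. The
test curves are multiples of a fixed vector, which is where homogeneity of \<open>B\<close> in its second
argument comes in.\<close>

lemma strong_iff_weak_euler_poincare:
  fixes \<l> :: "'y::real_normed_vector \<Rightarrow> real" and x :: "real \<Rightarrow> 'y" and B :: "'y \<Rightarrow> 'y \<Rightarrow> 'y"
  assumes coord: "has_coordinates TYPE('y)" and \<l>: "Cinf_on UNIV \<l>"
    and x: "Cinf_on S x" and S: "{a..b} \<subseteq> S" and ab: "a < b"
    and B: "\<And>w. Cinf_on S (\<lambda>t. B (x t) w)"
    and B_scaleR: "\<And>u r w. B u (r *\<^sub>R w) = r *\<^sub>R B u w"
  shows "(\<forall>t\<in>{a..b}. \<forall>w. fderiv (\<lambda>s. fderiv \<l> (x s) w) t 1 = - fderiv \<l> (x t) (B (x t) w))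
    \<longleftrightarrow> (\<forall>Q y. Cinf_on Q y \<longrightarrow> {a..b} \<subseteq> Q \<longrightarrow> y a = 0 \<longrightarrow> y b = 0 \<longrightarrow>
          ((\<lambda>t. fderiv \<l> (x t) (fderiv y t 1 - B (x t) (y t))) has_integral 0) {a..b})"
    (is "?strong \<longleftrightarrow> ?weak")
proof -
  have ld: "\<l> differentiable (at u)" for u by (rule Cinf_on_differentiable[OF \<l> UNIV_I])
  have \<mu>: "Cinf_on Q (\<lambda>s. fderiv \<l> (x s) (y s))" if "Cinf_on Q y" "Q \<subseteq> S" for y Q
    by (rule Cinf_on_compose_fderiv[OF coord \<l> Cinf_on_subset[OF x Cinf_on_open[OF that(1)]
      that(2)] that(1)]) simp
  have total: "((\<lambda>t. fderiv (\<lambda>s. fderiv \<l> (x s) (y t)) t 1 + fderiv \<l> (x t) (fderiv y t 1))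
    has_integral 0) {a..b}"
    if y: "Cinf_on Q y" "{a..b} \<subseteq> Q" "y a = 0" "y b = 0" for Q y
  proof -
    have oSQ: "open (S \<inter> Q)" by (rule open_Int[OF Cinf_on_open[OF x] Cinf_on_open[OF y(1)]])
    have y': "Cinf_on (S \<inter> Q) y" and x': "Cinf_on (S \<inter> Q) x"
      using Cinf_on_subset[OF y(1) oSQ] Cinf_on_subset[OF x oSQ] by auto
    have "((\<lambda>t. fderiv (\<lambda>s. fderiv \<l> (x s) (y s)) t 1) has_integral 0) {a..b}"
      by (rule integral_derivative_eq_0[OF \<mu>[OF y']]) (use S y ab fderiv_zero[OF ld] in auto)
    then show ?thesis
      by (rule has_integral_eq[rotated])
         (rule momentum_product_rule[OF coord \<l> x' y'], use S y(2) in auto)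
  qed
  show ?thesis
  proof
    assume strong: ?strong
    show ?weak
    proof (intro allI impI)
      fix Q and y :: "real \<Rightarrow> 'y" assume y: "Cinf_on Q y" "{a..b} \<subseteq> Q" "y a = 0" "y b = 0"
      show "((\<lambda>t. fderiv \<l> (x t) (fderiv y t 1 - B (x t) (y t))) has_integral 0) {a..b}"
        using total[OF y] by (rule has_integral_eq[rotated]) (use strong in \<open>simp add: fderiv_diff[OF ld]\<close>)
    qed
  next
    assume weak: ?weak
    show ?strong
    proof (intro ballI allI)
      fix t w assume t: "t \<in> {a..b}"
      \<comment> \<open>The defect \<open>e\<close> of the strong equation in direction \<open>w\<close> is itself smooth, so it can be used
        to build the test curve; then the weak equation says that \<open>(s - a) (b - s) (e s)\<^sup>2\<close> integrates
        to zero.\<close>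
      define e where "e s = fderiv (\<lambda>s. fderiv \<l> (x s) w) s 1 + fderiv \<l> (x s) (B (x s) w)" for s
      define p where "p s = (s - a) * (b - s) * e s" for s
      define y where "y s = p s *\<^sub>R w" for s
      have oS: "open S" by (rule Cinf_on_open[OF x])
      have \<mu>w: "Cinf_on S (\<lambda>s. fderiv \<l> (x s) w)" by (rule \<mu>[OF Cinf_on_const[OF oS]]) simp
      have e: "Cinf_on S e" unfolding e_def[abs_def]
        by (intro Cinf_on_add Cinf_on_fderiv \<mu>w \<mu>[OF B]) simp
      have p: "Cinf_on S p" unfolding p_def[abs_def]
        by (intro Cinf_on_mult Cinf_on_diff Cinf_on_ident Cinf_on_const e oS)
      have y: "Cinf_on S y" unfolding y_def[abs_def] by (intro Cinf_on_scaleR p Cinf_on_const oS)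
      have ya: "y a = 0" and yb: "y b = 0" by (simp_all add: y_def p_def)
      have "((\<lambda>s. (fderiv (\<lambda>r. fderiv \<l> (x r) (y s)) s 1 + fderiv \<l> (x s) (fderiv y s 1))
          - fderiv \<l> (x s) (fderiv y s 1 - B (x s) (y s))) has_integral 0 - 0) {a..b}"
        using weak y S ya yb by (intro has_integral_diff total[OF y S ya yb]) blast
      then have "((\<lambda>s. p s * e s) has_integral 0 - 0) {a..b}"
      proof (rule has_integral_eq[rotated])
        fix s assume s: "s \<in> {a..b}"
        have "fderiv (\<lambda>r. fderiv \<l> (x r) (y s)) s 1 = p s * fderiv (\<lambda>r. fderiv \<l> (x r) w) s 1"
        proof -
          have "fderiv (\<lambda>r. p s *\<^sub>R fderiv \<l> (x r) w) s 1 = p s *\<^sub>R fderiv (\<lambda>r. fderiv \<l> (x r) w) s 1"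
            by (rule fderiv_eqI[OF bounded_linear.has_derivative[OF bounded_linear_scaleR_right
                  Cinf_on_has_derivative[OF \<mu>w]]]) (use s S in auto)
          then show ?thesis unfolding y_def fderiv_scaleR[OF ld] by simp
        qed
        then show "fderiv (\<lambda>r. fderiv \<l> (x r) (y s)) s 1 + fderiv \<l> (x s) (fderiv y s 1)
          - fderiv \<l> (x s) (fderiv y s 1 - B (x s) (y s)) = p s * e s"
          unfolding fderiv_diff[OF ld] by (simp add: y_def B_scaleR fderiv_scaleR[OF ld] e_def distrib_left)
      qed
      then have int: "((\<lambda>s. p s * e s) has_integral 0) (cbox a b)" by simp
      have pe: "p s * e s = (s - a) * (b - s) * (e s * e s)" for s by (simp add: p_def)
      have zero: "p s * e s = 0" if "s \<in> {a..b}" for s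
      proof (rule has_integral_0_cbox_imp_0[OF _ _ int])
        show "continuous_on (cbox a b) (\<lambda>s. p s * e s)"
          using Cinf_on_continuous_on[OF Cinf_on_mult[OF p e]] S continuous_on_subset by auto
        show "0 \<le> p s * e s" if "s \<in> box a b" for s
          using that by (simp add: pe)
      qed (use that ab in auto)
      have "e s = 0" if "s \<in> {a<..<b}" for s
        using zero[of s] that by (simp add: pe)
      moreover have "continuous_on (closure {a<..<b}) e"
        using Cinf_on_continuous_on[OF e] S ab continuous_on_subset by auto
      ultimately have "e t = 0"
        using continuous_constant_on_closure[of "{a<..<b}" e 0 t] t ab by auto
      then show "fderiv (\<lambda>s. fderiv \<l> (x s) w) t 1 = - fderiv \<l> (x t) (B (x t) w)"
        by (simp add: e_def)
    qed
  qed
qed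

section \<open>Reduction of the Lagrangian\<close>

context lie_group
begin

text \<open>The reduced Lagrangian on the Lie algebra, in the coordinates of a chart at the identity.\<close>

definition chart_lagrangian :: "('a \<times> ('a, 'e) tangent \<Rightarrow> real) \<Rightarrow> ('a, 'e) chart \<Rightarrow> 'e \<Rightarrow> real" where
  "chart_lagrangian L c w = local_lagrangian A L c (snd c \<one>\<^bsub>G\<^esub>, w)"

lemma lagrangian_at_one:
  assumes c: "c \<in> unit_charts" and v: "v \<in> lie_algebra G A"
  shows "L (\<one>\<^bsub>G\<^esub>, v) = chart_lagrangian L c (v c)"
proof -
  have "tangent_of A c \<one>\<^bsub>G\<^esub> (v c) = v" by (rule tangent_space_eq_tangent_of[OF v c, symmetric])
  then show ?thesis by (simp add: chart_lagrangian_def local_lagrangian_def chart_one(2)[OF c])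
qed

lemma Cinf_on_chart_lagrangian:
  assumes c: "c \<in> unit_charts" and L: "smooth_lagrangian A L"
  shows "Cinf_on UNIV (chart_lagrangian L c)"
proof -
  have "smooth_on (snd c ` fst c \<times> UNIV) (local_lagrangian A L c)"
    using L charts_atD(1)[OF c] by (simp add: smooth_lagrangian_def)
  from smooth_on_compose_Cinf_on[OF coordinates_model_pair this,
      of UNIV "\<lambda>w. (snd c \<one>\<^bsub>G\<^esub>, w)"]
  show ?thesis using chart_one(1)[OF c]
    by (simp add: chart_lagrangian_def[abs_def] Cinf_on_Pair Cinf_on_const Cinf_on_ident)
qed

text \<open>Right-invariance moves the base point to the identity, and the tangent vector becomes the Darboux
derivative.\<close>

lemma lagrangian_along:
  assumes L: "right_invariant G A L" and f: "smooth_family S f" "x \<in> S"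
    and c: "c \<in> unit_charts"
  shows "L (f x, tangent_along f x u) = chart_lagrangian L c (darboux c f x u)"
proof -
  let ?h = "inv\<^bsub>G\<^esub> (f x)"
  have fx: "f x \<in> carrier G" by (rule smooth_family_carrier[OF f])
  have "L (f x, tangent_along f x u)
      = L (right_translation G ?h (f x), tangent_map A (right_translation G ?h) (f x)
        (tangent_along f x u))"
    using L fx tangent_along_in_tangent_space[OF f] unfolding right_invariant_def by simp
  also have "right_translation G ?h (f x) = \<one>\<^bsub>G\<^esub>"
    using fx by (simp add: right_translation_def)
  also have "tangent_map A (right_translation G ?h) (f x) (tangent_along f x u)
      = tangent_along (\<lambda>y. f y \<otimes>\<^bsub>G\<^esub> ?h) x u"
    unfolding right_translation_def
    by (rule tangent_map_tangent_along[OF f])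
       (use fx in \<open>simp add: smooth_family_right_translate smooth_family_chart_inv\<close>)
  also have "L (\<one>\<^bsub>G\<^esub>, \<dots>) = chart_lagrangian L c (darboux c f x u)"
    unfolding darboux_eq_tangent_along[OF f c]
    by (rule lagrangian_at_one[OF c tangent_along_right_translate_in_lie_algebra[OF f]])
  finally show ?thesis .
qed

text \<open>In an arbitrary chart the Lagrangian is the reduced one composed with a linear map that depends on
the base point.\<close>

lemma local_lagrangian_eq_darboux:
  assumes L: "right_invariant G A L" and c: "c \<in> unit_charts" and d: "d \<in> A"
    and p: "p \<in> snd d ` fst d"
  shows "local_lagrangian A L d (p, u) = chart_lagrangian L c (darboux c (chart_inv d) p u)"
  using lagrangian_along[OF L smooth_family_chart_inv[OF d] p c, of u]
  by (simp add: tangent_along_chart_inv[OF d p] local_lagrangian_def)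

lemma reduced_velocity_eq:
  assumes \<gamma>: "smooth_family S \<gamma>" and S: "{a..b} \<subseteq> S" and ab: "a < b" and t: "t \<in> {a..b}"
    and g: "\<And>s. s \<in> {a..b} \<Longrightarrow> g s = \<gamma> s"
  shows "reduced_velocity G A {a..b} g t \<in> lie_algebra G A"
    and "c \<in> unit_charts \<Longrightarrow> reduced_velocity G A {a..b} g t c = darboux c \<gamma> t 1"
proof -
  have tS: "t \<in> S" using S t by auto
  have \<gamma>t: "\<gamma> t \<in> carrier G" by (rule smooth_family_carrier[OF \<gamma> tS])
  have v: "velocity A {a..b} g t = tangent_along \<gamma> t 1"
    by (rule velocity_eq_tangent_along[OF \<gamma> S ab t g])
  have "reduced_velocity G A {a..b} g t
      = tangent_map A (\<lambda>h. h \<otimes>\<^bsub>G\<^esub> inv\<^bsub>G\<^esub> (\<gamma> t)) (\<gamma> t) (tangent_along \<gamma> t 1)"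
    by (simp add: reduced_velocity_def right_translation_def v g[OF t])
  also have "\<dots> = tangent_along (\<lambda>y. \<gamma> y \<otimes>\<^bsub>G\<^esub> inv\<^bsub>G\<^esub> (\<gamma> t)) t 1"
    by (rule tangent_map_tangent_along[OF \<gamma> tS])
       (use \<gamma>t in \<open>simp add: smooth_family_right_translate smooth_family_chart_inv\<close>)
  finally have eq: "reduced_velocity G A {a..b} g t = tangent_along (\<lambda>y. \<gamma> y \<otimes>\<^bsub>G\<^esub> inv\<^bsub>G\<^esub> (\<gamma> t)) t 1" .
  show "reduced_velocity G A {a..b} g t \<in> lie_algebra G A"
    unfolding eq by (rule tangent_along_right_translate_in_lie_algebra[OF \<gamma> tS])
  show "reduced_velocity G A {a..b} g t c = darboux c \<gamma> t 1" if "c \<in> unit_charts"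
    unfolding eq by (rule darboux_eq_tangent_along[OF \<gamma> tS that, symmetric])
qed

lemma functional_derivative_in_chart:
  assumes c: "c \<in> unit_charts" and L: "smooth_lagrangian A L"
    and \<xi>: "\<xi> \<in> lie_algebra G A" and \<zeta>: "\<zeta> \<in> lie_algebra G A"
  shows "functional_derivative (reduced_lagrangian G L) \<xi> \<zeta> = fderiv (chart_lagrangian L c) (\<xi> c) (\<zeta> c)"
proof -
  let ?l = "chart_lagrangian L c"
  have ld: "?l differentiable (at (\<xi> c))"
    by (rule Cinf_on_differentiable[OF Cinf_on_chart_lagrangian[OF c L] UNIV_I])
  have eq: "reduced_lagrangian G L (\<lambda>d. \<xi> d + \<epsilon> *\<^sub>R \<zeta> d) = ?l (\<xi> c + \<epsilon> *\<^sub>R \<zeta> c)" for \<epsilon>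
    using lagrangian_at_one[OF c tangent_space_add_scaleR[OF \<xi> \<zeta>]] by (simp add: reduced_lagrangian_def)
  have "((\<lambda>\<epsilon>. \<xi> c + \<epsilon> *\<^sub>R \<zeta> c) has_derivative (\<lambda>\<epsilon>. \<epsilon> *\<^sub>R \<zeta> c)) (at 0)"
    by (auto intro!: derivative_eq_intros)
  from diff_chain_at[OF this, of ?l "fderiv ?l (\<xi> c)"] fderiv_works[OF ld]
  have "((\<lambda>\<epsilon>. ?l (\<xi> c + \<epsilon> *\<^sub>R \<zeta> c)) has_derivative (\<lambda>\<epsilon>. fderiv ?l (\<xi> c) (\<zeta> c) * \<epsilon>)) (at 0)"
    by (simp add: o_def fderiv_scaleR[OF ld] mult.commute)
  then have "((\<lambda>\<epsilon>. ?l (\<xi> c + \<epsilon> *\<^sub>R \<zeta> c)) has_real_derivative fderiv ?l (\<xi> c) (\<zeta> c)) (at 0)"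
    by (simp add: has_field_derivative_def)
  then show ?thesis unfolding functional_derivative_def eq by (rule DERIV_imp_deriv)
qed

text \<open>The formula \<open>\<delta>\<xi> = \<eta>' - [\<xi>, \<eta>]\<close> for the variation of the reduced velocity \<open>\<xi>\<close> along a deformation with
reduced variation field \<open>\<eta>\<close>. This is where the form of the admissible reduced variations comes from.\<close>

lemma zero_curvature:
  fixes f :: "real \<times> real \<Rightarrow> 'a"
  assumes f: "smooth_family S f" and z: "(\<epsilon>, t) \<in> S" and c: "c \<in> unit_charts"
  shows "fderiv (\<lambda>z. darboux c f z (0, 1)) (\<epsilon>, t) (1, 0)
    = fderiv (\<lambda>s. darboux c f (\<epsilon>, s) (1, 0)) t 1
      - chart_bracket c (darboux c f (\<epsilon>, t) (0, 1)) (darboux c f (\<epsilon>, t) (1, 0))"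
proof -
  have "Cinf_on S (\<lambda>z. darboux c f z (1, 0))"
    by (rule Cinf_on_darboux[OF has_coordinates_real_pair f c])
       (use smooth_family_open[OF f] in \<open>auto intro: Cinf_on_ident Cinf_on_const\<close>)
  from fderiv_partial_snd[OF Cinf_on_differentiable[OF this z], of 1]
  have "fderiv (\<lambda>s. darboux c f (\<epsilon>, s) (1, 0)) t 1 = fderiv (\<lambda>z. darboux c f z (1, 0)) (\<epsilon>, t) (0, 1)" .
  moreover have "chart_bracket c (darboux c f (\<epsilon>, t) (1, 0)) (darboux c f (\<epsilon>, t) (0, 1))
      = - chart_bracket c (darboux c f (\<epsilon>, t) (0, 1)) (darboux c f (\<epsilon>, t) (1, 0))"
    by (simp add: chart_bracket_def)
  ultimately show ?thesis
    using maurer_cartan[OF has_coordinates_real_pair f z c, of "(0, 1)" "(1, 0)"] by (simp add: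
      diff_eq_eq add.commute)
qed

text \<open>Differentiation under the integral sign, with the derivative of the integrand given by the formula for
\<open>\<delta>\<xi>\<close>.\<close>

lemma first_variation:
  fixes f :: "real \<times> real \<Rightarrow> 'a"
  assumes c: "c \<in> unit_charts" and L: "smooth_lagrangian A L"
    and f: "smooth_family S f" and \<delta>: "\<delta> > 0" "{-\<delta><..<\<delta>} \<times> {a..b} \<subseteq> S"
  defines "x \<equiv> \<lambda>t. darboux c f (0, t) (0, 1)" and "y \<equiv> \<lambda>t. darboux c f (0, t) (1, 0)"
  shows "((\<lambda>\<epsilon>. integral {a..b} (\<lambda>t. chart_lagrangian L c (darboux c f (\<epsilon>, t) (0, 1)))) has_real_derivative
      integral {a..b} (\<lambda>t. fderiv (chart_lagrangian L c) (x t) (fderiv y t 1 - chart_bracket c (x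
        t) (y t)))) (at 0)"
proof -
  let ?l = "chart_lagrangian L c"
  have oS: "open S" by (rule smooth_family_open[OF f])
  have dar: "Cinf_on S (\<lambda>z. darboux c f z u)" for u
    by (rule Cinf_on_darboux[OF has_coordinates_real_pair f c]) (use oS in \<open>auto intro:
      Cinf_on_ident Cinf_on_const\<close>)
  have l: "Cinf_on UNIV ?l" by (rule Cinf_on_chart_lagrangian[OF c L])
  define \<phi> where "\<phi> z = ?l (darboux c f z (0, 1))" for z
  have \<phi>: "Cinf_on S \<phi>" unfolding \<phi>_def[abs_def] by (rule Cinf_on_compose[OF coordinates_model l dar]) simp
  have "((\<lambda>\<epsilon>. integral (cbox a b) (\<lambda>t. \<phi> (\<epsilon>, t))) has_field_derivative
      integral (cbox a b) (\<lambda>t. fderiv \<phi> (0, t) (1, 0))) (at 0 within {-\<delta><..<\<delta>})"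
  proof (rule leibniz_rule_field_derivative[where fx = "\<lambda>\<epsilon> t. fderiv \<phi> (\<epsilon>, t) (1, 0)"])
    fix \<epsilon> t assume "\<epsilon> \<in> {-\<delta><..<\<delta>}" "t \<in> cbox a b"
    then have z: "(\<epsilon>, t) \<in> S" using \<delta>(2) by auto
    note d = Cinf_on_differentiable[OF \<phi> z]
    have "(\<phi> \<circ> (\<lambda>\<epsilon>. (\<epsilon>, t))) differentiable (at \<epsilon>)"
      by (rule differentiable_chain_at) (use d in \<open>auto simp: differentiable_def intro!:
        derivative_eq_intros\<close>)
    then show "((\<lambda>\<epsilon>. \<phi> (\<epsilon>, t)) has_field_derivative fderiv \<phi> (\<epsilon>, t) (1, 0)) (at \<epsilon> within {-\<delta><..<\<delta>})"
      using has_real_derivative_fderiv[of "\<lambda>\<epsilon>. \<phi> (\<epsilon>, t)" \<epsilon> "{-\<delta><..<\<delta>}"]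
      unfolding o_def fderiv_partial_fst[OF d] by blast
  next
    fix \<epsilon> assume e: "\<epsilon> \<in> {-\<delta><..<\<delta>}"
    have "continuous_on (cbox a b) (\<lambda>t. \<phi> (\<epsilon>, t))"
      by (rule continuous_on_compose2[OF Cinf_on_continuous_on[OF \<phi>]])
         (use e \<delta>(2) in \<open>auto intro!: continuous_intros\<close>)
    then show "(\<lambda>t. \<phi> (\<epsilon>, t)) integrable_on cbox a b" by (rule integrable_continuous)
  next
    show "continuous_on ({-\<delta><..<\<delta>} \<times> cbox a b) (\<lambda>(\<epsilon>, t). fderiv \<phi> (\<epsilon>, t) (1, 0))"
      using continuous_on_subset[OF Cinf_on_continuous_on[OF Cinf_on_fderiv[OF \<phi>]]] \<delta>(2)
      by (simp add: case_prod_beta)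
  qed (use \<delta>(1) in auto)
  moreover have "fderiv \<phi> (0, t) (1, 0) = fderiv ?l (x t) (fderiv y t 1 - chart_bracket c (x t) (y t))"
    if t: "t \<in> {a..b}" for t
  proof -
    have z: "(0, t) \<in> S" using t \<delta> by auto
    have "fderiv \<phi> (0, t) (1, 0) = fderiv ?l (x t) (fderiv (\<lambda>z. darboux c f z (0, 1)) (0, t) (1, 0))"
      unfolding \<phi>_def[abs_def] x_def
      by (rule fderiv_compose[OF Cinf_on_differentiable[OF dar z] Cinf_on_differentiable[OF l UNIV_I]])
    then show ?thesis unfolding zero_curvature[OF f z c] by (simp add: x_def y_def)
  qed
  then have "integral (cbox a b) (\<lambda>t. fderiv \<phi> (0, t) (1, 0))
      = integral {a..b} (\<lambda>t. fderiv ?l (x t) (fderiv y t 1 - chart_bracket c (x t) (y t)))"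
    unfolding cbox_interval by (rule integral_cong)
  ultimately show ?thesis
    using \<delta>(1) at_within_open[of 0 "{-\<delta><..<\<delta>}"] by (simp add: \<phi>_def)
qed

end

section \<open>Prescribing Darboux derivatives\<close>

context lie_group
begin

lemma darboux_bounded_linear:
  assumes f: "smooth_family S f" and x: "x \<in> S" and c: "c \<in> unit_charts"
  shows "bounded_linear (darboux c f x)"
proof -
  have "smooth_family S (\<lambda>y. f y \<otimes>\<^bsub>G\<^esub> inv\<^bsub>G\<^esub> (f x))"
    using smooth_family_right_translate[OF f] smooth_family_carrier[OF f x] by simp
  from smooth_family_chart_differentiable[OF this x charts_atD(1)[OF c]]
  have "(\<lambda>y. snd c (f y \<otimes>\<^bsub>G\<^esub> inv\<^bsub>G\<^esub> (f x))) differentiable (at x)"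
    using mult_inv_self[OF f x] charts_atD(2)[OF c] by simp
  from has_derivative_bounded_linear[OF fderiv_works[OF this]]
  show ?thesis by (simp add: darboux_def[abs_def])
qed

text \<open>Straight lines in the chart at the identity, translated by \<open>h\<close>, realise every value of the Darboux
derivative at every group element.\<close>

lemma darboux_chart_line:
  fixes w :: 'e
  assumes c: "c \<in> unit_charts" and h: "h \<in> carrier G"
  defines "S \<equiv> {r. snd c \<one>\<^bsub>G\<^esub> + r *\<^sub>R w \<in> snd c ` fst c}"
  shows "smooth_family S (\<lambda>r. chart_inv c (snd c \<one>\<^bsub>G\<^esub> + r *\<^sub>R w) \<otimes>\<^bsub>G\<^esub> h)" and "0 \<in> S"
    and "darboux c (\<lambda>r. chart_inv c (snd c \<one>\<^bsub>G\<^esub> + r *\<^sub>R w) \<otimes>\<^bsub>G\<^esub> h) 0 1 = w"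
proof -
  let ?q = "snd c \<one>\<^bsub>G\<^esub>"
  note cA = charts_atD(1)[OF c]
  have \<phi>: "Cinf_on UNIV (\<lambda>r. ?q + r *\<^sub>R w)"
    by (intro Cinf_on_add Cinf_on_scaleR Cinf_on_const Cinf_on_ident open_UNIV)
  have oS: "open S"
    using continuous_open_preimage[OF Cinf_on_continuous_on[OF \<phi>] open_UNIV chart_image_open[OF cA]]
    by (simp add: S_def vimage_def)
  have line: "smooth_family S (\<lambda>r. chart_inv c (?q + r *\<^sub>R w))"
    by (rule smooth_family_compose[OF coordinates_model smooth_family_chart_inv[OF cA]
      Cinf_on_subset[OF \<phi> oS]])
       (simp_all add: S_def)
  show "smooth_family S (\<lambda>r. chart_inv c (?q + r *\<^sub>R w) \<otimes>\<^bsub>G\<^esub> h)"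
    by (rule smooth_family_right_translate[OF line h])
  show 0: "0 \<in> S" using chart_one(1)[OF c] by (simp add: S_def)
  have "darboux c (\<lambda>r. chart_inv c (?q + r *\<^sub>R w) \<otimes>\<^bsub>G\<^esub> h) 0 1 = darboux c (\<lambda>r. chart_inv c (?q + r
    *\<^sub>R w)) 0 1"
    by (rule darboux_right_translate[OF line 0 h])
  also have "\<dots> = fderiv (\<lambda>r. snd c (chart_inv c (?q + r *\<^sub>R w))) 0 1"
    by (rule darboux_at_one[OF line 0]) (simp add: chart_one(2)[OF c])
  also have "\<dots> = fderiv (\<lambda>r. ?q + r *\<^sub>R w) 0 1"
    by (rule fun_cong[OF fderiv_cong[OF oS 0]]) (simp add: S_def chart_chart_inv[OF cA])
  also have "\<dots> = w"
  proof -
    have "((\<lambda>r. ?q + r *\<^sub>R w) has_derivative (\<lambda>r. r *\<^sub>R w)) (at 0)"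
      by (auto intro!: derivative_eq_intros)
    from fderiv_eqI[OF this, of 1] show ?thesis by simp
  qed
  finally show "darboux c (\<lambda>r. chart_inv c (?q + r *\<^sub>R w) \<otimes>\<^bsub>G\<^esub> h) 0 1 = w" .
qed

text \<open>A translated line with Darboux derivative \<open>\<zeta>\<close> at \<open>p\<close> factors through the chart \<open>d\<close>, and its
velocity in that chart is the required \<open>w\<close>.\<close>

lemma darboux_chart_inv_surj:
  assumes c: "c \<in> unit_charts" and d: "d \<in> A" and p: "p \<in> snd d ` fst d"
  shows "\<exists>w. darboux c (chart_inv d) p w = \<zeta>"
proof -
  let ?q = "snd c \<one>\<^bsub>G\<^esub>" and ?h = "chart_inv d p"
  define \<gamma> where "\<gamma> r = chart_inv c (?q + r *\<^sub>R \<zeta>) \<otimes>\<^bsub>G\<^esub> ?h" for r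
  define S where "S = {r. ?q + r *\<^sub>R \<zeta> \<in> snd c ` fst c}"
  have h: "?h \<in> carrier G" by (rule chart_inv_carrier[OF d p])
  note line = darboux_chart_line[OF c h, of \<zeta>, folded \<gamma>_def[abs_def] S_def]
  have \<gamma>0: "\<gamma> 0 = ?h" using h by (simp add: \<gamma>_def chart_one(2)[OF c])
  define U where "U = {r\<in>S. \<gamma> r \<in> fst d}"
  have Q: "Cinf_on U (\<lambda>r. snd d (\<gamma> r))" unfolding U_def by (rule smooth_family_chart[OF line(1) d])
  have 0: "0 \<in> U" using line(2) chart_inv_dom[OF d p] by (simp add: U_def \<gamma>0)
  have Q0: "snd d (\<gamma> 0) = p" by (simp add: \<gamma>0 chart_chart_inv[OF d p])
  have "\<zeta> = darboux c \<gamma> 0 1" by (rule line(3)[symmetric])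
  also have "\<dots> = darboux c (\<lambda>r. chart_inv d (snd d (\<gamma> r))) 0 1"
    by (rule darboux_cong[OF Cinf_on_open[OF Q] 0]) (simp add: U_def chart_inv_chart[OF d])
  also have "\<dots> = darboux c (chart_inv d) p (fderiv (\<lambda>r. snd d (\<gamma> r)) 0 1)"
    using darboux_compose[OF smooth_family_chart_inv[OF d] Cinf_on_differentiable[OF Q 0] _ c, of 1] p
    by (simp add: Q0)
  finally show ?thesis by metis
qed

section \<open>The four statements in a chart at the identity\<close>

text \<open>The Euler-Poincare equation and the reduced variational principle for a curve \<open>x\<close> of coordinate
vectors. All four statements of the theorem are compared with these two.\<close>

definition strong_euler_poincare where
  "strong_euler_poincare c L a b x \<longleftrightarrow> (\<forall>t\<in>{a..b}. \<forall>w.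
     fderiv (\<lambda>s. fderiv (chart_lagrangian L c) (x s) w) t 1
       = - fderiv (chart_lagrangian L c) (x t) (chart_bracket c (x t) w))"

definition weak_euler_poincare where
  "weak_euler_poincare c L a b x \<longleftrightarrow> (\<forall>Q y. Cinf_on Q y \<longrightarrow> {a..b} \<subseteq> Q \<longrightarrow> y a = 0 \<longrightarrow> y b = 0 \<longrightarrow>
     ((\<lambda>t. fderiv (chart_lagrangian L c) (x t) (fderiv y t 1 - chart_bracket c (x t) (y t)))
        has_integral 0) {a..b})"

context
  fixes c :: "('a, 'e) chart" and L and S :: "real set" and \<gamma> g :: "real \<Rightarrow> 'a" and a b :: real
    and x :: "real \<Rightarrow> 'e" and \<xi> :: "real \<Rightarrow> ('a, 'e) tangent"
  assumes c: "c \<in> unit_charts" and L: "smooth_lagrangian A L" and RI: "right_invariant G A L"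
    and \<gamma>: "smooth_family S \<gamma>" and S: "{a..b} \<subseteq> S" and ab: "a < b"
    and g: "\<And>s. s \<in> {a..b} \<Longrightarrow> g s = \<gamma> s"
  defines "x \<equiv> \<lambda>t. darboux c \<gamma> t 1" and "\<xi> \<equiv> reduced_velocity G A {a..b} g"
begin

lemma Cinf_on_velocity: "Cinf_on S x"
  unfolding x_def using smooth_family_open[OF \<gamma>]
  by (intro Cinf_on_darboux[OF has_coordinates_real \<gamma> c] Cinf_on_ident Cinf_on_const)

lemma reduced_velocity_in_lie_algebra: "t \<in> {a..b} \<Longrightarrow> \<xi> t \<in> lie_algebra G A"
  unfolding \<xi>_def by (rule reduced_velocity_eq(1)[OF \<gamma> S ab _ g])

lemma reduced_velocity_in_chart: "t \<in> {a..b} \<Longrightarrow> \<xi> t c = x t"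
  unfolding \<xi>_def x_def by (rule reduced_velocity_eq(2)[OF \<gamma> S ab _ g c])

lemma Cinf_on_lagrangian: "Cinf_on UNIV (chart_lagrangian L c)"
  by (rule Cinf_on_chart_lagrangian[OF c L])

lemma Cinf_on_momentum:
  assumes "Cinf_on Q y" "Q \<subseteq> S"
  shows "Cinf_on Q (\<lambda>s. fderiv (chart_lagrangian L c) (x s) (y s))"
  by (rule Cinf_on_compose_fderiv[OF coordinates_model Cinf_on_lagrangian
        Cinf_on_subset[OF Cinf_on_velocity Cinf_on_open[OF assms(1)] assms(2)] assms(1)]) simp

lemma strong_iff_weak:
  "strong_euler_poincare c L a b x \<longleftrightarrow> weak_euler_poincare c L a b x"
  unfolding strong_euler_poincare_def weak_euler_poincare_def
  by (rule strong_iff_weak_euler_poincare[OF coordinates_model Cinf_on_lagrangian Cinf_on_velocity S ab])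
     (rule Cinf_on_chart_bracket[OF c Cinf_on_velocity Cinf_on_const[OF Cinf_on_open[OF Cinf_on_velocity]]],
      rule chart_bracket_scaleR_right[OF c])

lemma lie_algebra_of_coordinate:
  obtains \<zeta> where "\<zeta> \<in> lie_algebra G A" "\<zeta> c = w"
proof
  let ?\<zeta> = "tangent_along (chart_inv c) (snd c \<one>\<^bsub>G\<^esub>) w"
  show "?\<zeta> \<in> lie_algebra G A"
    using tangent_along_in_tangent_space[OF smooth_family_chart_inv[OF charts_atD(1)[OF c]]
      chart_one(1)[OF c], of w]
    by (simp add: chart_one(2)[OF c])
  show "?\<zeta> c = w" by (rule tangent_along_chart_inv_self[OF charts_atD(1)[OF c] chart_one(1)[OF c]])
qed

lemma euler_poincare_iff_strong:
  "euler_poincare G A (reduced_lagrangian G L) a b \<xi> \<longleftrightarrow> strong_euler_poincare c L a b x"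
proof -
  let ?l = "chart_lagrangian L c"
  have "((\<lambda>s. functional_derivative (reduced_lagrangian G L) (\<xi> s) \<zeta>) has_real_derivative
      - ad_star G A (\<xi> t) (functional_derivative (reduced_lagrangian G L) (\<xi> t)) \<zeta>) (at t within {a..b})
    \<longleftrightarrow> fderiv (\<lambda>s. fderiv ?l (x s) (\<zeta> c)) t 1 = - fderiv ?l (x t) (chart_bracket c (x t) (\<zeta> c))"
    if t: "t \<in> {a..b}" and \<zeta>: "\<zeta> \<in> lie_algebra G A" for t \<zeta>
  proof -
    have 1: "ad_star G A (\<xi> t) (functional_derivative (reduced_lagrangian G L) (\<xi> t)) \<zeta>
        = fderiv ?l (x t) (chart_bracket c (x t) (\<zeta> c))"
      unfolding ad_star_def
        functional_derivative_in_chart[OF c L reduced_velocity_in_lie_algebra[OF t]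
          ad_in_lie_algebra[OF reduced_velocity_in_lie_algebra[OF t] \<zeta>]]
        ad_in_chart[OF c reduced_velocity_in_lie_algebra[OF t] \<zeta>] reduced_velocity_in_chart[OF t] ..
    have "(\<lambda>s. fderiv ?l (x s) (\<zeta> c)) differentiable (at t)"
      by (rule Cinf_on_differentiable[OF Cinf_on_momentum[OF Cinf_on_const[OF Cinf_on_open[OF
        Cinf_on_velocity]]]])
         (use S t in auto)
    from has_real_derivative_within_Icc_iff[OF this ab t open_UNIV UNIV_I,
        of "\<lambda>s. functional_derivative (reduced_lagrangian G L) (\<xi> s) \<zeta>"]
    have 2: "((\<lambda>s. functional_derivative (reduced_lagrangian G L) (\<xi> s) \<zeta>) has_real_derivative E)
      (at t within {a..b})
      \<longleftrightarrow> E = fderiv (\<lambda>s. fderiv ?l (x s) (\<zeta> c)) t 1" for E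
      by (simp add: functional_derivative_in_chart[OF c L reduced_velocity_in_lie_algebra \<zeta>]
        reduced_velocity_in_chart)
    show ?thesis unfolding 1 2 by (rule eq_commute)
  qed
  then have "euler_poincare G A (reduced_lagrangian G L) a b \<xi> \<longleftrightarrow>
      (\<forall>t\<in>{a..b}. \<forall>\<zeta>\<in>lie_algebra G A.
        fderiv (\<lambda>s. fderiv ?l (x s) (\<zeta> c)) t 1 = - fderiv ?l (x t) (chart_bracket c (x t) (\<zeta> c)))"
    unfolding euler_poincare_def by (intro ball_cong refl)
  also have "\<dots> \<longleftrightarrow> strong_euler_poincare c L a b x"
    unfolding strong_euler_poincare_def
  proof (intro ball_cong refl iffI allI)
    fix t w
    assume "\<forall>\<zeta>\<in>lie_algebra G A.
        fderiv (\<lambda>s. fderiv ?l (x s) (\<zeta> c)) t 1 = - fderiv ?l (x t) (chart_bracket c (x t) (\<zeta> c))"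
    moreover obtain \<zeta> where "\<zeta> \<in> lie_algebra G A" "\<zeta> c = w" by (rule lie_algebra_of_coordinate)
    ultimately show "fderiv (\<lambda>s. fderiv ?l (x s) w) t 1 = - fderiv ?l (x t) (chart_bracket c (x t) w)"
      by blast
  qed blast
  finally show ?thesis .
qed

lemma path_derivative_lie:
  assumes \<eta>: "smooth_lie_algebra_path G A {a..b} \<eta>" and t: "t \<in> {a..b}"
  shows "path_derivative {a..b} \<eta> t \<in> lie_algebra G A"
proof -
  have lie: "\<eta> s \<in> lie_algebra G A" if "s \<in> {a..b}" for s
    using \<eta> that by (simp add: smooth_lie_algebra_path_def)
  have out: "path_derivative {a..b} \<eta> t d = 0" if "d \<notin> unit_charts" for d
    unfolding path_derivative_def
    by (rule vector_derivative_within_Icc[OF has_vector_derivative_const ab t])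
       (rule tangent_space_outside[OF lie that])
  have trans: "path_derivative {a..b} \<eta> t e
      = fderiv (snd e \<circ> chart_inv d) (snd d \<one>\<^bsub>G\<^esub>) (path_derivative {a..b} \<eta> t d)"
    if d: "d \<in> unit_charts" and e: "e \<in> unit_charts" for d e
  proof -
    let ?\<tau> = "fderiv (snd e \<circ> chart_inv d) (snd d \<one>\<^bsub>G\<^esub>)"
    obtain Q y where y: "{a..b} \<subseteq> Q" "Cinf_on Q y" "\<And>s. s \<in> {a..b} \<Longrightarrow> y s = \<eta> s d"
      using smooth_onE[of "{a..b}" "\<lambda>t. \<eta> t d"] \<eta> d unfolding smooth_lie_algebra_path_def by blast
    have "(snd e \<circ> chart_inv d) differentiable (at (snd d \<one>\<^bsub>G\<^esub>))"
      using smooth_family_chart_differentiable[OF smooth_family_chart_inv[OF charts_atD(1)[OF d]]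
          chart_one(1)[OF d] charts_atD(1)[OF e]] charts_atD(2)[OF e]
      by (simp add: chart_one(2)[OF d] o_def)
    then have \<tau>: "bounded_linear ?\<tau>" by (rule has_derivative_bounded_linear[OF fderiv_works])
    have y': "(y has_vector_derivative fderiv y t 1) (at t within {a..b})"
      by (rule has_vector_derivative_fderiv[OF Cinf_on_differentiable[OF y(2)]]) (use y(1) t in auto)
    have 1: "path_derivative {a..b} \<eta> t d = fderiv y t 1"
      unfolding path_derivative_def by (rule vector_derivative_within_Icc[OF y' ab t]) (simp add: y(3))
    have 2: "path_derivative {a..b} \<eta> t e = ?\<tau> (fderiv y t 1)"
      unfolding path_derivative_def
    proof (rule vector_derivative_within_Icc[OF bounded_linear.has_vector_derivative[OF \<tau> y'] ab t])
      fix s assume s: "s \<in> {a..b}"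
      show "\<eta> s e = ?\<tau> (y s)" unfolding y(3)[OF s] by (rule tangent_space_transform[OF lie[OF s] d e])
    qed
    show ?thesis unfolding 1 2 ..
  qed
  show ?thesis unfolding tangent_space_def mem_Collect_eq
  proof (intro conjI allI impI ballI, goal_cases)
    case (1 d) then show ?case by (rule out)
  next
    case (2 d e) then show ?case by (rule trans)
  qed
qed

lemma reduced_variational_principle_iff_weak:
  "reduced_variational_principle G A (reduced_lagrangian G L) a b \<xi> \<longleftrightarrow> weak_euler_poincare c L a b x"
proof -
  let ?l = "chart_lagrangian L c"
  have integrand: "functional_derivative (reduced_lagrangian G L) (\<xi> t) (reduced_variation G A {a..b} \<xi> \<eta> t)
      = fderiv ?l (x t) (fderiv y t 1 - chart_bracket c (x t) (y t))"
    if \<eta>: "smooth_lie_algebra_path G A {a..b} \<eta>" and y: "Cinf_on Q y" "{a..b} \<subseteq> Q"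
      "\<And>s. s \<in> {a..b} \<Longrightarrow> y s = \<eta> s c" and t: "t \<in> {a..b}" for \<eta> Q y t
  proof -
    have lie: "\<eta> t \<in> lie_algebra G A" using \<eta> t by (simp add: smooth_lie_algebra_path_def)
    have "path_derivative {a..b} \<eta> t c = fderiv y t 1"
      unfolding path_derivative_def
      by (rule vector_derivative_within_Icc[OF has_vector_derivative_fderiv[OF
        Cinf_on_differentiable[OF y(1)]] ab t])
         (use y t in auto)
    moreover have "reduced_variation G A {a..b} \<xi> \<eta> t \<in> lie_algebra G A"
      using tangent_space_add_scaleR[OF path_derivative_lie[OF \<eta> t] ad_in_lie_algebra[OF
        reduced_velocity_in_lie_algebra[OF t] lie], of "-1"]
      by (simp add: reduced_variation_def[abs_def])
    ultimately show ?thesis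
      using functional_derivative_in_chart[OF c L reduced_velocity_in_lie_algebra[OF t], of
        "reduced_variation G A {a..b} \<xi> \<eta> t"]
      by (simp add: reduced_variation_def ad_in_chart[OF c reduced_velocity_in_lie_algebra[OF t]
        lie] reduced_velocity_in_chart[OF t] y(3)[OF t])
  qed
  show ?thesis
  proof
    assume rvp: "reduced_variational_principle G A (reduced_lagrangian G L) a b \<xi>"
    show "weak_euler_poincare c L a b x"
      unfolding weak_euler_poincare_def
    proof (intro allI impI)
      fix Q and y :: "real \<Rightarrow> 'e" assume y: "Cinf_on Q y" "{a..b} \<subseteq> Q" "y a = 0" "y b = 0"
      let ?q = "snd c \<one>\<^bsub>G\<^esub>"
      note si = smooth_family_chart_inv[OF charts_atD(1)[OF c]]
      define \<eta> where "\<eta> t = tangent_along (chart_inv c) ?q (y t)" for t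
      have \<eta>c: "\<eta> t c = y t" for t
        unfolding \<eta>_def by (rule tangent_along_chart_inv_self[OF charts_atD(1)[OF c] chart_one(1)[OF c]])
      have path: "smooth_lie_algebra_path G A {a..b} \<eta>"
        unfolding smooth_lie_algebra_path_def
      proof (intro conjI ballI)
        show "\<eta> t \<in> lie_algebra G A" for t
          using tangent_along_in_tangent_space[OF si chart_one(1)[OF c], of "y t"]
          by (simp add: \<eta>_def chart_one(2)[OF c])
        fix d assume d: "d \<in> unit_charts"
        have "(\<lambda>p. snd d (chart_inv c p)) differentiable (at ?q)"
          by (rule smooth_family_chart_differentiable[OF si chart_one(1)[OF c]])
             (use charts_atD[OF d] chart_one(2)[OF c] in auto)
        then have "Cinf_on Q (\<lambda>t. fderiv (\<lambda>p. snd d (chart_inv c p)) ?q (y t))"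
          by (intro Cinf_on_bounded_linear_comp[OF has_derivative_bounded_linear[OF fderiv_works]] y(1))
        then show "smooth_on {a..b} (\<lambda>t. \<eta> t d)"
          by (rule smooth_onI[OF _ y(2)]) (simp add: \<eta>_def tangent_along_def chart_one(2)[OF c] d)
      qed
      have zero: "tangent_along (chart_inv c) ?q 0 = (\<lambda>_. 0)"
      proof
        fix d
        have "(\<lambda>p. snd d (chart_inv c p)) differentiable (at ?q)" if "d \<in> unit_charts"
          by (rule smooth_family_chart_differentiable[OF si chart_one(1)[OF c]])
             (use charts_atD[OF that] chart_one(2)[OF c] in auto)
        then show "tangent_along (chart_inv c) ?q 0 d = 0"
          by (simp add: tangent_along_def fderiv_zero chart_one(2)[OF c])
      qed
      have "\<eta> a = (\<lambda>_. 0)" "\<eta> b = (\<lambda>_. 0)" using y(3,4) zero by (simp_all add: \<eta>_def)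
      then have "((\<lambda>t. functional_derivative (reduced_lagrangian G L) (\<xi> t)
          (reduced_variation G A {a..b} \<xi> \<eta> t)) has_integral 0) {a..b}"
        using rvp path unfolding reduced_variational_principle_def by blast
      then show "((\<lambda>t. fderiv ?l (x t) (fderiv y t 1 - chart_bracket c (x t) (y t))) has_integral 0) {a..b}"
        by (rule has_integral_eq[rotated]) (rule integrand[OF path y(1,2) \<eta>c[symmetric]])
    qed
  next
    assume weak: "weak_euler_poincare c L a b x"
    show "reduced_variational_principle G A (reduced_lagrangian G L) a b \<xi>"
      unfolding reduced_variational_principle_def
    proof (intro allI impI, elim conjE)
      fix \<eta> assume \<eta>: "smooth_lie_algebra_path G A {a..b} \<eta>" "\<eta> a = (\<lambda>_. 0)" "\<eta> b = (\<lambda>_. 0)"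
      obtain Q y where y: "{a..b} \<subseteq> Q" "Cinf_on Q y" "\<And>s. s \<in> {a..b} \<Longrightarrow> y s = \<eta> s c"
        using smooth_onE[of "{a..b}" "\<lambda>t. \<eta> t c"] \<eta>(1) c unfolding smooth_lie_algebra_path_def by blast
      have "((\<lambda>t. fderiv ?l (x t) (fderiv y t 1 - chart_bracket c (x t) (y t))) has_integral 0) {a..b}"
        using weak y ab \<eta>(2,3) unfolding weak_euler_poincare_def by simp
      then show "((\<lambda>t. functional_derivative (reduced_lagrangian G L) (\<xi> t)
          (reduced_variation G A {a..b} \<xi> \<eta> t)) has_integral 0) {a..b}"
        by (rule has_integral_eq[rotated]) (rule integrand[OF \<eta>(1) y(2,1,3), symmetric])
    qed
  qed
qed

text \<open>In a chart \<open>d\<close> the Lagrangian at \<open>(Q, u)\<close> is \<open>l(R(Q) u)\<close> with a linear map \<open>R(Q)\<close>. Hence the canonical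
momentum paired with \<open>w\<close> is the reduced momentum paired with \<open>Y = R(Q) w\<close>, and its derivative is found
by the product rule. The force in direction \<open>w\<close> is the derivative of \<open>l\<close> of the reduced velocity along
the deformation \<open>Q + \<epsilon> w\<close>, whose reduced variation field is \<open>Y\<close>; it is the reduced momentum paired
with \<open>Y' - [x, Y]\<close>. The terms with \<open>Y'\<close> cancel.\<close>

lemma euler_lagrange_at_iff:
  fixes w :: 'e
  assumes t: "t \<in> {a..b}" and d: "d \<in> charts_at A (g t)"
  defines "q \<equiv> \<lambda>s. snd d (g s)"
  defines "v \<equiv> \<lambda>s. vector_derivative q (at s within {a..b})"
  defines "\<zeta> \<equiv> darboux c (chart_inv d) (q t) w"
  shows "((\<lambda>s. fderiv (\<lambda>u. local_lagrangian A L d (q s, u)) (v s) w) has_real_derivative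
      fderiv (\<lambda>p. local_lagrangian A L d (p, v t)) (q t) w) (at t within {a..b})
    \<longleftrightarrow> fderiv (\<lambda>s. fderiv (chart_lagrangian L c) (x s) \<zeta>) t 1
      = - fderiv (chart_lagrangian L c) (x t) (chart_bracket c (x t) \<zeta>)"
proof -
  let ?l = "chart_lagrangian L c" and ?P = "snd d ` fst d" and ?R = "darboux c (chart_inv d)"
    and ?Ld = "local_lagrangian A L d"
  note dA = charts_atD(1)[OF d]
  note si = smooth_family_chart_inv[OF dA]
  have ld: "?l differentiable (at u)" for u by (rule Cinf_on_differentiable[OF Cinf_on_lagrangian UNIV_I])
  define U where "U = {s\<in>S. \<gamma> s \<in> fst d}"
  define Q where "Q s = snd d (\<gamma> s)" for s
  define V where "V s = fderiv Q s 1" for s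
  have Q: "Cinf_on U Q" unfolding U_def Q_def by (rule smooth_family_chart[OF \<gamma> dA])
  have oU: "open U" by (rule Cinf_on_open[OF Q])
  have US: "U \<subseteq> S" by (auto simp: U_def)
  have tU: "t \<in> U" using t S charts_atD(2)[OF d] by (auto simp: U_def g)
  have QP: "Q s \<in> ?P" if "s \<in> U" for s using that by (simp add: U_def Q_def)
  have qQ: "q s = Q s" if "s \<in> {a..b}" for s using g[OF that] by (simp add: q_def Q_def)
  have vV: "v s = V s" if "s \<in> U" "s \<in> {a..b}" for s
    unfolding v_def V_def
    by (rule vector_derivative_within_Icc[OF has_vector_derivative_fderiv[OF
      Cinf_on_differentiable[OF Q that(1)]] ab that(2) qQ])
  have x_eq: "x s = ?R (Q s) (V s)" if s: "s \<in> U" for s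
  proof -
    have "x s = darboux c (\<lambda>s. chart_inv d (Q s)) s 1"
      unfolding x_def by (rule darboux_cong[OF oU s]) (simp add: U_def Q_def chart_inv_chart[OF dA])
    also have "\<dots> = ?R (Q s) (V s)"
      unfolding V_def by (rule darboux_compose[OF si Cinf_on_differentiable[OF Q s] QP[OF s] c])
    finally show ?thesis .
  qed
  have Ld: "?Ld (p, u) = ?l (?R p u)" if "p \<in> ?P" for p u
    by (rule local_lagrangian_eq_darboux[OF RI c dA that])
  define Y where "Y s = ?R (Q s) w" for s
  have Y: "Cinf_on U Y" unfolding Y_def
    by (rule Cinf_on_darboux[OF coordinates_model si c Q QP Cinf_on_const[OF oU]])
  have Yt: "Y t = \<zeta>" using t by (simp add: Y_def \<zeta>_def qQ)
  have momentum: "fderiv (\<lambda>u. ?Ld (q s, u)) (v s) w = fderiv ?l (x s) (Y s)"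
    if s: "s \<in> U" "s \<in> {a..b}" for s
  proof -
    have R: "(?R (Q s) has_derivative ?R (Q s)) (at (V s))"
      by (rule bounded_linear_imp_has_derivative[OF darboux_bounded_linear[OF si QP[OF s(1)] c]])
    from diff_chain_at[OF this fderiv_works[OF ld]]
    have "((\<lambda>u. ?l (?R (Q s) u)) has_derivative (\<lambda>w. fderiv ?l (?R (Q s) (V s)) (?R (Q s) w))) (at (V s))"
      by (simp add: o_def)
    from fderiv_eqI[OF this, of w] show ?thesis
      by (simp add: qQ[OF s(2)] vV[OF s] Ld[OF QP[OF s(1)]] x_eq[OF s(1)] Y_def)
  qed
  have dt: "fderiv (\<lambda>s. fderiv ?l (x s) (Y s)) t 1
      = fderiv (\<lambda>s. fderiv ?l (x s) \<zeta>) t 1 + fderiv ?l (x t) (fderiv Y t 1)"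
    unfolding Yt[symmetric]
    by (rule momentum_product_rule[OF coordinates_model Cinf_on_lagrangian Cinf_on_subset[OF
      Cinf_on_velocity oU US] Y tU])
  \<comment> \<open>The deformation \<open>Q + \<epsilon> w\<close> of the curve, whose tangent vector in \<open>\<epsilon>\<close> is constant in the chart.\<close>
  define \<phi> where "\<phi> z = Q (snd z) + fst z *\<^sub>R w" for z :: "real \<times> real"
  define S2 where "S2 = {z \<in> UNIV \<times> U. \<phi> z \<in> ?P}"
  define f where "f z = chart_inv d (\<phi> z)" for z
  have \<phi>U: "Cinf_on (UNIV \<times> U) \<phi>" unfolding \<phi>_def
    by (intro Cinf_on_add Cinf_on_scaleR Cinf_on_compose[OF has_coordinates_real Q] Cinf_on_fst Cinf_on_snd
          Cinf_on_ident Cinf_on_const open_Times open_UNIV oU) auto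
  have oS2: "open S2"
    using continuous_open_preimage[OF Cinf_on_continuous_on[OF \<phi>U] Cinf_on_open[OF \<phi>U]
      chart_image_open[OF dA]]
    by (simp add: S2_def vimage_def Int_def)
  have \<phi>: "Cinf_on S2 \<phi>" by (rule Cinf_on_subset[OF \<phi>U oS2]) (auto simp: S2_def)
  have f: "smooth_family S2 f" unfolding f_def
    by (rule smooth_family_compose[OF coordinates_model si \<phi>]) (simp add: S2_def)
  have z: "(0, s) \<in> S2" if "s \<in> U" for s using that QP by (simp add: S2_def \<phi>_def)
  have dar: "darboux c f (\<epsilon>, s) (k, r) = ?R (Q s + \<epsilon> *\<^sub>R w) (r *\<^sub>R V s + k *\<^sub>R w)" if es: "(\<epsilon>, s)
    \<in> S2" for \<epsilon> s k r
  proof -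
    have Qs: "Q differentiable (at s)" using es Cinf_on_differentiable[OF Q] by (simp add: S2_def)
    have "(Q has_derivative (\<lambda>r. r *\<^sub>R V s)) (at s)"
      using has_vector_derivative_fderiv[OF Qs, of UNIV] by (simp add: has_vector_derivative_def V_def)
    then have "(\<phi> has_derivative (\<lambda>u. snd u *\<^sub>R V s + fst u *\<^sub>R w)) (at (\<epsilon>, s))"
      unfolding \<phi>_def
      by (auto intro!: derivative_eq_intros has_derivative_compose[of snd _ _ _ Q])
    from fderiv_eqI[OF this, of "(k, r)"]
    have "fderiv \<phi> (\<epsilon>, s) (k, r) = r *\<^sub>R V s + k *\<^sub>R w" by simp
    moreover have "darboux c f (\<epsilon>, s) (k, r) = ?R (\<phi> (\<epsilon>, s)) (fderiv \<phi> (\<epsilon>, s) (k, r))"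
      unfolding f_def
      by (rule darboux_compose[OF si Cinf_on_differentiable[OF \<phi> es] _ c]) (use es in \<open>simp add: S2_def\<close>)
    ultimately show ?thesis by (simp add: \<phi>_def)
  qed
  have force: "fderiv (\<lambda>p. ?Ld (p, v t)) (q t) w
      = fderiv ?l (x t) (fderiv Y t 1) - fderiv ?l (x t) (chart_bracket c (x t) \<zeta>)"
  proof -
    have RV: "Cinf_on ?P (\<lambda>p. ?R p (V t))"
      by (rule Cinf_on_darboux[OF coordinates_model si c])
         (use chart_image_open[OF dA] in \<open>auto intro: Cinf_on_ident Cinf_on_const\<close>)
    have "fderiv (\<lambda>p. ?Ld (p, v t)) (q t) w = fderiv (\<lambda>p. ?l (?R p (V t))) (Q t) w"
      unfolding qQ[OF t] vV[OF tU t]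
      by (rule fun_cong[OF fderiv_cong[OF chart_image_open[OF dA] QP[OF tU]]]) (rule Ld)
    also have "\<dots> = fderiv ?l (x t) (fderiv (\<lambda>p. ?R p (V t)) (Q t) w)"
      unfolding x_eq[OF tU] by (rule fderiv_compose[OF Cinf_on_differentiable[OF RV QP[OF tU]] ld])
    also have "fderiv (\<lambda>p. ?R p (V t)) (Q t) w = fderiv (\<lambda>z. darboux c f z (0, 1)) (0, t) (1, 0)"
    proof -
      have "Cinf_on S2 (\<lambda>z. ?R (\<phi> z) (V (snd z)))"
        by (rule Cinf_on_darboux[OF coordinates_model si c \<phi>])
           (use oS2 in \<open>auto simp: S2_def V_def intro!: Cinf_on_compose[OF has_coordinates_real
             Cinf_on_fderiv[OF Q]]
              Cinf_on_snd Cinf_on_ident\<close>)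
      note diff = Cinf_on_differentiable[OF this z[OF tU]]
      have "fderiv (\<lambda>z. darboux c f z (0, 1)) (0, t) (1, 0) = fderiv (\<lambda>z. ?R (\<phi> z) (V (snd z)))
        (0, t) (1, 0)"
      proof (rule fun_cong[OF fderiv_cong[OF oS2 z[OF tU]]])
        fix z assume "z \<in> S2"
        then show "darboux c f z (0, 1) = ?R (\<phi> z) (V (snd z))"
          using dar[of "fst z" "snd z" 0 1] by (simp add: \<phi>_def)
      qed
      also have "\<dots> = fderiv (\<lambda>\<epsilon>. ?R (Q t + \<epsilon> *\<^sub>R w) (V t)) 0 1"
        using fderiv_partial_fst[OF diff, of 1] by (simp add: \<phi>_def)
      also have "\<dots> = fderiv (\<lambda>p. ?R p (V t)) (Q t) w"
      proof -
        have l: "((\<lambda>\<epsilon>. Q t + \<epsilon> *\<^sub>R w) has_derivative (\<lambda>\<epsilon>. \<epsilon> *\<^sub>R w)) (at 0)"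
          by (auto intro!: derivative_eq_intros)
        have "fderiv (\<lambda>\<epsilon>. ?R (Q t + \<epsilon> *\<^sub>R w) (V t)) 0 1
            = fderiv (\<lambda>p. ?R p (V t)) (Q t + 0 *\<^sub>R w) (fderiv (\<lambda>\<epsilon>. Q t + \<epsilon> *\<^sub>R w) 0 1)"
          by (rule fderiv_compose)
             (use l Cinf_on_differentiable[OF RV QP[OF tU]] in \<open>auto simp: differentiable_def\<close>)
        then show ?thesis using fderiv_eqI[OF l, of 1] by simp
      qed
      finally show ?thesis by (rule sym)
    qed
    also have "\<dots> = fderiv Y t 1 - chart_bracket c (x t) \<zeta>"
    proof -
      have "fderiv (\<lambda>s. darboux c f (0, s) (1, 0)) t 1 = fderiv Y t 1"
        by (rule fun_cong[OF fderiv_cong[OF oU tU]]) (use dar[OF z] in \<open>simp add: Y_def\<close>)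
      moreover have "darboux c f (0, t) (0, 1) = x t" "darboux c f (0, t) (1, 0) = \<zeta>"
        using dar[OF z[OF tU]] by (simp_all add: x_eq[OF tU] Yt[symmetric] Y_def)
      ultimately show ?thesis using zero_curvature[OF f z[OF tU] c] by simp
    qed
    finally show ?thesis by (simp only: fderiv_diff[OF ld])
  qed
  have "(\<lambda>s. fderiv ?l (x s) (Y s)) differentiable (at t)"
    by (rule Cinf_on_differentiable[OF Cinf_on_momentum[OF Y US] tU])
  from has_real_derivative_within_Icc_iff[OF this ab t oU tU momentum]
  show ?thesis unfolding force dt by (simp add: algebra_simps eq_neg_iff_add_eq_0)
qed

text \<open>The linear map \<open>R(Q)\<close> is onto, so testing with all \<open>w\<close> in one chart amounts to testing with all
elements of the Lie algebra.\<close>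

lemma euler_lagrange_iff_strong:
  "euler_lagrange A L a b g \<longleftrightarrow> strong_euler_poincare c L a b x"
proof
  assume el: "euler_lagrange A L a b g"
  show "strong_euler_poincare c L a b x"
    unfolding strong_euler_poincare_def
  proof (intro ballI allI)
    fix t \<zeta> assume t: "t \<in> {a..b}"
    let ?d = "chart_at A (g t)"
    have d: "?d \<in> charts_at A (g t)"
      by (rule chart_at_in) (use g[OF t] smooth_family_into[OF \<gamma>] S t in auto)
    obtain w where w: "darboux c (chart_inv ?d) (snd ?d (g t)) w = \<zeta>"
      using darboux_chart_inv_surj[OF c charts_atD(1)[OF d], of "snd ?d (g t)" \<zeta>] charts_atD(2)[OF
        d] by blast
    show "fderiv (\<lambda>s. fderiv (chart_lagrangian L c) (x s) \<zeta>) t 1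
        = - fderiv (chart_lagrangian L c) (x t) (chart_bracket c (x t) \<zeta>)"
      using el t d unfolding euler_lagrange_def Let_def
      by (intro euler_lagrange_at_iff[OF t d, of w, unfolded w, THEN iffD1]) blast
  qed
next
  assume strong: "strong_euler_poincare c L a b x"
  show "euler_lagrange A L a b g"
    unfolding euler_lagrange_def Let_def
  proof (intro ballI allI)
    fix t d w assume t: "t \<in> {a..b}" and d: "d \<in> charts_at A (g t)"
    show "((\<lambda>s. fderiv (\<lambda>u. local_lagrangian A L d (snd d (g s), u))
          (vector_derivative (\<lambda>s. snd d (g s)) (at s within {a..b})) w) has_real_derivative
        fderiv (\<lambda>p. local_lagrangian A L d (p, vector_derivative (\<lambda>s. snd d (g s)) (at t within {a..b})))
          (snd d (g t)) w) (at t within {a..b})"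
      by (rule euler_lagrange_at_iff[OF t d, THEN iffD2])
         (use strong t in \<open>simp only: strong_euler_poincare_def\<close>)
  qed
qed

text \<open>For any deformation with extension \<open>f\<close> the action is the integral of the reduced Lagrangian over
reduced velocities, so its derivative is the weak Euler-Poincare functional at the reduced variation
field \<open>y\<close>.\<close>

lemma action_derivative:
  assumes f: "smooth_family S2 f" and \<delta>: "\<delta> > 0" "{-\<delta><..<\<delta>} \<times> {a..b} \<subseteq> S2"
    and \<Gamma>: "\<And>\<epsilon> t. \<epsilon> \<in> {-\<delta><..<\<delta>} \<Longrightarrow> t \<in> {a..b} \<Longrightarrow> \<Gamma> \<epsilon> t = f (\<epsilon>, t)"
    and \<Gamma>0: "\<And>t. t \<in> {a..b} \<Longrightarrow> \<Gamma> 0 t = g t"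
  defines "y \<equiv> \<lambda>t. darboux c f (0, t) (1, 0)"
  shows "((\<lambda>\<epsilon>. integral {a..b} (\<lambda>t. L (\<Gamma> \<epsilon> t, velocity A {a..b} (\<Gamma> \<epsilon>) t))) has_real_derivative
      integral {a..b} (\<lambda>t. fderiv (chart_lagrangian L c) (x t) (fderiv y t 1 - chart_bracket c (x
        t) (y t)))) (at 0)"
proof -
  let ?l = "chart_lagrangian L c"
  have oS2: "open S2" by (rule smooth_family_open[OF f])
  define S' where "S' \<epsilon> = {t. (\<epsilon>, t) \<in> S2}" for \<epsilon>
  have slice: "Cinf_on UNIV (\<lambda>t. (\<epsilon>, t))" for \<epsilon> :: real
    by (intro Cinf_on_Pair Cinf_on_const Cinf_on_ident open_UNIV)
  have oS': "open (S' \<epsilon>)" for \<epsilon>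
    using continuous_open_preimage[OF Cinf_on_continuous_on[OF slice] open_UNIV oS2, of \<epsilon>]
    by (simp add: S'_def vimage_def)
  have f\<epsilon>: "smooth_family (S' \<epsilon>) (\<lambda>t. f (\<epsilon>, t))" for \<epsilon>
    by (rule smooth_family_compose[OF has_coordinates_real_pair f Cinf_on_subset[OF slice oS']])
      (simp_all add: S'_def)
  have dar: "darboux c (\<lambda>t. f (\<epsilon>, t)) t 1 = darboux c f (\<epsilon>, t) (0, 1)" if "(\<epsilon>, t) \<in> S2" for \<epsilon> t
  proof -
    have s: "((\<lambda>t. (\<epsilon>, t)) has_derivative (\<lambda>r. (0, r))) (at t)" by (auto intro!: derivative_eq_intros)
    then have "(\<lambda>t. (\<epsilon>, t)) differentiable (at t)" by (auto simp: differentiable_def)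
    from darboux_compose[OF f this that c, of 1] fderiv_eqI[OF s, of 1] show ?thesis by simp
  qed
  have vel: "L (\<Gamma> \<epsilon> t, velocity A {a..b} (\<Gamma> \<epsilon>) t) = ?l (darboux c f (\<epsilon>, t) (0, 1))"
    if \<epsilon>: "\<epsilon> \<in> {-\<delta><..<\<delta>}" and t: "t \<in> {a..b}" for \<epsilon> t
  proof -
    have sub: "{a..b} \<subseteq> S' \<epsilon>" using \<epsilon> \<delta>(2) by (auto simp: S'_def)
    have "velocity A {a..b} (\<Gamma> \<epsilon>) t = tangent_along (\<lambda>t. f (\<epsilon>, t)) t 1"
      by (rule velocity_eq_tangent_along[OF f\<epsilon> sub ab t \<Gamma>[OF \<epsilon>]])
    then show ?thesis
      using lagrangian_along[OF RI f\<epsilon> _ c, of t \<epsilon> 1] sub t dar[of \<epsilon> t] \<Gamma>[OF \<epsilon> t] by (auto simp: S'_def)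
  qed
  \<comment> \<open>The extensions \<open>f (0, t)\<close> and \<open>\<gamma>\<close> agree on \<open>{a..b}\<close> but perhaps on no neighbourhood of it; both
    compute the reduced velocity of \<open>g\<close> there.\<close>
  have x0: "darboux c f (0, t) (0, 1) = x t" if t: "t \<in> {a..b}" for t
  proof -
    have sub: "{a..b} \<subseteq> S' 0" using \<delta> by (auto simp: S'_def)
    have "g s = f (0, s)" if "s \<in> {a..b}" for s using \<Gamma>[of 0 s] \<Gamma>0[OF that] \<delta>(1) that by simp
    from reduced_velocity_eq(2)[OF f\<epsilon> sub ab t this c]
    have "\<xi> t c = darboux c (\<lambda>t. f (0, t)) t 1" unfolding \<xi>_def .
    then show ?thesis using reduced_velocity_in_chart[OF t] dar[of 0 t] sub t by (auto simp: S'_def)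
  qed
  have "((\<lambda>\<epsilon>. integral {a..b} (\<lambda>t. ?l (darboux c f (\<epsilon>, t) (0, 1)))) has_real_derivative
      integral {a..b} (\<lambda>t. fderiv ?l (darboux c f (0, t) (0, 1))
        (fderiv y t 1 - chart_bracket c (darboux c f (0, t) (0, 1)) (y t)))) (at 0)"
    unfolding y_def by (rule first_variation[OF c L f \<delta>])
  also have "integral {a..b} (\<lambda>t. fderiv ?l (darboux c f (0, t) (0, 1))
        (fderiv y t 1 - chart_bracket c (darboux c f (0, t) (0, 1)) (y t)))
      = integral {a..b} (\<lambda>t. fderiv ?l (x t) (fderiv y t 1 - chart_bracket c (x t) (y t)))"
    by (rule integral_cong) (simp only: x0)
  finally show ?thesis
  proof (rule has_field_derivative_transform_within_open[where S = "{-\<delta><..<\<delta>}"])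
    fix \<epsilon> assume "\<epsilon> \<in> {-\<delta><..<\<delta>}"
    then show "integral {a..b} (\<lambda>t. ?l (darboux c f (\<epsilon>, t) (0, 1)))
        = integral {a..b} (\<lambda>t. L (\<Gamma> \<epsilon> t, velocity A {a..b} (\<Gamma> \<epsilon>) t))"
      by (intro integral_cong) (simp only: vel)
  qed (use \<delta>(1) in auto)
qed

lemma darboux_fst_direction:
  assumes f: "smooth_family S2 f" and z: "(\<epsilon>, t) \<in> S2"
  shows "darboux c f (\<epsilon>, t) (1, 0) = darboux c (\<lambda>\<epsilon>. f (\<epsilon>, t)) \<epsilon> 1"
proof -
  have s: "((\<lambda>\<epsilon>. (\<epsilon>, t)) has_derivative (\<lambda>r. (r, 0))) (at \<epsilon>)" by (auto intro!: derivative_eq_intros)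
  then have "(\<lambda>\<epsilon>. (\<epsilon>, t)) differentiable (at \<epsilon>)" by (auto simp: differentiable_def)
  from darboux_compose[OF f this z c, of 1] fderiv_eqI[OF s, of 1] show ?thesis by simp
qed

text \<open>A deformation with fixed endpoints has a reduced variation field that vanishes at the endpoints, so
the weak equation applies to it.\<close>

lemma hamilton_if_weak:
  assumes weak: "weak_euler_poincare c L a b x"
  shows "hamilton_principle T A L a b g"
  unfolding hamilton_principle_def
proof (intro allI impI)
  fix \<Gamma> assume "fixed_endpoint_variation T A a b g \<Gamma>"
  then obtain \<delta> where \<Gamma>0: "\<And>t. t \<in> {a..b} \<Longrightarrow> \<Gamma> 0 t = g t" and \<delta>: "\<delta> > 0"
    and sm: "smooth_into T A ({-\<delta><..<\<delta>} \<times> {a..b}) (\<lambda>(\<epsilon>, t). \<Gamma> \<epsilon> t)"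
    and ends: "\<And>\<epsilon>. \<epsilon> \<in> {-\<delta><..<\<delta>} \<Longrightarrow> \<Gamma> \<epsilon> a = g a \<and> \<Gamma> \<epsilon> b = g b"
    unfolding fixed_endpoint_variation_def by blast
  obtain S2 f where f: "smooth_family S2 f" and S2: "{-\<delta><..<\<delta>} \<times> {a..b} \<subseteq> S2"
    and feq: "\<And>z. z \<in> {-\<delta><..<\<delta>} \<times> {a..b} \<Longrightarrow> f z = (\<lambda>(\<epsilon>, t). \<Gamma> \<epsilon> t) z"
    using smooth_intoE[OF sm] by blast
  have \<Gamma>: "\<Gamma> \<epsilon> t = f (\<epsilon>, t)" if "\<epsilon> \<in> {-\<delta><..<\<delta>}" "t \<in> {a..b}" for \<epsilon> t
    using feq[of "(\<epsilon>, t)"] that by simp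
  define y where "y t = darboux c f (0, t) (1, 0)" for t
  define Q where "Q = {t. (0, t) \<in> S2}"
  have slice: "Cinf_on UNIV (\<lambda>t. (0::real, t::real))"
    by (intro Cinf_on_Pair Cinf_on_const Cinf_on_ident open_UNIV)
  have oQ: "open Q"
    using continuous_open_preimage[OF Cinf_on_continuous_on[OF slice] open_UNIV smooth_family_open[OF f]]
    by (simp add: Q_def vimage_def)
  have y: "Cinf_on Q y" unfolding y_def
    by (rule Cinf_on_darboux[OF has_coordinates_real_pair f c
          Cinf_on_subset[OF slice oQ]]) (use oQ in \<open>auto simp: Q_def intro: Cinf_on_const\<close>)
  have abQ: "{a..b} \<subseteq> Q" using S2 \<delta> by (auto simp: Q_def)
  have y_end: "y t = 0" if t: "t \<in> {a..b}" and const: "\<And>\<epsilon>. \<epsilon> \<in> {-\<delta><..<\<delta>} \<Longrightarrow> \<Gamma> \<epsilon> t = g t" for t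
  proof -
    have "y t = darboux c (\<lambda>\<epsilon>. f (\<epsilon>, t)) 0 1"
      unfolding y_def by (rule darboux_fst_direction[OF f]) (use t S2 \<delta> in auto)
    also have "\<dots> = darboux c (\<lambda>\<epsilon>::real. g t) 0 1"
      by (rule darboux_cong[of "{-\<delta><..<\<delta>}"]) (use \<delta> \<Gamma>[OF _ t] const in auto)
    also have "\<dots> = 0" by (simp add: darboux_def)
    finally show ?thesis .
  qed
  have "y a = 0" "y b = 0" using y_end ends ab by auto
  then have "integral {a..b} (\<lambda>t. fderiv (chart_lagrangian L c) (x t) (fderiv y t 1 -
    chart_bracket c (x t) (y t))) = 0"
    using weak y abQ unfolding weak_euler_poincare_def by (intro integral_unique) blast
  with action_derivative[OF f \<delta> S2 \<Gamma> \<Gamma>0]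
  show "((\<lambda>\<epsilon>. integral {a..b} (\<lambda>t. L (\<Gamma> \<epsilon> t, velocity A {a..b} (\<Gamma> \<epsilon>) t))) has_real_derivative 0) (at 0)"
    by (simp add: y_def[abs_def])
qed

text \<open>Every curve \<open>y\<close> vanishing at the endpoints is the reduced variation field of the deformation that
multiplies \<open>\<gamma> t\<close> from the left by the group element with coordinates \<open>\<epsilon> y t\<close> relative to the
identity.\<close>

lemma weak_if_hamilton:
  assumes ham: "hamilton_principle T A L a b g"
  shows "weak_euler_poincare c L a b x"
  unfolding weak_euler_poincare_def
proof (intro allI impI)
  fix Q and y :: "real \<Rightarrow> 'e" assume y: "Cinf_on Q y" "{a..b} \<subseteq> Q" and ya: "y a = 0" and yb: "y b = 0"
  let ?q = "snd c \<one>\<^bsub>G\<^esub>" and ?P = "snd c ` fst c" and ?l = "chart_lagrangian L c"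
  note cA = charts_atD(1)[OF c]
  note si = smooth_family_chart_inv[OF cA]
  define W where "W = S \<inter> Q"
  have oW: "open W" unfolding W_def by (rule open_Int[OF smooth_family_open[OF \<gamma>] Cinf_on_open[OF y(1)]])
  have abW: "{a..b} \<subseteq> W" using S y(2) by (simp add: W_def)
  have yW: "Cinf_on W y" by (rule Cinf_on_subset[OF y(1) oW]) (simp add: W_def)
  define \<phi> where "\<phi> z = ?q + fst z *\<^sub>R y (snd z)" for z :: "real \<times> real"
  define S2 where "S2 = {z \<in> UNIV \<times> W. \<phi> z \<in> ?P}"
  define f where "f z = chart_inv c (\<phi> z) \<otimes>\<^bsub>G\<^esub> \<gamma> (snd z)" for z
  have \<phi>W: "Cinf_on (UNIV \<times> W) \<phi>" unfolding \<phi>_def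
    by (intro Cinf_on_add Cinf_on_scaleR Cinf_on_compose[OF has_coordinates_real yW] Cinf_on_fst Cinf_on_snd
          Cinf_on_ident Cinf_on_const open_Times open_UNIV oW) auto
  have oS2: "open S2"
    using continuous_open_preimage[OF Cinf_on_continuous_on[OF \<phi>W] Cinf_on_open[OF \<phi>W]
      chart_image_open[OF cA]]
    by (simp add: S2_def vimage_def Int_def)
  have \<phi>: "Cinf_on S2 \<phi>" by (rule Cinf_on_subset[OF \<phi>W oS2]) (auto simp: S2_def)
  have f: "smooth_family S2 f" unfolding f_def
  proof (rule smooth_family_mult)
    show "smooth_family S2 (\<lambda>z. chart_inv c (\<phi> z))"
      by (rule smooth_family_compose[OF coordinates_model si \<phi>]) (simp add: S2_def)
    show "smooth_family S2 (\<lambda>z. \<gamma> (snd z))"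
      by (rule smooth_family_compose[OF has_coordinates_real \<gamma> Cinf_on_snd[OF Cinf_on_ident[OF oS2]]])
         (auto simp: S2_def W_def)
  qed
  obtain r where r: "r > 0" "ball ?q r \<subseteq> ?P"
    using chart_image_open[OF cA] chart_one(1)[OF c] openE by blast
  have "compact (y ` {a..b})"
    by (rule compact_continuous_image[OF continuous_on_subset[OF Cinf_on_continuous_on[OF y(1)] y(2)]]) simp
  then obtain K where K: "K > 0" "\<And>t. t \<in> {a..b} \<Longrightarrow> norm (y t) \<le> K"
    using compact_imp_bounded[of "y ` {a..b}"] by (auto simp: bounded_pos)
  \<comment> \<open>The coordinates stay in the domain of the chart: they lie within \<open>r\<close> of the identity
    because \<open>y\<close> is bounded by \<open>K\<close>.\<close>
  define \<delta> where "\<delta> = r / K"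
  have \<delta>: "\<delta> > 0" using r K by (simp add: \<delta>_def)
  have S2: "{-\<delta><..<\<delta>} \<times> {a..b} \<subseteq> S2"
  proof clarify
    fix \<epsilon> t assume \<epsilon>: "\<epsilon> \<in> {-\<delta><..<\<delta>}" and t: "t \<in> {a..b}"
    have "\<bar>\<epsilon>\<bar> * norm (y t) \<le> \<bar>\<epsilon>\<bar> * K" by (rule mult_left_mono[OF K(2)[OF t]]) simp
    also have "\<dots> < \<delta> * K" using \<epsilon> K(1) by (intro mult_strict_right_mono) auto
    also have "\<dots> = r" using K(1) by (simp add: \<delta>_def)
    finally have "\<phi> (\<epsilon>, t) \<in> ball ?q r" by (simp add: \<phi>_def dist_norm)
    then show "(\<epsilon>, t) \<in> S2" using r(2) t abW by (auto simp: S2_def)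
  qed
  define \<Gamma> where "\<Gamma> \<epsilon> t = f (\<epsilon>, t)" for \<epsilon> t
  have still: "\<Gamma> \<epsilon> t = g t" if "t \<in> {a..b}" "\<epsilon> *\<^sub>R y t = 0" for \<epsilon> t
  proof -
    have "\<gamma> t \<in> carrier G" using smooth_family_carrier[OF \<gamma>] S that(1) by auto
    moreover have "\<phi> (\<epsilon>, t) = ?q" unfolding \<phi>_def fst_conv snd_conv that(2) by simp
    ultimately show ?thesis using that(1) by (simp add: \<Gamma>_def f_def chart_one(2)[OF c] g)
  qed
  have "fixed_endpoint_variation T A a b g \<Gamma>"
    unfolding fixed_endpoint_variation_def
  proof (intro conjI ballI exI[of _ \<delta>])
    show "smooth_into T A ({-\<delta><..<\<delta>} \<times> {a..b}) (\<lambda>(\<epsilon>, t). \<Gamma> \<epsilon> t)"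
      by (rule smooth_intoI[OF f S2]) (auto simp: \<Gamma>_def)
  qed (use still ya yb ab \<delta> in auto)
  then have 0: "((\<lambda>\<epsilon>. integral {a..b} (\<lambda>t. L (\<Gamma> \<epsilon> t, velocity A {a..b} (\<Gamma> \<epsilon>) t)))
    has_real_derivative 0) (at 0)"
    using ham unfolding hamilton_principle_def by blast
  have y_eq: "darboux c f (0, t) (1, 0) = y t" if t: "t \<in> W" for t
  proof -
    have "(0, t) \<in> S2" using t chart_one(1)[OF c] by (simp add: S2_def \<phi>_def)
    then have "darboux c f (0, t) (1, 0) = darboux c (\<lambda>\<epsilon>. f (\<epsilon>, t)) 0 1" by (rule
      darboux_fst_direction[OF f])
    also have "\<dots> = y t"
      unfolding f_def \<phi>_def fst_conv snd_conv
      by (rule darboux_chart_line(3)[OF c]) (use t smooth_family_carrier[OF \<gamma>] in \<open>auto simp: W_def\<close>)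
    finally show ?thesis .
  qed
  let ?I = "\<lambda>t. fderiv ?l (x t) (fderiv y t 1 - chart_bracket c (x t) (y t))"
  have "integral {a..b} (\<lambda>t. fderiv ?l (x t) (fderiv (\<lambda>t. darboux c f (0, t) (1, 0)) t 1
      - chart_bracket c (x t) (darboux c f (0, t) (1, 0)))) = integral {a..b} ?I"
  proof (rule integral_cong)
    fix t assume "t \<in> {a..b}"
    then have t: "t \<in> W" using abW by auto
    have "fderiv (\<lambda>t. darboux c f (0, t) (1, 0)) t = fderiv y t"
      by (rule fderiv_cong[OF oW t]) (rule y_eq)
    then show "fderiv ?l (x t) (fderiv (\<lambda>t. darboux c f (0, t) (1, 0)) t 1
      - chart_bracket c (x t) (darboux c f (0, t) (1, 0))) = ?I t" by (simp only: y_eq[OF t])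
  qed
  then have "integral {a..b} ?I = 0"
    using DERIV_unique[OF action_derivative[OF f \<delta> S2, of \<Gamma>] 0] still by (simp add: \<Gamma>_def)
  moreover have "Cinf_on W ?I"
    by (intro Cinf_on_momentum Cinf_on_diff Cinf_on_fderiv yW Cinf_on_chart_bracket[OF c]
          Cinf_on_subset[OF Cinf_on_velocity oW]) (auto simp: W_def)
  then have "?I integrable_on {a..b}"
    using continuous_on_subset[OF Cinf_on_continuous_on abW] integrable_continuous_real by blast
  ultimately show "(?I has_integral 0) {a..b}" by (simp add: has_integral_integrable_integral)
qed

end

end

section \<open>Euler-Poincare reduction\<close>

theorem theorem24p2:
  fixes G :: "('a, 'm) monoid_scheme"
    and T :: "'a topology"
    and A :: "('a, 'e::real_normed_vector) chart set"
    and L :: "'a \<times> ('a, 'e) tangent \<Rightarrow> real"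
    and l :: "('a, 'e) tangent \<Rightarrow> real"
    and g :: "real \<Rightarrow> 'a"
    and \<xi> :: "real \<Rightarrow> ('a, 'e) tangent"
    and a b :: real
  assumes "lie_group G T A"
    and "smooth_lagrangian A L"
    and "right_invariant G A L"
    and "l = reduced_lagrangian G L"
    and "a < b"
    and "smooth_into T A {a..b} g"
    and "\<xi> = reduced_velocity G A {a..b} g"
  shows "(euler_lagrange A L a b g \<longleftrightarrow> hamilton_principle T A L a b g)
    \<and> (hamilton_principle T A L a b g \<longleftrightarrow> euler_poincare G A l a b \<xi>)
    \<and> (euler_poincare G A l a b \<xi> \<longleftrightarrow> reduced_variational_principle G A l a b \<xi>)"
proof -
  interpret lie_group G T A by fact
  obtain S \<gamma> where \<gamma>: "smooth_family S \<gamma>" "{a..b} \<subseteq> S" "\<And>t. t \<in> {a..b} \<Longrightarrow> \<gamma> t = g t"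
    using smooth_intoE[OF assms(6)] by blast
  have g: "\<And>t. t \<in> {a..b} \<Longrightarrow> g t = \<gamma> t" using \<gamma>(3) by simp
  define c where "c = chart_at A \<one>\<^bsub>G\<^esub>"
  have c: "c \<in> charts_at A \<one>\<^bsub>G\<^esub>" unfolding c_def by (rule chart_at_in[OF one_in_topspace])
  note context_facts = c assms(2,3) \<gamma>(1,2) assms(5) g
  have "euler_lagrange A L a b g \<longleftrightarrow> strong_euler_poincare c L a b (\<lambda>t. darboux c \<gamma> t 1)"
    by (rule euler_lagrange_iff_strong[OF context_facts])
  moreover have "euler_poincare G A l a b \<xi> \<longleftrightarrow> strong_euler_poincare c L a b (\<lambda>t. darboux c \<gamma> t 1)"
    unfolding assms(4,7) by (rule euler_poincare_iff_strong[OF context_facts])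
  moreover have "strong_euler_poincare c L a b (\<lambda>t. darboux c \<gamma> t 1)
      \<longleftrightarrow> weak_euler_poincare c L a b (\<lambda>t. darboux c \<gamma> t 1)"
    by (rule strong_iff_weak[OF context_facts])
  moreover have "reduced_variational_principle G A l a b \<xi>
      \<longleftrightarrow> weak_euler_poincare c L a b (\<lambda>t. darboux c \<gamma> t 1)"
    unfolding assms(4,7) by (rule reduced_variational_principle_iff_weak[OF context_facts])
  moreover have "hamilton_principle T A L a b g
      \<longleftrightarrow> weak_euler_poincare c L a b (\<lambda>t. darboux c \<gamma> t 1)"
    using hamilton_if_weak[OF context_facts] weak_if_hamilton[OF context_facts] by blast
  ultimately show ?thesis by blast
qed

end
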